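(* Let $(\mathcal{M},\mathbf{c},N,K)$ be an almost conformal Robinson manifold of dimension $2m+2$, $m>1$. Let $g$ be a metric in $\mathbf{c}$, so that $(\mathcal{M},g,N,K)$ is an almost Robinson manifold with bundle of intrinsic torsions $\mathcal{G}$. Any conformally invariant subbundle of $\mathcal{G}$ must be an intersection of the following (defined in the context): $$\mathcal{S}_{-2}^{0,0},\quad \mathcal{S}_{-1}^{1,0},\ \mathcal{S}_{-1}^{1,1},\ \mathcal{S}_{-1}^{1,2},\quad \mathcal{S}_{-1}^{2,0},\ \mathcal{S}_{-1}^{2,1},\ \mathcal{S}_{-1}^{3,0},\quad \mathcal{S}_0^{1,1},\ \mathcal{S}_0^{1,2},\ \mathcal{S}_0^{1,3},\ (\mathcal{S}_0^{0\times1})_{[2(m-1)i:-1]},\quad \mathcal{S}_1^{0,0},$$ $$(\mathcal{S}_{-1}^{1\times2})_{[x:y]}\ \text{ for }[x:y]\in\mathbb{RP}^1,\qquad(\mathcal{S}_{-1}^{1\times3})_{[z:w]}\ \text{ for }[z:w]\in\mathbb{CP}^1.$$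
   Context: $(\mathcal{M},\mathbf{c})$ is an oriented, time-oriented Lorentzian conformal manifold. An almost Robinson structure $(N,K)$ on it: $N\subset{}^{\mathbb{C}}T\mathcal{M}$ of complex rank $m+1$, totally null for (the complexification of) the metrics in $\mathbf{c}$; $K$ a real line distribution with ${}^{\mathbb{C}}K=N\cap\overline N$. For each $g\in\mathbf{c}$, this is a $Q$-structure with $Q=(\mathbb{R}_{>0}\times\mathbf{U}(m))\ltimes(\mathbb{R}^{2m})^*\subset\mathbf{SO}^0(2m+1,1)$, and the bundle of intrinsic torsions is $\mathcal{G}$, associated to the $Q$-module $\mathbb{V}^*\otimes(\mathfrak{g}/\mathfrak{q})$, where $\mathbb{V}=\mathbb{R}^{2m+1,1}$, $\mathfrak{g}=\mathfrak{so}(2m+1,1)$, $\mathfrak{q}=\mathrm{Lie}(Q)$. By a subbundle of $\mathcal{G}$ is meant one associated to a $Q$-submodule. Such a subbundle (i.e. a torsion class) is conformally invariant if, for almost conformal Robinson manifolds of this dimension, the condition that the intrinsic torsion be a section of it does not depend on the choice of metric in $\mathbf{c}$. Screen bundle $H_K=K^\perp/K$, metric $h$, complex structure $J$ with $-i$-eigenbundle $N/{}^{\mathbb{C}}K$, $+i$-eigenbundle $\overline N/{}^{\mathbb{C}}K$, $\omega_{ij}=J_i{}^kh_{kj}$. Adapted frame $(\ell,e_\alpha,e_{\bar\alpha},k)$: $k\in\Gamma(K)$ nonvanishing, $\ell$ null, $g(k,\ell)=1$, $e_\alpha$ sections of $\overline N$ orthogonal to $\ell$ spanning $\overline N$ modulo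 $K$, $e_{\bar\alpha}=\overline{e_\alpha}$, $h_{\alpha\bar\beta}=g(e_\alpha,e_{\bar\beta})$; $i,j$ run over $\alpha,\bar\alpha$. With $\kappa=g(k,\cdot)$, $\rho_{abc}=3\kappa_{[a}\omega_{bc]}$, $A_{ij}=(\nabla_{e_i}\kappa)(e_j)$, the components of the intrinsic torsion are: $\gamma_i=(\nabla_k\kappa)(e_i)$; $\epsilon=h^{ij}A_{ij}$; $\tau_{ij}=A_{[ij]}$, with $\tau^\omega=\omega^{ij}\tau_{ij}$ and $\tau^\circ_{\alpha\bar\beta}$ the tracefree part of $\tau_{\alpha\bar\beta}$; $\sigma_{ij}$ the tracefree part of $A_{(ij)}$; $E_i=(\nabla_\ell\kappa)(e_i)$; $\zeta_{\alpha\beta}=(\nabla_k\rho)(e_\alpha,e_\beta,\ell)$; $G_{i\beta\gamma}=(\nabla_{e_i}\rho)(e_\beta,e_\gamma,\ell)$, with $G_\alpha=h^{\beta\bar\gamma}G_{\bar\gamma\beta\alpha}$, $G^{\mathrm{sk}}_{\alpha\beta\gamma}=G_{[\alpha\beta\gamma]}$, $G^{\mathrm{hk}}_{\alpha\beta\gamma}=\tfrac23(G_{(\alpha\beta)\gamma}-G_{(\alpha\gamma)\beta})$, $G^\circ_{\bar\alpha\beta\gamma}$ the tracefree part of $G_{\bar\alpha\beta\gamma}$; $B_{\alpha\beta}=(\nabla_\ell\rho)(e_\alpha,e_\beta,\ell)$. The subbundles are defined by the following frame-independent conditions on the components: $\mathcal{S}_{-2}^{0,0}$: $\gamma_i=0$.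 Together with $\gamma_i=0$: $\mathcal{S}_{-1}^{1,0}$: $\tau^\omega=0$; $\mathcal{S}_{-1}^{1,1}$: $\tau_{\alpha\beta}=0$; $\mathcal{S}_{-1}^{1,2}$: $\tau^\circ_{\alpha\bar\beta}=0$; $\mathcal{S}_{-1}^{2,0}$: $\sigma_{\alpha\bar\beta}=0$; $\mathcal{S}_{-1}^{2,1}$: $\sigma_{\alpha\beta}=0$; $\mathcal{S}_{-1}^{3,0}$: $\zeta_{\alpha\beta}=0$; $(\mathcal{S}_{-1}^{1\times2})_{[x:y]}$: $x\sigma_{\alpha\bar\beta}-iy\tau^\circ_{\alpha\bar\beta}=0$. $(\mathcal{S}_{-1}^{1\times3})_{[z:w]}$: $z\tau_{\alpha\beta}+w\zeta_{\alpha\beta}=(z+4iw)\gamma_\alpha=0$. $\mathcal{S}_0^{1,1}$: $G^{\mathrm{sk}}_{\alpha\beta\gamma}=-4i\tau_{\alpha\beta}+\zeta_{\alpha\beta}=0$. $\mathcal{S}_0^{1,2}$: $G^{\mathrm{hk}}_{\alpha\beta\gamma}=2i\tau_{\alpha\beta}+\zeta_{\alpha\beta}=\sigma_{\alpha\beta}=\gamma_i=0$. $\mathcal{S}_0^{1,3}$: $G^\circ_{\bar\alpha\beta\gamma}=\tau^\circ_{\alpha\bar\beta}=\sigma_{\alpha\bar\beta}=\zeta_{\alpha\beta}=\gamma_i=0$. (For $m=2$, $\mathcal{S}_0^{1,1}=\mathcal{S}_0^{1,3}=\mathcal{G}$.) $(\mathcal{S}_0^{0\times1})_{[2(m-1)i:-1]}$: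 $2(m-1)iE_\alpha-G_\alpha=2(m-1)i\tau_{\alpha\beta}+\zeta_{\alpha\beta}=\tau^\circ_{\alpha\bar\beta}=\sigma_{ij}=\gamma_i=0$. $\mathcal{S}_1^{0,0}$: for $m>2$, $B_{\alpha\beta}=2(m-1)iE_\alpha-G_\alpha=G^{\mathrm{sk}}=G^{\mathrm{hk}}=G^\circ=\tau_{\alpha\beta}=\tau^\circ_{\alpha\bar\beta}=\sigma_{ij}=\zeta_{\alpha\beta}=\gamma_i=0$; for $m=2$, $B_{\alpha\beta}=2iE_\alpha-G_\alpha=G^{\mathrm{hk}}=2i\tau_{\alpha\beta}+\zeta_{\alpha\beta}=\tau^\circ_{\alpha\bar\beta}=\sigma_{ij}=\gamma_i=0$. *)

theory Defs
  imports "HOL-Analysis.Analysis"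
begin

section \<open>The model space and the group Q\<close>

text \<open>
  The integer m is \<open>CARD('m)\<close>.  The index type below has 2m+2 elements; \<open>real^'m idx\<close> serves both
  as the model \<open>\<real>\<^bsup>2m+1,1\<^esup>\<close> of the tangent spaces and as the range of the charts.  The standard basis
  of the model is \<open>x_a = Inl a\<close>, \<open>y_a = Inr (Inl a)\<close> (orthonormal, spanning the screen space) and
  the null vectors l and k with g(k,l) = 1.
\<close>

type_synonym 'm idx = "'m + 'm + bool"

abbreviation il :: "'m idx" where "il \<equiv> Inr (Inr False)"
abbreviation ik :: "'m idx" where "ik \<equiv> Inr (Inr True)"

definition eta :: "real^'m::finite idx^'m idx" where
  "eta = (\<chi> i j. case (i, j) of
      (Inl a, Inl b) \<Rightarrow> (if a = b then 1 else 0)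
    | (Inr (Inl a), Inr (Inl b)) \<Rightarrow> (if a = b then 1 else 0)
    | (Inr (Inr p), Inr (Inr q)) \<Rightarrow> (if p \<noteq> q then 1 else 0)
    | _ \<Rightarrow> 0)"

text \<open>
  J x_a = y_a and J y_a = - x_a, extended by 0 to l and k.
\<close>

definition screen_J :: "real^'m::finite idx^'m idx" where
  "screen_J = (\<chi> i j. case (i, j) of
      (Inr (Inl a), Inl b) \<Rightarrow> (if a = b then 1 else 0)
    | (Inl a, Inr (Inl b)) \<Rightarrow> (if a = b then - 1 else 0)
    | _ \<Rightarrow> 0)"

definition cmat :: "real^'n^'k \<Rightarrow> complex^'n^'k" where
  "cmat A = (\<chi> i j. complex_of_real (A $ i $ j))"

definition re_vec :: "complex^'n \<Rightarrow> real^'n" where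
  "re_vec v = (\<chi> i. Re (v $ i))"

definition im_vec :: "complex^'n \<Rightarrow> real^'n" where
  "im_vec v = (\<chi> i. Im (v $ i))"

definition cnj_vec :: "complex^'n \<Rightarrow> complex^'n" where
  "cnj_vec v = (\<chi> i. cnj (v $ i))"

text \<open>The complex-bilinear extension of a real bilinear form.\<close>

definition cbil :: "real^'n^'n \<Rightarrow> complex^'n \<Rightarrow> complex^'n \<Rightarrow> complex" where
  "cbil G v w = (\<Sum>i\<in>UNIV. \<Sum>j\<in>UNIV. complex_of_real (G $ i $ j) * v $ i * w $ j)"

text \<open>
  The model of N: spanned over the complex numbers by k and the vectors x_a + i y_a, which are the
  (-i)-eigenvectors of J.
\<close>

definition N_model :: "(complex^'m::finite idx) set" where
  "N_model = {v. v $ il = 0 \<and> (\<forall>a. v $ Inr (Inl a) = \<i> * v $ Inl a)}"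

text \<open>
  The identity component of the isometry group: k - l is timelike, so the last condition says that
  the time orientation is preserved.
\<close>

definition SO0 :: "(real^'m::finite idx^'m idx) set" where
  "SO0 = {q. transpose q ** eta ** q = eta \<and> det q = 1 \<and>
     (let t = axis ik 1 - axis il 1 in (q *v t) \<bullet> (eta *v t) < 0)}"

text \<open>
  Q is the stabiliser of the model N in SO0.  Being real, its elements preserve the real line
  spanned by k, on which they act by a positive factor; on the screen space they act by unitary
  maps, and the remaining freedom is that of the choice of l.
\<close>

definition Q_group :: "(real^'m::finite idx^'m idx) set" where
  "Q_group = {q \<in> SO0. (*v) (cmat q) ` N_model = N_model}"

definition so_alg :: "(real^'m::finite idx^'m idx) set" where
  "so_alg = {A. transpose A ** eta + eta ** A = 0}"

definition q_alg :: "(real^'m::finite idx^'m idx) set" where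
  "q_alg = {A \<in> so_alg. (*v) (cmat A) ` N_model \<subseteq> N_model}"


section \<open>The module of intrinsic torsions\<close>

type_synonym 'm tensor = "real^'m idx \<Rightarrow> real^'m idx^'m idx"

definition conn_space :: "('m::finite tensor) set" where
  "conn_space = {T. linear T \<and> (\<forall>v. T v \<in> so_alg)}"

text \<open>The elements of \<open>V\<^sup>* \<otimes> (so/q)\<close> are cosets of \<open>V\<^sup>* \<otimes> q\<close> in \<open>V\<^sup>* \<otimes> so\<close>.\<close>

definition torsion_class :: "'m::finite tensor \<Rightarrow> 'm tensor set" where
  "torsion_class T = {S \<in> conn_space. \<forall>v. S v - T v \<in> q_alg}"

definition torsion_module :: "('m::finite tensor set) set" where
  "torsion_module = torsion_class ` conn_space"

definition Q_act :: "real^'m::finite idx^'m idx \<Rightarrow> 'm tensor set \<Rightarrow> 'm tensor set" where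
  "Q_act q C = (\<lambda>T v. q ** T (matrix_inv q *v v) ** matrix_inv q) ` C"

definition Q_submodule :: "('m::finite tensor set) set \<Rightarrow> bool" where
  "Q_submodule W \<longleftrightarrow>
     W \<subseteq> torsion_module \<and>
     torsion_class (\<lambda>v. 0) \<in> W \<and>
     (\<forall>S\<in>conn_space. \<forall>T\<in>conn_space. torsion_class S \<in> W \<longrightarrow> torsion_class T \<in> W \<longrightarrow>
        torsion_class (\<lambda>v. S v + T v) \<in> W) \<and>
     (\<forall>r. \<forall>T\<in>conn_space. torsion_class T \<in> W \<longrightarrow> torsion_class (\<lambda>v. r *\<^sub>R T v) \<in> W) \<and>
     (\<forall>q\<in>Q_group. \<forall>C\<in>W. Q_act q C \<in> W)"


section \<open>Components of an intrinsic torsion\<close>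

text \<open>
  A tensor T is read as the Levi-Civita connection form in an adapted frame, so that
  \<open>\<nabla>\<^sub>u\<close> acts on tensors with constant components in that frame, such as \<open>\<kappa>\<close> and \<open>\<rho>\<close>, as the
  endomorphism T(u) does.  Everything is extended complex multilinearly.
\<close>

definition ctensor :: "'m::finite tensor \<Rightarrow> complex^'m idx \<Rightarrow> complex^'m idx^'m idx" where
  "ctensor T u = (\<chi> i j. Complex (T (re_vec u) $ i $ j) (T (im_vec u) $ i $ j))"

definition vk :: "complex^'m::finite idx" where "vk = axis ik 1"
definition vl :: "complex^'m::finite idx" where "vl = axis il 1"

text \<open>
  The index type \<open>'m + 'm\<close> of the screen frame plays the role of i, j: \<open>Inl a\<close> is \<open>\<alpha>\<close> and \<open>Inr a\<close> is
  \<open>\<alpha>\<close>-bar.  The frame \<open>e_\<alpha> = x_\<alpha> - i y_\<alpha>\<close> has \<open>g(e_\<alpha>, e_\<beta>-bar) = 2 \<delta>_\<alpha>\<beta>\<close>, whence the factor 1/2 in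
  the inverse.
\<close>

definition fr :: "'m::finite + 'm \<Rightarrow> complex^'m idx" where
  "fr i = (case i of
      Inl a \<Rightarrow> axis (Inl a) 1 - axis (Inr (Inl a)) \<i>
    | Inr a \<Rightarrow> axis (Inl a) 1 + axis (Inr (Inl a)) \<i>)"

definition h_low :: "'m::finite + 'm \<Rightarrow> 'm + 'm \<Rightarrow> complex" where
  "h_low i j = cbil eta (fr i) (fr j)"

definition h_up :: "'m + 'm \<Rightarrow> 'm + 'm \<Rightarrow> complex" where
  "h_up i j = (case (i, j) of
      (Inl a, Inr b) \<Rightarrow> (if a = b then 1/2 else 0)
    | (Inr a, Inl b) \<Rightarrow> (if a = b then 1/2 else 0)
    | _ \<Rightarrow> 0)"

definition kappa :: "complex^'m::finite idx \<Rightarrow> complex" where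
  "kappa v = cbil eta vk v"

definition omega :: "complex^'m::finite idx \<Rightarrow> complex^'m idx \<Rightarrow> complex" where
  "omega v w = cbil eta (cmat screen_J *v v) w"

definition rho ::
  "complex^'m::finite idx \<Rightarrow> complex^'m idx \<Rightarrow> complex^'m idx \<Rightarrow> complex" where
  "rho u v w = kappa u * omega v w + kappa v * omega w u + kappa w * omega u v"

definition nabla_kappa ::
  "'m::finite tensor \<Rightarrow> complex^'m idx \<Rightarrow> complex^'m idx \<Rightarrow> complex" where
  "nabla_kappa T u v = - kappa (ctensor T u *v v)"

definition nabla_rho ::
  "'m::finite tensor \<Rightarrow> complex^'m idx \<Rightarrow>
     complex^'m idx \<Rightarrow> complex^'m idx \<Rightarrow> complex^'m idx \<Rightarrow> complex" where
  "nabla_rho T u v w z =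
     - rho (ctensor T u *v v) w z - rho v (ctensor T u *v w) z - rho v w (ctensor T u *v z)"

definition c_A :: "'m::finite tensor \<Rightarrow> 'm + 'm \<Rightarrow> 'm + 'm \<Rightarrow> complex" where
  "c_A T i j = nabla_kappa T (fr i) (fr j)"

definition c_gamma :: "'m::finite tensor \<Rightarrow> 'm + 'm \<Rightarrow> complex" where
  "c_gamma T i = nabla_kappa T vk (fr i)"

definition c_eps :: "'m::finite tensor \<Rightarrow> complex" where
  "c_eps T = (\<Sum>i\<in>UNIV. \<Sum>j\<in>UNIV. h_up i j * c_A T i j)"

definition c_tau :: "'m::finite tensor \<Rightarrow> 'm + 'm \<Rightarrow> 'm + 'm \<Rightarrow> complex" where
  "c_tau T i j = (c_A T i j - c_A T j i) / 2"

definition omega_up :: "'m::finite + 'm \<Rightarrow> 'm + 'm \<Rightarrow> complex" where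
  "omega_up i j = (\<Sum>k\<in>UNIV. \<Sum>l\<in>UNIV. h_up i k * h_up j l * omega (fr k) (fr l))"

definition c_tau_omega :: "'m::finite tensor \<Rightarrow> complex" where
  "c_tau_omega T = (\<Sum>i\<in>UNIV. \<Sum>j\<in>UNIV. omega_up i j * c_tau T i j)"

text \<open>The arguments a and b of \<open>c_tau_free T a b\<close> stand for \<open>\<alpha>\<close> and \<open>\<beta>\<close>-bar.\<close>

definition c_tau_free :: "'m::finite tensor \<Rightarrow> 'm \<Rightarrow> 'm \<Rightarrow> complex" where
  "c_tau_free T a b = c_tau T (Inl a) (Inr b)
     - h_low (Inl a) (Inr b) / of_nat CARD('m)
       * (\<Sum>c\<in>UNIV. \<Sum>d\<in>UNIV. h_up (Inl c) (Inr d) * c_tau T (Inl c) (Inr d))"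

definition c_sigma :: "'m::finite tensor \<Rightarrow> 'm + 'm \<Rightarrow> 'm + 'm \<Rightarrow> complex" where
  "c_sigma T i j = (c_A T i j + c_A T j i) / 2
     - h_low i j / of_nat (2 * CARD('m)) * c_eps T"

definition c_E :: "'m::finite tensor \<Rightarrow> 'm + 'm \<Rightarrow> complex" where
  "c_E T i = nabla_kappa T vl (fr i)"

definition c_zeta :: "'m::finite tensor \<Rightarrow> 'm \<Rightarrow> 'm \<Rightarrow> complex" where
  "c_zeta T a b = nabla_rho T vk (fr (Inl a)) (fr (Inl b)) vl"

definition c_G :: "'m::finite tensor \<Rightarrow> 'm + 'm \<Rightarrow> 'm \<Rightarrow> 'm \<Rightarrow> complex" where
  "c_G T i b c = nabla_rho T (fr i) (fr (Inl b)) (fr (Inl c)) vl"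

definition c_G_trace :: "'m::finite tensor \<Rightarrow> 'm \<Rightarrow> complex" where
  "c_G_trace T a = (\<Sum>b\<in>UNIV. \<Sum>c\<in>UNIV. h_up (Inl b) (Inr c) * c_G T (Inr c) b a)"

definition c_G_sk :: "'m::finite tensor \<Rightarrow> 'm \<Rightarrow> 'm \<Rightarrow> 'm \<Rightarrow> complex" where
  "c_G_sk T a b c =
     (c_G T (Inl a) b c + c_G T (Inl b) c a + c_G T (Inl c) a b
      - c_G T (Inl a) c b - c_G T (Inl b) a c - c_G T (Inl c) b a) / 6"

definition c_G_hk :: "'m::finite tensor \<Rightarrow> 'm \<Rightarrow> 'm \<Rightarrow> 'm \<Rightarrow> complex" where
  "c_G_hk T a b c = 2/3 *
     ((c_G T (Inl a) b c + c_G T (Inl b) a c) / 2 - (c_G T (Inl a) c b + c_G T (Inl c) a b) / 2)"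

text \<open>
  In \<open>c_G_free T a b c\<close> the argument a stands for \<open>\<alpha>\<close>-bar.  The coefficient of the trace comes from
  contracting \<open>h_(\<beta>\<alpha>-bar) G_\<gamma> - h_(\<gamma>\<alpha>-bar) G_\<beta>\<close>, which gives \<open>(m - 1) G_\<gamma>\<close>.
\<close>

definition c_G_free :: "'m::finite tensor \<Rightarrow> 'm \<Rightarrow> 'm \<Rightarrow> 'm \<Rightarrow> complex" where
  "c_G_free T a b c = c_G T (Inr a) b c
     - (h_low (Inl b) (Inr a) * c_G_trace T c - h_low (Inl c) (Inr a) * c_G_trace T b)
       / (of_nat CARD('m) - 1)"

definition c_B :: "'m::finite tensor \<Rightarrow> 'm \<Rightarrow> 'm \<Rightarrow> complex" where
  "c_B T a b = nabla_rho T vl (fr (Inl a)) (fr (Inl b)) vl"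


section \<open>The distinguished submodules\<close>

text \<open>
  The components do not change under \<open>V\<^sup>* \<otimes> q\<close>, so it does not matter which representative
  of a class they are evaluated on.  In the names, \<open>S_m1_20\<close> stands for the submodule with lower
  index -1 and upper indices 2,0.
\<close>

definition cut :: "('m::finite tensor \<Rightarrow> bool) \<Rightarrow> ('m tensor set) set" where
  "cut P = {C \<in> torsion_module. \<forall>T\<in>C. P T}"

definition S_m2_00 :: "('m::finite tensor set) set" where
  "S_m2_00 = cut (\<lambda>T. \<forall>i. c_gamma T i = 0)"

definition S_m1_10 :: "('m::finite tensor set) set" where
  "S_m1_10 = cut (\<lambda>T. c_tau_omega T = 0 \<and> (\<forall>i. c_gamma T i = 0))"

definition S_m1_11 :: "('m::finite tensor set) set" where
  "S_m1_11 = cut (\<lambda>T. (\<forall>a b. c_tau T (Inl a) (Inl b) = 0) \<and> (\<forall>i. c_gamma T i = 0))"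

definition S_m1_12 :: "('m::finite tensor set) set" where
  "S_m1_12 = cut (\<lambda>T. (\<forall>a b. c_tau_free T a b = 0) \<and> (\<forall>i. c_gamma T i = 0))"

definition S_m1_20 :: "('m::finite tensor set) set" where
  "S_m1_20 = cut (\<lambda>T. (\<forall>a b. c_sigma T (Inl a) (Inr b) = 0) \<and> (\<forall>i. c_gamma T i = 0))"

definition S_m1_21 :: "('m::finite tensor set) set" where
  "S_m1_21 = cut (\<lambda>T. (\<forall>a b. c_sigma T (Inl a) (Inl b) = 0) \<and> (\<forall>i. c_gamma T i = 0))"

definition S_m1_30 :: "('m::finite tensor set) set" where
  "S_m1_30 = cut (\<lambda>T. (\<forall>a b. c_zeta T a b = 0) \<and> (\<forall>i. c_gamma T i = 0))"

definition S_m1_1x2 :: "real \<Rightarrow> real \<Rightarrow> ('m::finite tensor set) set" where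
  "S_m1_1x2 x y = cut (\<lambda>T.
     (\<forall>a b. of_real x * c_sigma T (Inl a) (Inr b) - \<i> * of_real y * c_tau_free T a b = 0) \<and>
     (\<forall>i. c_gamma T i = 0))"

definition S_m1_1x3 :: "complex \<Rightarrow> complex \<Rightarrow> ('m::finite tensor set) set" where
  "S_m1_1x3 z w = cut (\<lambda>T.
     (\<forall>a b. z * c_tau T (Inl a) (Inl b) + w * c_zeta T a b = 0) \<and>
     (\<forall>a. (z + 4 * \<i> * w) * c_gamma T (Inl a) = 0))"

definition S_0_11 :: "('m::finite tensor set) set" where
  "S_0_11 = (if CARD('m) = 2 then torsion_module else cut (\<lambda>T.
     (\<forall>a b c. c_G_sk T a b c = 0) \<and>
     (\<forall>a b. - 4 * \<i> * c_tau T (Inl a) (Inl b) + c_zeta T a b = 0)))"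

definition S_0_12 :: "('m::finite tensor set) set" where
  "S_0_12 = cut (\<lambda>T.
     (\<forall>a b c. c_G_hk T a b c = 0) \<and>
     (\<forall>a b. 2 * \<i> * c_tau T (Inl a) (Inl b) + c_zeta T a b = 0) \<and>
     (\<forall>a b. c_sigma T (Inl a) (Inl b) = 0) \<and>
     (\<forall>i. c_gamma T i = 0))"

definition S_0_13 :: "('m::finite tensor set) set" where
  "S_0_13 = (if CARD('m) = 2 then torsion_module else cut (\<lambda>T.
     (\<forall>a b c. c_G_free T a b c = 0) \<and>
     (\<forall>a b. c_tau_free T a b = 0) \<and>
     (\<forall>a b. c_sigma T (Inl a) (Inr b) = 0) \<and>
     (\<forall>a b. c_zeta T a b = 0) \<and>
     (\<forall>i. c_gamma T i = 0)))"

definition S_0_0x1 :: "('m::finite tensor set) set" where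
  "S_0_0x1 = cut (\<lambda>T.
     (\<forall>a. 2 * (of_nat CARD('m) - 1) * \<i> * c_E T (Inl a) - c_G_trace T a = 0) \<and>
     (\<forall>a b. 2 * (of_nat CARD('m) - 1) * \<i> * c_tau T (Inl a) (Inl b) + c_zeta T a b = 0) \<and>
     (\<forall>a b. c_tau_free T a b = 0) \<and>
     (\<forall>i j. c_sigma T i j = 0) \<and>
     (\<forall>i. c_gamma T i = 0))"

definition S_1_00 :: "('m::finite tensor set) set" where
  "S_1_00 = (if CARD('m) = 2 then cut (\<lambda>T.
       (\<forall>a b. c_B T a b = 0) \<and>
       (\<forall>a. 2 * \<i> * c_E T (Inl a) - c_G_trace T a = 0) \<and>
       (\<forall>a b c. c_G_hk T a b c = 0) \<and>
       (\<forall>a b. 2 * \<i> * c_tau T (Inl a) (Inl b) + c_zeta T a b = 0) \<and>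
       (\<forall>a b. c_tau_free T a b = 0) \<and>
       (\<forall>i j. c_sigma T i j = 0) \<and>
       (\<forall>i. c_gamma T i = 0))
     else cut (\<lambda>T.
       (\<forall>a b. c_B T a b = 0) \<and>
       (\<forall>a. 2 * (of_nat CARD('m) - 1) * \<i> * c_E T (Inl a) - c_G_trace T a = 0) \<and>
       (\<forall>a b c. c_G_sk T a b c = 0) \<and>
       (\<forall>a b c. c_G_hk T a b c = 0) \<and>
       (\<forall>a b c. c_G_free T a b c = 0) \<and>
       (\<forall>a b. c_tau T (Inl a) (Inl b) = 0) \<and>
       (\<forall>a b. c_tau_free T a b = 0) \<and>
       (\<forall>i j. c_sigma T i j = 0) \<and>
       (\<forall>a b. c_zeta T a b = 0) \<and>
       (\<forall>i. c_gamma T i = 0)))"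

definition distinguished_submodules :: "('m::finite tensor set) set set" where
  "distinguished_submodules =
     {S_m2_00, S_m1_10, S_m1_11, S_m1_12, S_m1_20, S_m1_21, S_m1_30,
      S_0_11, S_0_12, S_0_13, S_0_0x1, S_1_00}
     \<union> {S_m1_1x2 x y |x y. (x, y) \<noteq> (0, 0)}
     \<union> {S_m1_1x3 z w |z w. (z, w) \<noteq> (0, 0)}"


section \<open>Almost conformal Robinson manifolds\<close>

primrec Ck_on ::
  "nat \<Rightarrow> 'a::real_normed_vector set \<Rightarrow> ('a \<Rightarrow> 'b::real_normed_vector) \<Rightarrow> bool" where
  "Ck_on 0 S f \<longleftrightarrow> continuous_on S f"
| "Ck_on (Suc k) S f \<longleftrightarrow>
     f differentiable_on S \<and> (\<forall>v. Ck_on k S (\<lambda>x. frechet_derivative f (at x) v))"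

text \<open>Only meant for open S, where the derivatives above are determined by f on S.\<close>

definition smooth_on ::
  "'a::real_normed_vector set \<Rightarrow> ('a \<Rightarrow> 'b::real_normed_vector) \<Rightarrow> bool" where
  "smooth_on S f \<longleftrightarrow> (\<forall>k. Ck_on k S f)"

type_synonym ('p, 'm) chart = "'p set \<times> ('p \<Rightarrow> real^'m idx)"

text \<open>
  A tensor field is given by its components in each chart of the atlas, as functions of
  the coordinates, related on overlaps by the usual transformation law.
\<close>

type_synonym ('p, 'm) metric_field = "('p, 'm) chart \<Rightarrow> real^'m idx \<Rightarrow> real^'m idx^'m idx"

text \<open>
  The data \<open>(M, c, N, K)\<close>, with a smooth atlas.  The time orientation is
  represented by a future-directed vector field that is timelike for the metrics in c.
\<close>

record ('p, 'm) robinson_data =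
  points :: "'p topology"
  atlas :: "('p, 'm::finite) chart set"
  future :: "('p, 'm) chart \<Rightarrow> real^'m idx \<Rightarrow> real^'m idx"
  conf_class :: "('p, 'm) metric_field set"
  Ndist :: "('p, 'm) chart \<Rightarrow> real^'m idx \<Rightarrow> (complex^'m idx) set"
  Kdist :: "('p, 'm) chart \<Rightarrow> real^'m idx \<Rightarrow> (real^'m idx) set"

definition transition ::
  "('p, 'm) chart \<Rightarrow> ('p, 'm) chart \<Rightarrow> real^'m::finite idx \<Rightarrow> real^'m idx" where
  "transition c d = (\<lambda>x. snd d (inv_into (fst c) (snd c) x))"

definition jac ::
  "('p, 'm) chart \<Rightarrow> ('p, 'm) chart \<Rightarrow> 'p \<Rightarrow> real^'m::finite idx^'m idx" where
  "jac c d p = matrix (frechet_derivative (transition c d) (at (snd c p)))"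

text \<open>The orientation is the one for which all charts of the atlas are positive.\<close>

definition oriented_manifold :: "('p, 'm::finite) robinson_data \<Rightarrow> bool" where
  "oriented_manifold M \<longleftrightarrow>
     Hausdorff_space (points M) \<and> second_countable (points M) \<and>
     topspace (points M) = \<Union> (fst ` atlas M) \<and>
     (\<forall>c\<in>atlas M. openin (points M) (fst c) \<and> open (snd c ` fst c) \<and>
        homeomorphic_map (subtopology (points M) (fst c))
          (top_of_set (snd c ` fst c)) (snd c)) \<and>
     (\<forall>c\<in>atlas M. \<forall>d\<in>atlas M.
        smooth_on (snd c ` (fst c \<inter> fst d)) (transition c d) \<and>
        (\<forall>p\<in>fst c \<inter> fst d. det (jac c d p) > 0))"

definition lorentzian_metric ::
  "('p, 'm::finite) robinson_data \<Rightarrow> ('p, 'm) metric_field \<Rightarrow> bool" where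
  "lorentzian_metric M g \<longleftrightarrow>
     (\<forall>c\<in>atlas M. smooth_on (snd c ` fst c) (g c) \<and>
        (\<forall>x\<in>snd c ` fst c. transpose (g c x) = g c x \<and>
           (\<exists>P. invertible P \<and> transpose P ** g c x ** P = (eta :: real^'m idx^'m idx)))) \<and>
     (\<forall>c\<in>atlas M. \<forall>d\<in>atlas M. \<forall>p\<in>fst c \<inter> fst d.
        g c (snd c p) = transpose (jac c d p) ** g d (snd d p) ** jac c d p)"

definition conformally_related ::
  "('p, 'm::finite) robinson_data \<Rightarrow> ('p, 'm) metric_field \<Rightarrow> ('p, 'm) metric_field \<Rightarrow> bool" where
  "conformally_related M g g' \<longleftrightarrow>
     (\<exists>f. (\<forall>p\<in>topspace (points M). f p > 0) \<and>
          (\<forall>c\<in>atlas M. smooth_on (snd c ` fst c) (\<lambda>x. f (inv_into (fst c) (snd c) x)) \<and>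
             (\<forall>p\<in>fst c. g' c (snd c p) = f p *\<^sub>R g c (snd c p))))"

definition conformal_structure :: "('p, 'm::finite) robinson_data \<Rightarrow> bool" where
  "conformal_structure M \<longleftrightarrow>
     (\<exists>g. lorentzian_metric M g \<and> conf_class M = {g'. conformally_related M g g'})"

definition time_orientation :: "('p, 'm::finite) robinson_data \<Rightarrow> bool" where
  "time_orientation M \<longleftrightarrow>
     (\<forall>c\<in>atlas M. smooth_on (snd c ` fst c) (future M c) \<and>
        (\<forall>g\<in>conf_class M. \<forall>x\<in>snd c ` fst c. future M c x \<bullet> (g c x *v future M c x) < 0)) \<and>
     (\<forall>c\<in>atlas M. \<forall>d\<in>atlas M. \<forall>p\<in>fst c \<inter> fst d.
        future M d (snd d p) = jac c d p *v future M c (snd c p))"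

definition almost_robinson :: "('p, 'm::finite) robinson_data \<Rightarrow> bool" where
  "almost_robinson M \<longleftrightarrow>
     (\<forall>c\<in>atlas M. \<forall>x\<in>snd c ` fst c.
        vec.subspace (Ndist M c x) \<and> vec.dim (Ndist M c x) = CARD('m) + 1 \<and>
        (\<exists>V n. open V \<and> x \<in> V \<and> V \<subseteq> snd c ` fst c \<and> (\<forall>j\<le>CARD('m). smooth_on V (n j)) \<and>
           (\<forall>y\<in>V. Ndist M c y = vec.span ((\<lambda>j. n j y) ` {..CARD('m)}))) \<and>
        (\<forall>g\<in>conf_class M. \<forall>v\<in>Ndist M c x. \<forall>w\<in>Ndist M c x. cbil (g c x) v w = 0) \<and>
        subspace (Kdist M c x) \<and> dim (Kdist M c x) = 1 \<and>
        (\<exists>V k. open V \<and> x \<in> V \<and> V \<subseteq> snd c ` fst c \<and> smooth_on V k \<and>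
           (\<forall>y\<in>V. Kdist M c y = span {k y})) \<and>
        {v. re_vec v \<in> Kdist M c x \<and> im_vec v \<in> Kdist M c x}
          = Ndist M c x \<inter> cnj_vec ` Ndist M c x) \<and>
     (\<forall>c\<in>atlas M. \<forall>d\<in>atlas M. \<forall>p\<in>fst c \<inter> fst d.
        Ndist M d (snd d p) = (*v) (cmat (jac c d p)) ` Ndist M c (snd c p) \<and>
        Kdist M d (snd d p) = (*v) (jac c d p) ` Kdist M c (snd c p))"

definition almost_conformal_robinson_manifold :: "('p, 'm::finite) robinson_data \<Rightarrow> bool" where
  "almost_conformal_robinson_manifold M \<longleftrightarrow>
     oriented_manifold M \<and> conformal_structure M \<and> time_orientation M \<and> almost_robinson M"


section \<open>Intrinsic torsion and conformal invariance\<close>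

text \<open>
  The fibre at the point with coordinates x of the Q-structure of \<open>(M, g, N, K)\<close>: the columns of P
  are the images in the chart c of the basis of the model.  As k is real, it is mapped into K.
  Any two such P differ by an element of Q (whose determinant is 1), so that the Q-structure itself
  singles out one of the two orientations of M; no compatibility with the given one is imposed.
\<close>

definition adapted_frames ::
  "('p, 'm::finite) robinson_data \<Rightarrow> ('p, 'm) metric_field \<Rightarrow> ('p, 'm) chart \<Rightarrow>
     real^'m idx \<Rightarrow> (real^'m idx^'m idx) set" where
  "adapted_frames M g c x = {P.
     transpose P ** g c x ** P = eta \<and>
     (*v) (cmat P) ` N_model = Ndist M c x \<and>
     (P *v axis ik 1) \<bullet> (g c x *v future M c x) < 0}"

text \<open>The matrix \<open>(v\<^sup>i \<Gamma>\<^sup>k\<^sub>i\<^sub>j)\<^sub>k\<^sub>j\<close> of Christoffel symbols of the metric with components G.\<close>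

definition christoffel ::
  "(real^'n \<Rightarrow> real^'n^'n) \<Rightarrow> real^'n \<Rightarrow> real^'n \<Rightarrow> real^'n^'n" where
  "christoffel G x v =
     (let D = (\<lambda>w. frechet_derivative G (at x) w) in
      \<chi> k j. 1/2 * (\<Sum>l\<in>UNIV. matrix_inv (G x) $ k $ l *
        (\<Sum>i\<in>UNIV. v $ i *
           (D (axis i 1) $ j $ l + D (axis j 1) $ i $ l - D (axis l 1) $ i $ j))))"

text \<open>
  The Levi-Civita connection form of the frame field F, as a function on the model:
  \<open>\<nabla>\<^sub>v e\<^sub>b = \<Sum>\<^sub>a (conn_form G F x u)\<^sub>a\<^sub>b e\<^sub>a\<close>, where v is the tangent vector with components u in the frame.
\<close>

definition conn_form ::
  "(real^'m::finite idx \<Rightarrow> real^'m idx^'m idx) \<Rightarrow> (real^'m idx \<Rightarrow> real^'m idx^'m idx) \<Rightarrow>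
     real^'m idx \<Rightarrow> 'm tensor" where
  "conn_form G F x = (\<lambda>u. matrix_inv (F x) **
     (frechet_derivative F (at x) (F x *v u) + christoffel G x (F x *v u) ** F x))"

text \<open>
  The intrinsic torsion is the section of the bundle associated to \<open>torsion_module\<close> which an adapted
  frame P at a point identifies with the class of the connection form of any local
  adapted frame field through P (the class does not depend on the extension).
\<close>

definition intrinsic_torsion_in ::
  "('p, 'm::finite) robinson_data \<Rightarrow> ('p, 'm) metric_field \<Rightarrow> ('m tensor set) set \<Rightarrow> bool" where
  "intrinsic_torsion_in M g W \<longleftrightarrow>
     (\<forall>c\<in>atlas M. \<forall>V F. open V \<and> V \<subseteq> snd c ` fst c \<and> smooth_on V F \<and>
        (\<forall>x\<in>V. F x \<in> adapted_frames M g c x) \<longrightarrow>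
        (\<forall>x\<in>V. torsion_class (conn_form (g c) F x) \<in> W))"

text \<open>
  Quantifying over manifolds whose points lie in the type \<open>real^'m idx\<close>, with an arbitrary
  topology, is no restriction: a second countable Hausdorff manifold has at most
  continuum many points.
\<close>

definition conformally_invariant :: "('m::finite tensor set) set \<Rightarrow> bool" where
  "conformally_invariant W \<longleftrightarrow>
     (\<forall>M :: (real^'m idx, 'm) robinson_data. almost_conformal_robinson_manifold M \<longrightarrow>
        (\<forall>g\<in>conf_class M. \<forall>g'\<in>conf_class M.
           intrinsic_torsion_in M g W \<longleftrightarrow> intrinsic_torsion_in M g' W))"

text \<open>
  The bundle associated to W, as pairs of a point and an equivariant map from the adapted frames at
  this point into W.  A frame is given by a chart and a matrix, up to change of chart.
\<close>

definition associated_bundle ::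
  "('p, 'm::finite) robinson_data \<Rightarrow> ('p, 'm) metric_field \<Rightarrow> ('m tensor set) set \<Rightarrow>
     ('p \<times> (('p, 'm) chart \<times> (real^'m idx^'m idx) \<Rightarrow> 'm tensor set)) set" where
  "associated_bundle M g W =
     (SIGMA p:topspace (points M).
       (let Fr = {(c, P). c \<in> atlas M \<and> p \<in> fst c \<and> P \<in> adapted_frames M g c (snd c p)} in
        {s \<in> extensional Fr. \<forall>(c, P)\<in>Fr. s (c, P) \<in> W \<and>
           (\<forall>q\<in>Q_group. s (c, P ** q) = Q_act (matrix_inv q) (s (c, P))) \<and>
           (\<forall>d\<in>atlas M. p \<in> fst d \<longrightarrow> s (d, jac c d p ** P) = s (c, P))}))"

end

theory Submission
  imports Defs
begin

text \<open>
  On flat space the torsion of the constant metric vanishes, and rescaling it by \<open>exp (2 b \<bullet> x)\<close> turns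
  the torsion at the origin into the class of \<open>v \<mapsto> v \<and> b\<close>; hence a conformally invariant submodule
  contains all these classes, and this is the only use made of conformal invariance.  Being a closed
  subspace, the submodule is also invariant under the Lie algebra of Q.  The grading element and
  the centre of \<open>u(m)\<close> split it into homogeneous pieces.  Outside charge zero these are complex
  subspaces, on which \<open>gl(m, \<complex>)\<close> acts, and normal-ordered products of elementary matrices carry
  any nonzero value of an irreducible component to any other; so such a component is either
  arbitrary or zero on the submodule, and a pair of isomorphic components is arbitrary, zero or
  confined to a line.  When a component vanishes, applying null rotations shows that
  certain combinations of the lower ones vanish as well, and these are exactly the
  conditions defining the distinguished submodules.
\<close>

section \<open>Tuples of components and the action of the stabiliser algebra\<close>

text \<open>The obstacle is that a submodule is only a real space, while its components are complex.
  Away from charge zero the centre of \<open>u(m)\<close> supplies multiplication by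
  \<open>\<i>\<close>. In charge zero the tracefree part of \<open>Am\<close> is two copies of the
  real adjoint representation, the Hermitian and the skew-Hermitian matrices, so its submodules are
  lines in a real plane: hence the real parameter [x:y]. The skew part of \<open>Ap\<close> and
  \<open>Ze\<close> are isomorphic complex modules, hence the complex parameter [z:w]. A null
  rotation carries \<gamma> into one fixed line of that pair, and the functionals vanishing on this
  line do not force \<gamma> to vanish; this is the origin of the factor z + 4iw. The rescaling
  classes contain the real trace of \<open>Am\<close>, so \<epsilon> is never constrained, and
  tuples with \<open>trG = 2 (m - 1) Ee\<close>, which singles out the combination of E and the
  trace of G.\<close>

text \<open>
  The constructors stand for \<open>\<gamma>\<close>, \<open>\<zeta>\<close>, \<open>A\<close> with unbarred and with barred first index, \<open>E\<close>, \<open>G\<close> with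
  unbarred and with barred first index, and \<open>B\<close>; the remaining components are complex conjugates of
  these.  All are values of the trilinear form \<open>g(T(u)v, w)\<close> on frame vectors, so that \<open>\<zeta>\<close>, \<open>G\<close> and \<open>B\<close>,
  which are defined through \<open>\<nabla>\<rho>\<close>, are \<open>2i\<close> times the values used here.
\<close>

datatype 'm cix =
    Ga 'm | Ze 'm 'm | Ap 'm 'm | Am 'm 'm | Ee 'm | Gp 'm 'm 'm | Gm 'm 'm 'm | Be 'm 'm

definition dl :: "'a \<Rightarrow> 'a \<Rightarrow> complex" where
  "dl x y = (if x = y then 1 else 0)"

lemma dl_same [simp]: "dl x x = 1"
  and dl_neq [simp]: "x \<noteq> y \<Longrightarrow> dl x y = 0"
  and cnj_dl [simp]: "cnj (dl x y) = dl x y"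
  by (simp_all add: dl_def)

lemma dl_commute: "dl x y = dl y x"
  by (simp add: dl_def)

lemma sum_dl [simp]:
  fixes f :: "'a::finite \<Rightarrow> complex"
  shows "(\<Sum>b\<in>UNIV. dl b x * f b) = f x" "(\<Sum>b\<in>UNIV. dl x b * f b) = f x"
    "(\<Sum>b\<in>UNIV. f b * dl b x) = f x" "(\<Sum>b\<in>UNIV. f b * dl x b) = f x"
    "(\<Sum>b\<in>UNIV. dl b x) = 1" "(\<Sum>b\<in>UNIV. dl x b) = 1"
proof -
  have *: "(\<Sum>b\<in>UNIV. dl b x * f b) = f x" for f
  proof -
    have "(\<Sum>b\<in>UNIV. dl b x * f b) = (\<Sum>b\<in>UNIV. if b = x then f b else 0)"
      by (rule sum.cong) (auto simp: dl_def)
    then show ?thesis by simp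
  qed
  show "(\<Sum>b\<in>UNIV. dl b x * f b) = f x" "(\<Sum>b\<in>UNIV. dl x b * f b) = f x"
    "(\<Sum>b\<in>UNIV. f b * dl b x) = f x" "(\<Sum>b\<in>UNIV. f b * dl x b) = f x"
    "(\<Sum>b\<in>UNIV. dl b x) = 1" "(\<Sum>b\<in>UNIV. dl x b) = 1"
    using *[of f] *[of "\<lambda>_. 1"] by (simp_all add: dl_commute[of x] mult.commute)
qed

text \<open>The result of inserting \<open>qmat r U v\<close> into each argument of the trilinear
  form in turn; terms with k in both of the last two arguments drop out by skewness. This is minus
  the action on tensors, see \<open>Phi_bracket\<close>. The halves in \<open>Ee\<close> and
  \<open>Be\<close> come from the image of l, as a frame vector and its conjugate have product
  2.\<close>

fun act :: "real \<Rightarrow> ('m::finite \<Rightarrow> 'm \<Rightarrow> complex) \<Rightarrow> ('m \<Rightarrow> complex) \<Rightarrow>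
    ('m cix \<Rightarrow> complex) \<Rightarrow> 'm cix \<Rightarrow> complex" where
  "act r U v w (Ga a) = 2 * of_real r * w (Ga a) + (\<Sum>p\<in>UNIV. U p a * w (Ga p))"
| "act r U v w (Ze a b) = of_real r * w (Ze a b) + (\<Sum>p\<in>UNIV. U p a * w (Ze p b))
     + (\<Sum>p\<in>UNIV. U p b * w (Ze a p)) - v a * w (Ga b) + v b * w (Ga a)"
| "act r U v w (Ap a b) = of_real r * w (Ap a b) + (\<Sum>p\<in>UNIV. U p a * w (Ap p b))
     + (\<Sum>p\<in>UNIV. U p b * w (Ap a p)) - v a * w (Ga b)"
| "act r U v w (Am a b) = of_real r * w (Am a b) + (\<Sum>p\<in>UNIV. cnj (U p a) * w (Am p b))
     + (\<Sum>p\<in>UNIV. U p b * w (Am a p)) - cnj (v a) * w (Ga b)"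
| "act r U v w (Ee a) = (\<Sum>p\<in>UNIV. U p a * w (Ee p))
     + (\<Sum>p\<in>UNIV. cnj (v p) * w (Ap p a) + v p * w (Am p a)) / 2"
| "act r U v w (Gp a b c) = (\<Sum>p\<in>UNIV. U p a * w (Gp p b c))
     + (\<Sum>p\<in>UNIV. U p b * w (Gp a p c)) + (\<Sum>p\<in>UNIV. U p c * w (Gp a b p))
     - v a * w (Ze b c) - v b * w (Ap a c) + v c * w (Ap a b)"
| "act r U v w (Gm a b c) = (\<Sum>p\<in>UNIV. cnj (U p a) * w (Gm p b c))
     + (\<Sum>p\<in>UNIV. U p b * w (Gm a p c)) + (\<Sum>p\<in>UNIV. U p c * w (Gm a b p))
     - cnj (v a) * w (Ze b c) - v b * w (Am a c) + v c * w (Am a b)"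
| "act r U v w (Be a b) = - of_real r * w (Be a b) + (\<Sum>p\<in>UNIV. U p a * w (Be p b))
     + (\<Sum>p\<in>UNIV. U p b * w (Be a p))
     + (\<Sum>p\<in>UNIV. cnj (v p) * w (Gp p a b) + v p * w (Gm p a b)) / 2
     - v a * w (Ee b) + v b * w (Ee a)"

text \<open>The complex linear extension of the action of the unitary Lie algebra, evaluated on an
  elementary matrix; barred indices transform in the dual representation.\<close>

fun el :: "'m \<Rightarrow> 'm \<Rightarrow> ('m cix \<Rightarrow> complex) \<Rightarrow> 'm cix \<Rightarrow> complex" where
  "el p q w (Ga a) = dl a p * w (Ga q)"
| "el p q w (Ze a b) = dl a p * w (Ze q b) + dl b p * w (Ze a q)"
| "el p q w (Ap a b) = dl a p * w (Ap q b) + dl b p * w (Ap a q)"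
| "el p q w (Am a b) = - dl a q * w (Am p b) + dl b p * w (Am a q)"
| "el p q w (Ee a) = dl a p * w (Ee q)"
| "el p q w (Gp a b c) = dl a p * w (Gp q b c) + dl b p * w (Gp a q c) + dl c p * w (Gp a b q)"
| "el p q w (Gm a b c) = - dl a q * w (Gm p b c) + dl b p * w (Gm a q c) + dl c p * w (Gm a b q)"
| "el p q w (Be a b) = dl a p * w (Be q b) + dl b p * w (Be a q)"

text \<open>Eigenvalues of the grading element \<open>r = 1\<close>. The function \<open>chg\<close>
  below gives those of the central element \<open>\<i> * dl\<close>, divided by \<open>\<i>\<close>:
  the number of unbarred minus the number of barred indices.\<close>

fun hgt :: "'m cix \<Rightarrow> real" where
  "hgt (Ga a) = 2" | "hgt (Ze a b) = 1" | "hgt (Ap a b) = 1" | "hgt (Am a b) = 1"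
| "hgt (Ee a) = 0" | "hgt (Gp a b c) = 0" | "hgt (Gm a b c) = 0" | "hgt (Be a b) = - 1"

fun chg :: "'m cix \<Rightarrow> real" where
  "chg (Ga a) = 1" | "chg (Ze a b) = 2" | "chg (Ap a b) = 2" | "chg (Am a b) = 0"
| "chg (Ee a) = 1" | "chg (Gp a b c) = 3" | "chg (Gm a b c) = 1" | "chg (Be a b) = 2"

definition skewh :: "('m \<Rightarrow> 'm \<Rightarrow> complex) \<Rightarrow> bool" where
  "skewh U \<longleftrightarrow> (\<forall>a b. U a b = - cnj (U b a))"

text \<open>One embedding for each pair of values of \<open>hgt\<close> and \<open>chg\<close>.
  \<open>Ap\<close> and \<open>Ze\<close> share a pair, and so do \<open>Ee\<close> and
  \<open>Gm\<close>; the grading and the centre cannot separate them.\<close>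

definition iGa :: "('m \<Rightarrow> complex) \<Rightarrow> 'm cix \<Rightarrow> complex" where
  "iGa g c = (case c of Ga a \<Rightarrow> g a | _ \<Rightarrow> 0)"
definition iAZ :: "('m \<Rightarrow> 'm \<Rightarrow> complex) \<Rightarrow> ('m \<Rightarrow> 'm \<Rightarrow> complex) \<Rightarrow> 'm cix \<Rightarrow> complex" where
  "iAZ A Z c = (case c of Ap a b \<Rightarrow> A a b | Ze a b \<Rightarrow> Z a b | _ \<Rightarrow> 0)"
definition iM :: "('m \<Rightarrow> 'm \<Rightarrow> complex) \<Rightarrow> 'm cix \<Rightarrow> complex" where
  "iM A c = (case c of Am a b \<Rightarrow> A a b | _ \<Rightarrow> 0)"
definition iEG :: "('m \<Rightarrow> complex) \<Rightarrow> ('m \<Rightarrow> 'm \<Rightarrow> 'm \<Rightarrow> complex) \<Rightarrow> 'm cix \<Rightarrow> complex" where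
  "iEG e G c = (case c of Ee a \<Rightarrow> e a | Gm x y z \<Rightarrow> G x y z | _ \<Rightarrow> 0)"
definition iP :: "('m \<Rightarrow> 'm \<Rightarrow> 'm \<Rightarrow> complex) \<Rightarrow> 'm cix \<Rightarrow> complex" where
  "iP G c = (case c of Gp x y z \<Rightarrow> G x y z | _ \<Rightarrow> 0)"
definition iB :: "('m \<Rightarrow> 'm \<Rightarrow> complex) \<Rightarrow> 'm cix \<Rightarrow> complex" where
  "iB A c = (case c of Be a b \<Rightarrow> A a b | _ \<Rightarrow> 0)"

lemmas emb_defs = iGa_def iAZ_def iM_def iEG_def iP_def iB_def

lemma emb_simps [simp]:
  "iGa g (Ga a) = g a" "iGa g (Ze a b) = 0" "iGa g (Ap a b) = 0" "iGa g (Am a b) = 0"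
  "iGa g (Ee a) = 0" "iGa g (Gp a b c) = 0" "iGa g (Gm a b c) = 0" "iGa g (Be a b) = 0"
  "iAZ A Z (Ga a) = 0" "iAZ A Z (Ze a b) = Z a b" "iAZ A Z (Ap a b) = A a b" "iAZ A Z (Am a b) = 0"
  "iAZ A Z (Ee a) = 0" "iAZ A Z (Gp a b c) = 0" "iAZ A Z (Gm a b c) = 0" "iAZ A Z (Be a b) = 0"
  "iM A (Ga a) = 0" "iM A (Ze a b) = 0" "iM A (Ap a b) = 0" "iM A (Am a b) = A a b"
  "iM A (Ee a) = 0" "iM A (Gp a b c) = 0" "iM A (Gm a b c) = 0" "iM A (Be a b) = 0"
  "iEG e G (Ga a) = 0" "iEG e G (Ze a b) = 0" "iEG e G (Ap a b) = 0" "iEG e G (Am a b) = 0"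
  "iEG e G (Ee a) = e a" "iEG e G (Gp a b c) = 0" "iEG e G (Gm a b c) = G a b c" "iEG e G (Be a b) = 0"
  "iP G (Ga a) = 0" "iP G (Ze a b) = 0" "iP G (Ap a b) = 0" "iP G (Am a b) = 0"
  "iP G (Ee a) = 0" "iP G (Gp a b c) = G a b c" "iP G (Gm a b c) = 0" "iP G (Be a b) = 0"
  "iB A (Ga a) = 0" "iB A (Ze a b) = 0" "iB A (Ap a b) = 0" "iB A (Am a b) = 0"
  "iB A (Ee a) = 0" "iB A (Gp a b c) = 0" "iB A (Gm a b c) = 0" "iB A (Be a b) = A a b"
  by (simp_all add: emb_defs)

lemma emb_split:
  "w c = iGa (\<lambda>a. w (Ga a)) c + iAZ (\<lambda>a b. w (Ap a b)) (\<lambda>a b. w (Ze a b)) c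
    + iM (\<lambda>a b. w (Am a b)) c + iEG (\<lambda>a. w (Ee a)) (\<lambda>a b d. w (Gm a b d)) c
    + iP (\<lambda>a b d. w (Gp a b d)) c + iB (\<lambda>a b. w (Be a b)) c"
  by (cases c) simp_all

section \<open>Real subspaces of tuples invariant under the stabiliser algebra\<close>

text \<open>What the classification uses of a submodule. Scaling is by reals only.
  \<open>conf_M\<close> and \<open>conf_EG\<close> are the classes of rescalings whose gradient
  pairs with k, and whose gradient lies along the screen space, respectively.\<close>

locale torsion_cmps =
  fixes S :: "('m::finite cix \<Rightarrow> complex) set"
  assumes zero: "(\<lambda>_. 0) \<in> S"
    and add: "\<And>w w'. w \<in> S \<Longrightarrow> w' \<in> S \<Longrightarrow> (\<lambda>c. w c + w' c) \<in> S"
    and scale: "\<And>w r. w \<in> S \<Longrightarrow> (\<lambda>c. of_real r * w c) \<in> S"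
    and act_in: "\<And>w r U v. w \<in> S \<Longrightarrow> skewh U \<Longrightarrow> act r U v w \<in> S"
    and anti_Ze: "\<And>w a b. w \<in> S \<Longrightarrow> w (Ze a b) = - w (Ze b a)"
    and anti_Gp: "\<And>w a b c. w \<in> S \<Longrightarrow> w (Gp a b c) = - w (Gp a c b)"
    and anti_Gm: "\<And>w a b c. w \<in> S \<Longrightarrow> w (Gm a b c) = - w (Gm a c b)"
    and anti_Be: "\<And>w a b. w \<in> S \<Longrightarrow> w (Be a b) = - w (Be b a)"
    and conf_M: "iM dl \<in> S"
    and conf_EG: "\<And>e. iEG e (\<lambda>a b c. 2 * dl a b * e c - 2 * dl a c * e b) \<in> S"
    and two: "1 < CARD('m)"
begin

lemma diff: "w \<in> S \<Longrightarrow> w' \<in> S \<Longrightarrow> (\<lambda>c. w c - w' c) \<in> S"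
  using add[of w "\<lambda>c. of_real (-1) * w' c"] scale[of w' "-1"] by simp

lemma sum_in: "finite I \<Longrightarrow> (\<And>i. i \<in> I \<Longrightarrow> f i \<in> S) \<Longrightarrow> (\<lambda>c. \<Sum>i\<in>I. f i c) \<in> S"
proof (induction I rule: finite_induct)
  case empty
  then show ?case using zero by simp
next
  case (insert x I)
  then show ?case using add[of "f x" "\<lambda>c. \<Sum>i\<in>I. f i c"] by simp
qed

text \<open>Multiplication by a diagonal operator generates, by Lagrange interpolation, the
  multiplications by all functions of its eigenvalues.\<close>

lemma diag_fun:
  assumes d: "\<And>w. w \<in> S \<Longrightarrow> (\<lambda>c. of_real (d c) * w c) \<in> S"
    and fin: "finite (range d)" and w: "w \<in> S"
  shows "(\<lambda>c. of_real (\<phi> (d c)) * w c) \<in> S"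
proof -
  have pr: "(\<lambda>c. of_real (\<Prod>s\<in>D. d c - s) * w c) \<in> S" if "finite D" for D
    using that
  proof (induction D rule: finite_induct)
    case empty
    then show ?case using w by simp
  next
    case (insert x D)
    let ?u = "\<lambda>c. of_real (\<Prod>s\<in>D. d c - s) * w c"
    have "(\<lambda>c. of_real (d c) * ?u c - of_real x * ?u c) \<in> S"
      by (intro diff d scale insert.IH)
    then show ?case using insert by (simp add: algebra_simps)
  qed
  let ?k = "\<lambda>r. \<phi> r / (\<Prod>s\<in>range d - {r}. r - s)"
  have "(\<lambda>c. \<Sum>r\<in>range d. of_real (?k r) * (of_real (\<Prod>s\<in>range d - {r}. d c - s) * w c)) \<in> S"
    by (intro sum_in fin scale pr finite_Diff)
  also have "(\<lambda>c. \<Sum>r\<in>range d. of_real (?k r) * (of_real (\<Prod>s\<in>range d - {r}. d c - s) * w c))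
      = (\<lambda>c. of_real (\<phi> (d c)) * w c)"
  proof
    fix c
    have "(\<Sum>r\<in>range d. of_real (?k r) * (of_real (\<Prod>s\<in>range d - {r}. d c - s) * w c))
      = (\<Sum>r\<in>range d. if r = d c then of_real (\<phi> (d c)) * w c else 0)"
    proof (rule sum.cong)
      fix r assume "r \<in> range d"
      show "of_real (?k r) * (of_real (\<Prod>s\<in>range d - {r}. d c - s) * w c)
        = (if r = d c then of_real (\<phi> (d c)) * w c else 0)"
      proof (cases "r = d c")
        case True
        have "(\<Prod>s\<in>range d - {d c}. d c - s) \<noteq> 0"
          using fin by (simp add: prod_zero_iff)
        then show ?thesis using True
          by (simp del: of_real_prod of_real_divide of_real_mult add: of_real_mult[symmetric] mult.assoc[symmetric])
      next
        case False
        have "(\<Prod>s\<in>range d - {r}. d c - s) = 0"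
          using fin False by (intro prod_zero) auto
        then have "complex_of_real (\<Prod>s\<in>range d - {r}. d c - s) = 0" by (simp only: of_real_0)
        then show ?thesis using False by (simp del: of_real_prod)
      qed
    qed simp
    also have "\<dots> = of_real (\<phi> (d c)) * w c" using fin by simp
    finally show "(\<Sum>r\<in>range d. of_real (?k r) * (of_real (\<Prod>s\<in>range d - {r}. d c - s) * w c))
      = of_real (\<phi> (d c)) * w c" .
  qed
  finally show ?thesis .
qed

lemma range_hgt: "finite (range (hgt :: 'a cix \<Rightarrow> real))"
proof (rule finite_subset)
  have "hgt c \<in> {2, 1, 0, - 1}" for c :: "'a cix" by (cases c) simp_all
  then show "range (hgt :: 'a cix \<Rightarrow> real) \<subseteq> {2, 1, 0, - 1}" by blast
qed simp

lemma range_chg: "finite (range (chg :: 'a cix \<Rightarrow> real))"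
proof (rule finite_subset)
  have "chg c \<in> {0, 1, 2, 3}" for c :: "'a cix" by (cases c) simp_all
  then show "range (chg :: 'a cix \<Rightarrow> real) \<subseteq> {0, 1, 2, 3}" by blast
qed simp

lemma hgt_in: "w \<in> S \<Longrightarrow> (\<lambda>c. of_real (\<phi> (hgt c)) * w c) \<in> S"
proof (rule diag_fun[OF _ range_hgt])
  fix w assume "w \<in> S"
  then have "act 1 (\<lambda>_ _. 0) (\<lambda>_. 0) w \<in> S" by (rule act_in) (simp add: skewh_def)
  also have "act 1 (\<lambda>_ _. 0) (\<lambda>_. 0) w = (\<lambda>c. of_real (hgt c) * w c)"
  proof
    show "act 1 (\<lambda>_ _. 0) (\<lambda>_. 0) w c = of_real (hgt c) * w c" for c by (cases c) simp_all
  qed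
  finally show "(\<lambda>c. of_real (hgt c) * w c) \<in> S" .
qed

lemma chg_i: "w \<in> S \<Longrightarrow> (\<lambda>c. \<i> * of_real (chg c) * w c) \<in> S"
proof -
  assume "w \<in> S"
  then have "act 0 (\<lambda>a b. \<i> * dl a b) (\<lambda>_. 0) w \<in> S"
    by (rule act_in) (simp add: skewh_def dl_commute)
  also have "act 0 (\<lambda>a b. \<i> * dl a b) (\<lambda>_. 0) w = (\<lambda>c. \<i> * of_real (chg c) * w c)"
  proof
    have *: "(\<Sum>p\<in>UNIV. \<i> * dl p x * f p) = \<i> * f x" "(\<Sum>p\<in>UNIV. \<i> * (dl p x * f p)) = \<i> * f x"
      for f :: "'m \<Rightarrow> complex" and x
      by (simp_all add: mult.assoc sum_distrib_left[symmetric])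
    show "act 0 (\<lambda>a b. \<i> * dl a b) (\<lambda>_. 0) w c = \<i> * of_real (chg c) * w c" for c
      by (cases c) (simp_all add: * sum_negf algebra_simps)
  qed
  finally show ?thesis .
qed

text \<open>The available operator is multiplication by \<open>\<i> * chg\<close>, which is not
  real. Its square is real: up to sign it multiplies by the square of the charge. As charges are
  nonnegative, functions of the square give all functions of the charge.\<close>

lemma chg_in: "w \<in> S \<Longrightarrow> (\<lambda>c. of_real (\<phi> (chg c)) * w c) \<in> S"
proof -
  assume w: "w \<in> S"
  have r: "range (\<lambda>c::'m cix. (chg c)\<^sup>2) = (\<lambda>x. x\<^sup>2) ` range (chg :: 'm cix \<Rightarrow> real)"
    by (auto simp: image_image)
  have "(\<lambda>c. of_real (\<phi> (sqrt ((chg c)\<^sup>2))) * w c) \<in> S"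
  proof (rule diag_fun[OF _ _ w, where d = "\<lambda>c. (chg c)\<^sup>2" and \<phi> = "\<lambda>x. \<phi> (sqrt x)"])
    fix w assume "w \<in> S"
    then have "(\<lambda>c. of_real (-1) * (\<i> * of_real (chg c) * (\<i> * of_real (chg c) * w c))) \<in> S"
      by (intro scale chg_i)
    then show "(\<lambda>c. of_real ((chg c)\<^sup>2) * w c) \<in> S"
      by (simp add: power2_eq_square mult.assoc[symmetric]) (simp add: algebra_simps)
  next
    show "finite (range (\<lambda>c::'m cix. (chg c)\<^sup>2))" unfolding r by (intro finite_imageI range_chg)
  qed
  moreover have "sqrt ((chg c)\<^sup>2) = chg c" for c :: "'m cix" by (cases c) simp_all
  ultimately show ?thesis by simp
qed

text \<open>The product of two indicator functions projects onto one pair of height and charge, and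
  the six pairs are different.\<close>

lemma piece:
  assumes w: "w \<in> S"
  shows piece_Ga: "iGa (\<lambda>a. w (Ga a)) \<in> S"
    and piece_AZ: "iAZ (\<lambda>a b. w (Ap a b)) (\<lambda>a b. w (Ze a b)) \<in> S"
    and piece_M: "iM (\<lambda>a b. w (Am a b)) \<in> S"
    and piece_EG: "iEG (\<lambda>a. w (Ee a)) (\<lambda>a b d. w (Gm a b d)) \<in> S"
    and piece_P: "iP (\<lambda>a b d. w (Gp a b d)) \<in> S"
    and piece_B: "iB (\<lambda>a b. w (Be a b)) \<in> S"
proof -
  have *: "(\<lambda>c. of_real (if hgt c = h \<and> chg c = k then 1 else 0) * w c) \<in> S" for h k
  proof -
    have "(\<lambda>c. of_real (if hgt c = h then 1 else 0) *
        (of_real (if chg c = k then 1 else 0) * w c)) \<in> S"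
      by (rule hgt_in[where \<phi> = "\<lambda>x. if x = h then 1 else 0"],
          rule chg_in[where \<phi> = "\<lambda>x. if x = k then 1 else 0"], rule w)
    also have "(\<lambda>c. of_real (if hgt c = h then 1 else 0) * (of_real (if chg c = k then 1 else 0) * w c))
       = (\<lambda>c. of_real (if hgt c = h \<and> chg c = k then 1 else 0) * w c)" by auto
    finally show ?thesis .
  qed
  have e: "f = (\<lambda>c. of_real (if hgt c = h \<and> chg c = k then 1 else 0) * w c) \<Longrightarrow> f \<in> S" for f h k
    using * by simp
  show "iGa (\<lambda>a. w (Ga a)) \<in> S"
    by (rule e[of _ 2 1], rule ext, case_tac c) simp_all
  show "iAZ (\<lambda>a b. w (Ap a b)) (\<lambda>a b. w (Ze a b)) \<in> S"
    by (rule e[of _ 1 2], rule ext, case_tac c) simp_all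
  show "iM (\<lambda>a b. w (Am a b)) \<in> S"
    by (rule e[of _ 1 0], rule ext, case_tac c) simp_all
  show "iEG (\<lambda>a. w (Ee a)) (\<lambda>a b d. w (Gm a b d)) \<in> S"
    by (rule e[of _ 0 1], rule ext, case_tac c) simp_all
  show "iP (\<lambda>a b d. w (Gp a b d)) \<in> S"
    by (rule e[of _ 0 3], rule ext, case_tac c) simp_all
  show "iB (\<lambda>a b. w (Be a b)) \<in> S"
    by (rule e[of _ "-1" 2], rule ext, case_tac c) simp_all
qed

text \<open>The centre of the unitary group acts on the components of nonzero charge by multiples of \<open>i\<close>, which
  makes this part of \<open>S\<close> a complex subspace.\<close>

definition Sc :: "('m cix \<Rightarrow> complex) set" where
  "Sc = {w \<in> S. \<forall>a b. w (Am a b) = 0}"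

lemma Sc_S: "w \<in> Sc \<Longrightarrow> w \<in> S"
  by (simp add: Sc_def)

lemma emb_Sc [simp]:
  "iGa g \<in> Sc \<longleftrightarrow> iGa g \<in> S" "iAZ A Z \<in> Sc \<longleftrightarrow> iAZ A Z \<in> S" "iEG e G \<in> Sc \<longleftrightarrow> iEG e G \<in> S"
  "iP G \<in> Sc \<longleftrightarrow> iP G \<in> S" "iB A \<in> Sc \<longleftrightarrow> iB A \<in> S"
  by (simp_all add: Sc_def)

lemma Sc_add: "w \<in> Sc \<Longrightarrow> w' \<in> Sc \<Longrightarrow> (\<lambda>c. w c + w' c) \<in> Sc"
  by (simp add: Sc_def add)

text \<open>Dividing by the charge before applying \<open>chg_i\<close> leaves \<open>\<i>\<close>.
  The charge is zero only on \<open>Am\<close>, where the elements of \<open>Sc\<close>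
  vanish.\<close>

lemma Sc_i: "w \<in> Sc \<Longrightarrow> (\<lambda>c. \<i> * w c) \<in> Sc"
proof -
  assume w: "w \<in> Sc"
  then have "(\<lambda>c. \<i> * of_real (chg c) * (of_real (1 / chg c) * w c)) \<in> S"
    by (intro chg_i chg_in[where \<phi> = "\<lambda>x. 1 / x"] Sc_S)
  also have "(\<lambda>c. \<i> * of_real (chg c) * (of_real (1 / chg c) * w c)) = (\<lambda>c. \<i> * w c)"
  proof
    show "\<i> * of_real (chg c) * (of_real (1 / chg c) * w c) = \<i> * w c" for c
      using w by (cases c) (simp_all add: Sc_def)
  qed
  finally show ?thesis using w by (simp add: Sc_def)
qed

lemma Sc_scale: "w \<in> Sc \<Longrightarrow> (\<lambda>c. z * w c) \<in> Sc"
proof -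
  assume w: "w \<in> Sc"
  have "(\<lambda>c. of_real (Re z) * w c + of_real (Im z) * (\<i> * w c)) \<in> S"
    using w by (intro add scale) (auto intro: Sc_S Sc_i)
  also have "(\<lambda>c. of_real (Re z) * w c + of_real (Im z) * (\<i> * w c)) = (\<lambda>c. z * w c)"
    by (rule ext) (subst (3) complex_eq, simp add: algebra_simps)
  finally show ?thesis using w by (simp add: Sc_def)
qed

lemma Sc_diff: "w \<in> Sc \<Longrightarrow> w' \<in> Sc \<Longrightarrow> (\<lambda>c. w c - w' c) \<in> Sc"
  by (simp add: Sc_def diff)

text \<open>An elementary matrix is \<open>U + \<i> * V\<close> with skew-Hermitian U and V, here
  \<open>?U\<close> and \<open>?V\<close>. Conjugation fixes \<open>?U\<close> and changes the sign
  of \<open>?V\<close>, so barred indices see minus the transposed matrix.\<close>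

lemma el_in: "w \<in> Sc \<Longrightarrow> el p q w \<in> Sc"
proof -
  assume w: "w \<in> Sc"
  let ?U = "\<lambda>a b. (dl a q * dl b p - dl a p * dl b q) / 2"
  let ?V = "\<lambda>a b. - \<i> * (dl a q * dl b p + dl a p * dl b q) / 2"
  have M: "act 0 U (\<lambda>_. 0) w (Am a b) = 0" for U a b using w by (simp add: Sc_def)
  have "skewh ?U" unfolding skewh_def by (simp add: dl_commute field_simps)
  then have U: "act 0 ?U (\<lambda>_. 0) w \<in> Sc" using w M by (simp add: Sc_def act_in)
  have "skewh ?V" unfolding skewh_def by (simp add: dl_commute field_simps)
  then have V: "act 0 ?V (\<lambda>_. 0) w \<in> Sc" using w M by (simp add: Sc_def act_in)
  from U V have "(\<lambda>c. act 0 ?U (\<lambda>_. 0) w c + \<i> * act 0 ?V (\<lambda>_. 0) w c) \<in> Sc"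
    by (intro Sc_add Sc_scale)
  also have "(\<lambda>c. act 0 ?U (\<lambda>_. 0) w c + \<i> * act 0 ?V (\<lambda>_. 0) w c) = el p q w"
  proof
    have alg: "(x - y) / 2 * t + \<i> * (- \<i> * (x + y) / 2 * t) = x * t"
      "(x - y) / 2 * t + \<i> * (\<i> * (x + y) / 2 * t) = - y * t" for x y t :: complex
      by (simp_all add: field_simps)
    have 1: "(\<Sum>r\<in>UNIV. ?U r a * f r) + \<i> * (\<Sum>r\<in>UNIV. ?V r a * f r) = dl a p * f q"
      for a and f :: "'m \<Rightarrow> complex"
      unfolding sum_distrib_left sum.distrib[symmetric] alg by (simp add: mult.assoc)
    have 2: "(\<Sum>r\<in>UNIV. cnj (?U r a) * f r) + \<i> * (\<Sum>r\<in>UNIV. cnj (?V r a) * f r) = - dl a q * f p"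
      for a and f :: "'m \<Rightarrow> complex"
    proof -
      have c: "cnj (?U r a) = ?U r a" "cnj (?V r a) = \<i> * (dl r q * dl a p + dl r p * dl a q) / 2" for r
        by simp_all
      show ?thesis
        unfolding sum_distrib_left sum.distrib[symmetric] c alg
        by (simp add: mult.assoc sum_negf)
    qed
    have shuf: "a1 + b1 + \<i> * (a2 + b2) = (a1 + \<i> * a2) + (b1 + \<i> * b2)"
      "a1 + b1 + c1 + \<i> * (a2 + b2 + c2) = (a1 + \<i> * a2) + (b1 + \<i> * b2) + (c1 + \<i> * c2)"
      for a1 a2 b1 b2 c1 c2 :: complex by (simp_all add: algebra_simps)
    show "act 0 ?U (\<lambda>_. 0) w c + \<i> * act 0 ?V (\<lambda>_. 0) w c = el p q w c" for c
      using w by (cases c)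
        (simp_all only: act.simps el.simps mult_zero_left mult_zero_right of_real_0 add_0_left
          add_0_right diff_zero complex_cnj_zero minus_zero sum.neutral_const div_0 shuf 1 2)
  qed
  finally show ?thesis .
qed

end

section \<open>Elementary tensors and normal-ordered products\<close>

lemma sum_dl_prod [simp]:
  fixes n :: "'a::finite \<Rightarrow> 'a \<Rightarrow> complex" and t :: "'a \<Rightarrow> 'a \<Rightarrow> 'a \<Rightarrow> complex"
  shows "(\<Sum>p\<in>UNIV. \<Sum>r\<in>UNIV. n p r * (dl a p * dl b r)) = n a b"
    and "(\<Sum>p\<in>UNIV. \<Sum>r\<in>UNIV. n p r * (dl b r * dl a p)) = n a b"
    and "(\<Sum>p\<in>UNIV. \<Sum>r\<in>UNIV. \<Sum>s\<in>UNIV. t p r s * (dl a p * (dl b r * dl c s))) = t a b c"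
proof -
  show *: "(\<Sum>p\<in>UNIV. \<Sum>r\<in>UNIV. n p r * (dl a p * dl b r)) = n a b" for n :: "'a \<Rightarrow> 'a \<Rightarrow> complex" and a b
  proof -
    have "(\<Sum>p\<in>UNIV. \<Sum>r\<in>UNIV. n p r * (dl a p * dl b r))
      = (\<Sum>p\<in>UNIV. dl a p * (\<Sum>r\<in>UNIV. dl b r * n p r))"
      unfolding sum_distrib_left by (intro sum.cong refl) (simp add: ac_simps)
    then show ?thesis by simp
  qed
  then show "(\<Sum>p\<in>UNIV. \<Sum>r\<in>UNIV. n p r * (dl b r * dl a p)) = n a b"
    by (simp add: mult.commute)
  have "(\<Sum>p\<in>UNIV. \<Sum>r\<in>UNIV. \<Sum>s\<in>UNIV. t p r s * (dl a p * (dl b r * dl c s)))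
      = (\<Sum>p\<in>UNIV. dl a p * (\<Sum>r\<in>UNIV. \<Sum>s\<in>UNIV. t p r s * (dl b r * dl c s)))"
    unfolding sum_distrib_left by (intro sum.cong refl) (simp add: ac_simps)
  then show "(\<Sum>p\<in>UNIV. \<Sum>r\<in>UNIV. \<Sum>s\<in>UNIV. t p r s * (dl a p * (dl b r * dl c s))) = t a b c"
    by (simp add: *)
qed

definition wdg :: "'a \<Rightarrow> 'a \<Rightarrow> 'a \<Rightarrow> 'a \<Rightarrow> complex" where
  "wdg p r a b = dl a p * dl b r - dl b p * dl a r"

definition sy :: "'a \<Rightarrow> 'a \<Rightarrow> 'a \<Rightarrow> 'a \<Rightarrow> complex" where
  "sy p r a b = dl a p * dl b r + dl b p * dl a r"

lemma sum_wdg: "(\<Sum>p\<in>UNIV. \<Sum>r\<in>UNIV. n p r * wdg p r a b) = n a b - n b (a::'a::finite)"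
  by (simp add: wdg_def right_diff_distrib sum_subtractf)

lemma sum_sy: "(\<Sum>p\<in>UNIV. \<Sum>r\<in>UNIV. n p r * sy p r a b) = n a b + n b (a::'a::finite)"
  by (simp add: sy_def distrib_left sum.distrib)

definition alt3 :: "'a \<Rightarrow> 'a \<Rightarrow> 'a \<Rightarrow> 'a \<Rightarrow> 'a \<Rightarrow> 'a \<Rightarrow> complex" where
  "alt3 p r s a b c = dl a p * (dl b r * dl c s) + dl b p * (dl c r * dl a s) + dl c p * (dl a r * dl b s)
     - dl b p * (dl a r * dl c s) - dl a p * (dl c r * dl b s) - dl c p * (dl b r * dl a s)"

text \<open>A Young symmetriser of hook shape: separating the first index from a skew pair, this is
  \<open>e_p (x) (e_r ^ e_s) + e_r (x) (e_p ^ e_s)\<close>.\<close>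

definition hk3 :: "'a \<Rightarrow> 'a \<Rightarrow> 'a \<Rightarrow> 'a \<Rightarrow> 'a \<Rightarrow> 'a \<Rightarrow> complex" where
  "hk3 p r s a b c = dl b p * (dl a r * dl c s) - dl c p * (dl a r * dl b s)
     + dl a p * (dl b r * dl c s) - dl a p * (dl c r * dl b s)"

lemma sum_dl_prod3 [simp]:
  fixes t :: "'a::finite \<Rightarrow> 'a \<Rightarrow> 'a \<Rightarrow> complex"
  shows "(\<Sum>p\<in>UNIV. \<Sum>r\<in>UNIV. \<Sum>s\<in>UNIV. t p r s * alt3 p r s a b c)
      = t a b c + t b c a + t c a b - t b a c - t a c b - t c b a"
    and "(\<Sum>p\<in>UNIV. \<Sum>r\<in>UNIV. \<Sum>s\<in>UNIV. t p r s * hk3 p r s a b c)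
      = t b a c - t c a b + t a b c - t a c b"
  by (simp_all add: alt3_def hk3_def right_diff_distrib distrib_left sum.distrib sum_subtractf)

text \<open>Normal-ordered products of the operators \<open>el\<close>: they act on two, respectively three, different
  indices, which is how the symmetrisers of tensors arise from the unitary group.\<close>

definition o2 :: "'m \<Rightarrow> 'm \<Rightarrow> 'm \<Rightarrow> 'm \<Rightarrow> ('m cix \<Rightarrow> complex) \<Rightarrow> 'm cix \<Rightarrow> complex" where
  "o2 p q r s w c = el p q (el r s w) c - dl q r * el p s w c"

definition o3 :: "'m \<Rightarrow> 'm \<Rightarrow> 'm \<Rightarrow> 'm \<Rightarrow> 'm \<Rightarrow> 'm \<Rightarrow> ('m cix \<Rightarrow> complex) \<Rightarrow> 'm cix \<Rightarrow> complex" where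
  "o3 p q r s t u w c = el p q (o2 r s t u w) c - dl q r * o2 p s t u w c - dl q t * o2 r s p u w c"

lemma o2_iB: "o2 p q r s (iB A) = iB (\<lambda>a b. dl a p * dl b r * A q s + dl b p * dl a r * A s q)"
proof
  show "o2 p q r s (iB A) c = iB (\<lambda>a b. dl a p * dl b r * A q s + dl b p * dl a r * A s q) c" for c
    by (cases c) (simp_all add: o2_def algebra_simps)
qed

lemma o2_iAZ: "o2 p q r s (iAZ A Z) = iAZ (\<lambda>a b. dl a p * dl b r * A q s + dl b p * dl a r * A s q)
    (\<lambda>a b. dl a p * dl b r * Z q s + dl b p * dl a r * Z s q)"
proof
  show "o2 p q r s (iAZ A Z) c = iAZ (\<lambda>a b. dl a p * dl b r * A q s + dl b p * dl a r * A s q)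
    (\<lambda>a b. dl a p * dl b r * Z q s + dl b p * dl a r * Z s q) c" for c
    by (cases c) (simp_all add: o2_def algebra_simps)
qed

lemma o3_iP: "o3 p q r s t u (iP G) = iP (\<lambda>a b c.
    dl a p * (dl b r * dl c t) * G q s u + dl a p * (dl c r * dl b t) * G q u s
  + dl b p * (dl a r * dl c t) * G s q u + dl c p * (dl a r * dl b t) * G s u q
  + dl b p * (dl c r * dl a t) * G u q s + dl c p * (dl b r * dl a t) * G u s q)"
  (is "_ = ?R")
proof
  show "o3 p q r s t u (iP G) c = ?R c" for c
    by (cases c) (simp_all add: o2_def o3_def algebra_simps)
qed

text \<open>Applied over the complex numbers to the pair of \<open>Ap\<close> and \<open>Ze\<close>,
  and over the reals to the complex plane. The coefficients of the functional become the parameters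
  of the two families of distinguished submodules.\<close>

lemma separating_functional:
  fixes L :: "('a::field \<times> 'a) set"
  assumes add: "\<And>u v. u \<in> L \<Longrightarrow> v \<in> L \<Longrightarrow> (fst u + fst v, snd u + snd v) \<in> L"
    and scale: "\<And>u k. u \<in> L \<Longrightarrow> (k * fst u, k * snd u) \<in> L"
    and v: "(a, b) \<notin> L" and z: "(0, 0) \<in> L"
  shows "\<exists>p q. p * a + q * b \<noteq> 0 \<and> (\<forall>(s, t)\<in>L. p * s + q * t = 0)"
proof (cases "L = {(0, 0)}")
  case True
  then have "a \<noteq> 0 \<or> b \<noteq> 0" using v by auto
  then have "\<exists>p q. p * a + q * b \<noteq> 0"
    by (metis add_0 add_0_right mult_1 mult_zero_left)
  then show ?thesis using True by simp
next
  case False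
  then obtain c d where cd: "(c, d) \<in> L" "(c, d) \<noteq> (0, 0)" using z by auto
  have main: "s * d - c * t = 0" if st: "(s, t) \<in> L" "a * d - c * b \<noteq> 0 \<or> True" for s t
  proof (rule ccontr)
    assume n: "s * d - c * t \<noteq> 0"
    let ?D = "s * d - c * t"
    \<comment> \<open>Cramer's rule writes \<open>(a, b)\<close> as a combination of the independent
      pairs \<open>(s, t)\<close> and \<open>(c, d)\<close>.\<close>
    have "((a * d - c * b) / ?D * s, (a * d - c * b) / ?D * t) \<in> L"
      using scale[OF st(1), of "(a * d - c * b) / ?D"] by simp
    moreover have "((s * b - a * t) / ?D * c, (s * b - a * t) / ?D * d) \<in> L"
      using scale[OF cd(1), of "(s * b - a * t) / ?D"] by simp
    ultimately have "((a * d - c * b) / ?D * s + (s * b - a * t) / ?D * c,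
        (a * d - c * b) / ?D * t + (s * b - a * t) / ?D * d) \<in> L"
      using add by fastforce
    moreover have "(a * d - c * b) / ?D * s + (s * b - a * t) / ?D * c = a"
    proof -
      have "(a * d - c * b) * s + (s * b - a * t) * c = a * ?D" by (simp add: algebra_simps)
      then show ?thesis using n by (simp add: add_divide_distrib[symmetric])
    qed
    moreover have "(a * d - c * b) / ?D * t + (s * b - a * t) / ?D * d = b"
    proof -
      have "(a * d - c * b) * t + (s * b - a * t) * d = b * ?D" by (simp add: algebra_simps)
      then show ?thesis using n by (simp add: add_divide_distrib[symmetric])
    qed
    ultimately show False using v by simp
  qed
  have "a * d - c * b \<noteq> 0"
  proof
    assume e: "a * d - c * b = 0"
    show False
    proof (cases "c = 0")
      case True
      then have "d \<noteq> 0" "a = 0" using cd e by auto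
      then show False using scale[OF cd(1), of "b / d"] v True by simp
    next
      case False
      then have "b = a / c * d" using e by (simp add: field_simps)
      then show False using scale[OF cd(1), of "a / c"] v False by simp
    qed
  qed
  then have "d * a + (- c) * b \<noteq> 0 \<and> (\<forall>(s, t)\<in>L. d * s + (- c) * t = 0)"
    using main by (auto simp: mult.commute)
  then show ?thesis by blast
qed

lemma cancel_factor: "(k::'a::field) \<noteq> 0 \<Longrightarrow> x / (c * k) * (k * y) = x / c * y"
  "(k::'a::field) \<noteq> 0 \<Longrightarrow> x / (c * k) * (y * k) = x / c * y"
  by simp_all

text \<open>A null rotation with parameter z contributes terms in z and in its conjugate; the values
  1 and \<open>\<i>\<close> of z separate them.\<close>

lemma conj_linear_zero:
  assumes "\<And>z. z * x + cnj z * y = 0"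
  shows "x = 0" "y = 0"
proof -
  have "x + y = 0" "\<i> * x - \<i> * y = 0" using assms[of 1] assms[of \<i>] by simp_all
  then have "x + y = 0" "x - y = 0" by (simp_all add: right_diff_distrib[symmetric])
  then show "x = 0" "y = 0" by (simp_all add: eq_neg_iff_add_eq_0[symmetric])
qed

context torsion_cmps
begin

lemma o2_in: "w \<in> Sc \<Longrightarrow> o2 p q r s w \<in> Sc"
  unfolding o2_def by (intro Sc_diff Sc_scale el_in)

lemma o3_in: "w \<in> Sc \<Longrightarrow> o3 p q r s t u w \<in> Sc"
  unfolding o3_def by (intro Sc_diff Sc_scale el_in o2_in)

lemma in_sum:
  shows iGa_sum: "(\<And>i. iGa (f i) \<in> S) \<Longrightarrow> iGa (\<lambda>a. \<Sum>i\<in>(UNIV::'i::finite set). f i a) \<in> S"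
    and iAZ_sum: "(\<And>i. iAZ (A i) (Z i) \<in> S) \<Longrightarrow>
      iAZ (\<lambda>a b. \<Sum>i\<in>(UNIV::'i set). A i a b) (\<lambda>a b. \<Sum>i\<in>UNIV. Z i a b) \<in> S"
    and iM_sum: "(\<And>i. iM (A i) \<in> S) \<Longrightarrow> iM (\<lambda>a b. \<Sum>i\<in>(UNIV::'i set). A i a b) \<in> S"
    and iEG_sum: "(\<And>i. iEG (f i) (T i) \<in> S) \<Longrightarrow>
      iEG (\<lambda>a. \<Sum>i\<in>(UNIV::'i set). f i a) (\<lambda>a b c. \<Sum>i\<in>UNIV. T i a b c) \<in> S"
    and iP_sum: "(\<And>i. iP (T i) \<in> S) \<Longrightarrow> iP (\<lambda>a b c. \<Sum>i\<in>(UNIV::'i set). T i a b c) \<in> S"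
    and iB_sum: "(\<And>i. iB (A i) \<in> S) \<Longrightarrow> iB (\<lambda>a b. \<Sum>i\<in>(UNIV::'i set). A i a b) \<in> S"
proof -
  have e: "(\<And>i. F i \<in> S) \<Longrightarrow> (\<And>c. G c = (\<Sum>i\<in>(UNIV::'i set). F i c)) \<Longrightarrow> G \<in> S" for F G
    using sum_in[of "UNIV :: 'i set" F] by (subst ext[of G "\<lambda>c. \<Sum>i\<in>UNIV. F i c"]) auto
  show "(\<And>i. iGa (f i) \<in> S) \<Longrightarrow> iGa (\<lambda>a. \<Sum>i\<in>(UNIV::'i::finite set). f i a) \<in> S"
    by (erule e, case_tac c) simp_all
  show "(\<And>i. iAZ (A i) (Z i) \<in> S) \<Longrightarrow>
      iAZ (\<lambda>a b. \<Sum>i\<in>(UNIV::'i set). A i a b) (\<lambda>a b. \<Sum>i\<in>UNIV. Z i a b) \<in> S"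
    by (erule e, case_tac c) simp_all
  show "(\<And>i. iM (A i) \<in> S) \<Longrightarrow> iM (\<lambda>a b. \<Sum>i\<in>(UNIV::'i set). A i a b) \<in> S"
    by (erule e, case_tac c) simp_all
  show "(\<And>i. iEG (f i) (T i) \<in> S) \<Longrightarrow>
      iEG (\<lambda>a. \<Sum>i\<in>(UNIV::'i set). f i a) (\<lambda>a b c. \<Sum>i\<in>UNIV. T i a b c) \<in> S"
    by (erule e, case_tac c) simp_all
  show "(\<And>i. iP (T i) \<in> S) \<Longrightarrow> iP (\<lambda>a b c. \<Sum>i\<in>(UNIV::'i set). T i a b c) \<in> S"
    by (erule e, case_tac c) simp_all
  show "(\<And>i. iB (A i) \<in> S) \<Longrightarrow> iB (\<lambda>a b. \<Sum>i\<in>(UNIV::'i set). A i a b) \<in> S"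
    by (erule e, case_tac c) simp_all
qed

lemma in_scale:
  shows iGa_scale: "iGa f \<in> S \<Longrightarrow> iGa (\<lambda>a. z * f a) \<in> S"
    and iAZ_scale: "iAZ A Z \<in> S \<Longrightarrow> iAZ (\<lambda>a b. z * A a b) (\<lambda>a b. z * Z a b) \<in> S"
    and iEG_scale: "iEG f T \<in> S \<Longrightarrow> iEG (\<lambda>a. z * f a) (\<lambda>a b c. z * T a b c) \<in> S"
    and iP_scale: "iP T \<in> S \<Longrightarrow> iP (\<lambda>a b c. z * T a b c) \<in> S"
    and iB_scale: "iB A \<in> S \<Longrightarrow> iB (\<lambda>a b. z * A a b) \<in> S"
proof -
  have e: "F \<in> Sc \<Longrightarrow> (\<And>c. G c = z * F c) \<Longrightarrow> G \<in> S" for F G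
    using Sc_S[OF Sc_scale[of F z]] by (subst ext[of G "\<lambda>c. z * F c"]) auto
  show "iGa f \<in> S \<Longrightarrow> iGa (\<lambda>a. z * f a) \<in> S" by (rule e[of "iGa f"], simp, case_tac c) simp_all
  show "iAZ A Z \<in> S \<Longrightarrow> iAZ (\<lambda>a b. z * A a b) (\<lambda>a b. z * Z a b) \<in> S"
    by (rule e[of "iAZ A Z"], simp, case_tac c) simp_all
  show "iEG f T \<in> S \<Longrightarrow> iEG (\<lambda>a. z * f a) (\<lambda>a b c. z * T a b c) \<in> S"
    by (rule e[of "iEG f T"], simp, case_tac c) simp_all
  show "iP T \<in> S \<Longrightarrow> iP (\<lambda>a b c. z * T a b c) \<in> S"
    by (rule e[of "iP T"], simp, case_tac c) simp_all
  show "iB A \<in> S \<Longrightarrow> iB (\<lambda>a b. z * A a b) \<in> S"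
    by (rule e[of "iB A"], simp, case_tac c) simp_all
qed

lemma in_add:
  shows iAZ_add: "iAZ A Z \<in> S \<Longrightarrow> iAZ A' Z' \<in> S \<Longrightarrow>
      iAZ (\<lambda>a b. A a b + A' a b) (\<lambda>a b. Z a b + Z' a b) \<in> S"
    and iM_add: "iM A \<in> S \<Longrightarrow> iM A' \<in> S \<Longrightarrow> iM (\<lambda>a b. A a b + A' a b) \<in> S"
    and iEG_add: "iEG f T \<in> S \<Longrightarrow> iEG f' T' \<in> S \<Longrightarrow>
      iEG (\<lambda>a. f a + f' a) (\<lambda>a b c. T a b c + T' a b c) \<in> S"
    and iP_add: "iP T \<in> S \<Longrightarrow> iP T' \<in> S \<Longrightarrow> iP (\<lambda>a b c. T a b c + T' a b c) \<in> S"
proof -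
  have e: "F \<in> S \<Longrightarrow> F' \<in> S \<Longrightarrow> (\<And>c. G c = F c + F' c) \<Longrightarrow> G \<in> S" for F F' G
    using add[of F F'] by (subst ext[of G "\<lambda>c. F c + F' c"]) auto
  show "iAZ A Z \<in> S \<Longrightarrow> iAZ A' Z' \<in> S \<Longrightarrow>
      iAZ (\<lambda>a b. A a b + A' a b) (\<lambda>a b. Z a b + Z' a b) \<in> S"
    by (rule e[of "iAZ A Z" "iAZ A' Z'"], simp, simp, case_tac c) simp_all
  show "iM A \<in> S \<Longrightarrow> iM A' \<in> S \<Longrightarrow> iM (\<lambda>a b. A a b + A' a b) \<in> S"
    by (rule e[of "iM A" "iM A'"], simp, simp, case_tac c) simp_all
  show "iEG f T \<in> S \<Longrightarrow> iEG f' T' \<in> S \<Longrightarrow>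
      iEG (\<lambda>a. f a + f' a) (\<lambda>a b c. T a b c + T' a b c) \<in> S"
    by (rule e[of "iEG f T" "iEG f' T'"], simp, simp, case_tac c) simp_all
  show "iP T \<in> S \<Longrightarrow> iP T' \<in> S \<Longrightarrow> iP (\<lambda>a b c. T a b c + T' a b c) \<in> S"
    by (rule e[of "iP T" "iP T'"], simp, simp, case_tac c) simp_all
qed

section \<open>Irreducible components generated by one nonzero value\<close>

text \<open>\<open>el p q\<close> puts the value at q into the place p; the resulting multiples of
  unit vectors span everything.\<close>

lemma Ga_all:
  assumes w: "w \<in> S" and n: "w (Ga q) \<noteq> 0"
  shows "iGa g \<in> S"
proof -
  have "el p q (iGa (\<lambda>a. w (Ga a))) \<in> S" for p
    using el_in[of "iGa (\<lambda>a. w (Ga a))"] piece_Ga[OF w] by (simp add: Sc_S)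
  also have "el p q (iGa (\<lambda>a. w (Ga a))) = iGa (\<lambda>a. dl a p * w (Ga q))" for p
    by (rule ext, case_tac x) simp_all
  finally have "iGa (\<lambda>a. \<Sum>p\<in>UNIV. g p / w (Ga q) * (dl a p * w (Ga q))) \<in> S"
    by (intro iGa_sum iGa_scale)
  then show ?thesis using n by (simp add: mult.commute[of "dl _ _"])
qed

text \<open>With the source indices q and s fixed, \<open>o2\<close> yields elementary skew tensors
  in the target indices p and r. A skew matrix is half the sum of these, weighted with its
  entries.\<close>

lemma B_all:
  assumes w: "w \<in> S" and n: "w (Be q s) \<noteq> 0" and anti: "\<And>a b. N a b = - N b a"
  shows "iB N \<in> S"
proof -
  let ?k = "w (Be q s)"
  have s: "w (Be s q) = - ?k" using anti_Be[OF w] by metis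
  have "o2 p q r s (iB (\<lambda>a b. w (Be a b))) \<in> S" for p r
    using o2_in[of "iB (\<lambda>a b. w (Be a b))"] piece_B[OF w] by (simp add: Sc_S)
  then have "iB (\<lambda>a b. dl a p * dl b r * ?k + dl b p * dl a r * - ?k) \<in> S" for p r
    by (simp add: o2_iB s)
  then have "iB (\<lambda>a b. \<Sum>p\<in>UNIV. \<Sum>r\<in>UNIV. N p r / (2 * ?k) * (dl a p * dl b r * ?k + dl b p * dl a r * - ?k)) \<in> S"
    by (intro iB_sum iB_scale)
  also have "(\<lambda>a b. \<Sum>p\<in>UNIV. \<Sum>r\<in>UNIV. N p r / (2 * ?k) * (dl a p * dl b r * ?k + dl b p * dl a r * - ?k))
     = (\<lambda>a b. \<Sum>p\<in>UNIV. \<Sum>r\<in>UNIV. N p r / 2 * wdg p r a b)"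
    using n by (intro ext sum.cong refl) (simp add: wdg_def field_simps)
  also have "\<dots> = N"
  proof (intro ext)
    show "(\<Sum>p\<in>UNIV. \<Sum>r\<in>UNIV. N p r / 2 * wdg p r a b) = N a b" for a b
      unfolding sum_wdg anti[of b a] by simp
  qed
  finally show ?thesis .
qed

text \<open>Obtained by antisymmetrising the target indices p and r of \<open>o2\<close>. The same
  operator acts on \<open>Ap\<close> and on \<open>Ze\<close>, so that these two isomorphic
  components stay tied together by the pair of coefficients taken from w.\<close>

lemma AZ_wdg:
  assumes w: "w \<in> S"
  shows "iAZ (\<lambda>a b. wdg p r a b * ((w (Ap q s) - w (Ap s q)) / 2)) (\<lambda>a b. wdg p r a b * w (Ze q s)) \<in> S"
proof -
  let ?A = "\<lambda>a b. w (Ap a b)" and ?Z = "\<lambda>a b. w (Ze a b)"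
  have u: "iAZ ?A ?Z \<in> Sc" using piece_AZ[OF w] by simp
  have z: "w (Ze s q) = - w (Ze q s)" using anti_Ze[OF w] .
  have "(\<lambda>c. 1/2 * (o2 p q r s (iAZ ?A ?Z) c - o2 r q p s (iAZ ?A ?Z) c)) \<in> S"
    using u by (intro Sc_S Sc_scale Sc_diff o2_in)
  also have "(\<lambda>c. 1/2 * (o2 p q r s (iAZ ?A ?Z) c - o2 r q p s (iAZ ?A ?Z) c))
    = iAZ (\<lambda>a b. wdg p r a b * ((w (Ap q s) - w (Ap s q)) / 2)) (\<lambda>a b. wdg p r a b * w (Ze q s))"
    unfolding o2_iAZ by (rule ext, case_tac c) (simp_all add: wdg_def z algebra_simps diff_divide_distrib)
  finally show ?thesis .
qed

text \<open>Symmetrising the target indices removes \<open>Ze\<close>, which is skew.\<close>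

lemma AZ_sy:
  assumes w: "w \<in> S"
  shows "iAZ (\<lambda>a b. sy p r a b * (w (Ap q s) + w (Ap s q))) (\<lambda>_ _. 0) \<in> S"
proof -
  let ?A = "\<lambda>a b. w (Ap a b)" and ?Z = "\<lambda>a b. w (Ze a b)"
  have u: "iAZ ?A ?Z \<in> Sc" using piece_AZ[OF w] by simp
  have z: "w (Ze s q) = - w (Ze q s)" using anti_Ze[OF w] .
  have "(\<lambda>c. o2 p q r s (iAZ ?A ?Z) c + o2 r q p s (iAZ ?A ?Z) c) \<in> S"
    using u by (intro Sc_S Sc_add o2_in)
  also have "(\<lambda>c. o2 p q r s (iAZ ?A ?Z) c + o2 r q p s (iAZ ?A ?Z) c)
    = iAZ (\<lambda>a b. sy p r a b * (w (Ap q s) + w (Ap s q))) (\<lambda>_ _. 0)"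
    unfolding o2_iAZ by (rule ext, case_tac c) (simp_all add: sy_def z algebra_simps)
  finally show ?thesis .
qed

lemma AZ_sym_all:
  assumes w: "w \<in> S" and n: "w (Ap q s) + w (Ap s q) \<noteq> 0" and N: "\<And>a b. N a b = N b a"
  shows "iAZ N (\<lambda>_ _. 0) \<in> S"
proof -
  let ?k = "w (Ap q s) + w (Ap s q)"
  have "iAZ (\<lambda>a b. \<Sum>p\<in>UNIV. \<Sum>r\<in>UNIV. N p r / (2 * ?k) * (sy p r a b * ?k))
     (\<lambda>a b. \<Sum>p\<in>UNIV. \<Sum>r\<in>UNIV. N p r / (2 * ?k) * 0) \<in> S"
    by (intro iAZ_sum iAZ_scale AZ_sy w)
  also have "(\<lambda>a b. \<Sum>p\<in>UNIV. \<Sum>r\<in>UNIV. N p r / (2 * ?k) * (sy p r a b * ?k))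
     = (\<lambda>a b. \<Sum>p\<in>UNIV. \<Sum>r\<in>UNIV. N p r / 2 * sy p r a b)"
    unfolding cancel_factor[OF n] ..
  also have "\<dots> = N"
  proof (intro ext)
    show "(\<Sum>p\<in>UNIV. \<Sum>r\<in>UNIV. N p r / 2 * sy p r a b) = N a b" for a b
      unfolding sum_sy N[of b a] by simp
  qed
  finally show ?thesis by simp
qed

text \<open>Symmetrising the target indices p and r of \<open>o3\<close>, while \<open>Gp\<close> is
  skew in its last two indices, projects to the hook shape. The coefficient vanishes when w is
  totally skew there.\<close>

lemma P_hk:
  assumes w: "w \<in> S"
  shows "iP (\<lambda>a b c. (w (Gp q s u) + w (Gp s q u)) * hk3 p r t a b c) \<in> S"
proof -
  let ?G = "\<lambda>a b c. w (Gp a b c)"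
  have "iP ?G \<in> Sc" using piece_P[OF w] by simp
  then have "(\<lambda>c. o3 p q r s t u (iP ?G) c + o3 r q p s t u (iP ?G) c) \<in> S"
    by (intro Sc_S Sc_add o3_in)
  also have "(\<lambda>c. o3 p q r s t u (iP ?G) c + o3 r q p s t u (iP ?G) c)
    = iP (\<lambda>a b c. (w (Gp q s u) + w (Gp s q u)) * hk3 p r t a b c)"
    unfolding o3_iP anti_Gp[OF w, of q u s] anti_Gp[OF w, of s u q] anti_Gp[OF w, of u s q]
    by (rule ext, case_tac c) (simp_all add: hk3_def algebra_simps)
  finally show ?thesis .
qed

lemma P_sk:
  assumes w: "w \<in> S"
  shows "iP (\<lambda>a b c. (w (Gp q s u) + w (Gp s u q) + w (Gp u q s)) * alt3 p r t a b c) \<in> S"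
proof -
  let ?G = "\<lambda>a b c. w (Gp a b c)"
  have "iP ?G \<in> Sc" using piece_P[OF w] by simp
  then have "(\<lambda>c. 1/2 * ((o3 p q r s t u (iP ?G) c + o3 r q t s p u (iP ?G) c + o3 t q p s r u (iP ?G) c)
      - (o3 r q p s t u (iP ?G) c + o3 p q t s r u (iP ?G) c + o3 t q r s p u (iP ?G) c))) \<in> S"
    by (intro Sc_S Sc_scale Sc_add Sc_diff o3_in)
  also have "(\<lambda>c. 1/2 * ((o3 p q r s t u (iP ?G) c + o3 r q t s p u (iP ?G) c + o3 t q p s r u (iP ?G) c)
      - (o3 r q p s t u (iP ?G) c + o3 p q t s r u (iP ?G) c + o3 t q r s p u (iP ?G) c)))
    = iP (\<lambda>a b c. (w (Gp q s u) + w (Gp s u q) + w (Gp u q s)) * alt3 p r t a b c)"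
    unfolding o3_iP anti_Gp[OF w, of q u s] anti_Gp[OF w, of s q u] anti_Gp[OF w, of u s q]
    by (rule ext, case_tac c) (simp_all add: alt3_def algebra_simps)
  finally show ?thesis .
qed

lemma P_hk_all:
  assumes w: "w \<in> S" and n: "w (Gp q s u) + w (Gp s q u) \<noteq> 0"
    and a: "\<And>a b c. N a b c = - N a c b" and cyc: "\<And>a b c. N a b c + N b c a + N c a b = 0"
  shows "iP N \<in> S"
proof -
  let ?k = "w (Gp q s u) + w (Gp s q u)"
  have "iP (\<lambda>a b c. \<Sum>p\<in>UNIV. \<Sum>r\<in>UNIV. \<Sum>t\<in>UNIV. N p r t / (3 * ?k) * (?k * hk3 p r t a b c)) \<in> S"
    by (intro iP_sum iP_scale P_hk w)
  also have "(\<lambda>a b c. \<Sum>p\<in>UNIV. \<Sum>r\<in>UNIV. \<Sum>t\<in>UNIV. N p r t / (3 * ?k) * (?k * hk3 p r t a b c))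
     = (\<lambda>a b c. \<Sum>p\<in>UNIV. \<Sum>r\<in>UNIV. \<Sum>t\<in>UNIV. N p r t / 3 * hk3 p r t a b c)"
    unfolding cancel_factor[OF n] ..
  also have "\<dots> = N"
  proof (intro ext)
    fix x y z
    \<comment> \<open>On tensors of hook type the sum against \<open>hk3\<close> is multiplication
      by 3; this is the divisor used above.\<close>
    have "N y x z - N z x y + N x y z - N x z y = 3 * N x y z"
    proof -
      have "N x y z = - N y z x - N z x y"
        using cyc[of x y z] by (simp add: algebra_simps eq_neg_iff_add_eq_0)
      then show ?thesis unfolding a[of y x z] a[of x z y] by simp
    qed
    then show "(\<Sum>p\<in>UNIV. \<Sum>r\<in>UNIV. \<Sum>t\<in>UNIV. N p r t / 3 * hk3 p r t x y z) = N x y z"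
      unfolding sum_dl_prod3 by (simp add: diff_divide_distrib[symmetric] add_divide_distrib[symmetric])
  qed
  finally show ?thesis .
qed

lemma P_sk_all:
  assumes w: "w \<in> S" and n: "w (Gp q s u) + w (Gp s u q) + w (Gp u q s) \<noteq> 0"
    and a: "\<And>a b c. N a b c = - N a c b" and cyc: "\<And>a b c. N a b c = N b c a"
  shows "iP N \<in> S"
proof -
  let ?k = "w (Gp q s u) + w (Gp s u q) + w (Gp u q s)"
  have "iP (\<lambda>a b c. \<Sum>p\<in>UNIV. \<Sum>r\<in>UNIV. \<Sum>t\<in>UNIV. N p r t / (6 * ?k) * (?k * alt3 p r t a b c)) \<in> S"
    by (intro iP_sum iP_scale P_sk w)
  also have "(\<lambda>a b c. \<Sum>p\<in>UNIV. \<Sum>r\<in>UNIV. \<Sum>t\<in>UNIV. N p r t / (6 * ?k) * (?k * alt3 p r t a b c))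
     = (\<lambda>a b c. \<Sum>p\<in>UNIV. \<Sum>r\<in>UNIV. \<Sum>t\<in>UNIV. N p r t / 6 * alt3 p r t a b c)"
    unfolding cancel_factor[OF n] ..
  also have "\<dots> = N"
  proof (intro ext)
    fix x y z
    have "N y z x = N x y z" "N z x y = N x y z" "N x z y = - N x y z" "N y x z = - N x y z" "N z y x = - N x y z"
      using cyc a by metis+
    then show "(\<Sum>p\<in>UNIV. \<Sum>r\<in>UNIV. \<Sum>t\<in>UNIV. N p r t / 6 * alt3 p r t x y z) = N x y z"
      unfolding sum_dl_prod3 by simp
  qed
  finally show ?thesis .
qed

end

section \<open>The distinguished conditions on tuples\<close>

definition trG :: "('m::finite cix \<Rightarrow> complex) \<Rightarrow> 'm \<Rightarrow> complex" where
  "trG w c = (\<Sum>b\<in>UNIV. w (Gm b b c))"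

text \<open>
  \<open>P_gam\<close>, \<open>P_om\<close>, \<open>P_sig\<close>, \<open>P_xy\<close>, \<open>P_zw\<close>, \<open>P_sk\<close>, \<open>P_hk\<close>, \<open>P_G0\<close>, \<open>P_EG\<close> and \<open>P_B\<close> correspond, in this
  order, to \<open>S_m2_00\<close>, \<open>S_m1_10\<close>, \<open>S_m1_21\<close>, \<open>S_m1_1x2\<close>, \<open>S_m1_1x3\<close>, \<open>S_0_11\<close>, \<open>S_0_12\<close>, \<open>S_0_13\<close>, \<open>S_0_0x1\<close>
  and \<open>S_1_00\<close>; the other four distinguished submodules belong to the two families.
\<close>

definition P_gam :: "('m cix \<Rightarrow> complex) \<Rightarrow> bool" where
  "P_gam w \<longleftrightarrow> (\<forall>a. w (Ga a) = 0)"

definition P_sig :: "('m cix \<Rightarrow> complex) \<Rightarrow> bool" where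
  "P_sig w \<longleftrightarrow> P_gam w \<and> (\<forall>a b. w (Ap a b) + w (Ap b a) = 0)"

definition P_om :: "('m::finite cix \<Rightarrow> complex) \<Rightarrow> bool" where
  "P_om w \<longleftrightarrow> P_gam w \<and> Im (\<Sum>a\<in>UNIV. w (Am a a)) = 0"

definition tfM :: "('m::finite cix \<Rightarrow> complex) \<Rightarrow> 'm \<Rightarrow> 'm \<Rightarrow> complex" where
  "tfM w a b = w (Am a b) - dl a b * (\<Sum>p\<in>UNIV. w (Am p p)) / of_nat CARD('m)"

definition P_xy :: "real \<Rightarrow> real \<Rightarrow> ('m::finite cix \<Rightarrow> complex) \<Rightarrow> bool" where
  "P_xy x y w \<longleftrightarrow> P_gam w \<and> (\<forall>a b. of_real x * (tfM w a b + cnj (tfM w b a))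
     + \<i> * of_real y * (tfM w a b - cnj (tfM w b a)) = 0)"

definition P_zw :: "complex \<Rightarrow> complex \<Rightarrow> ('m cix \<Rightarrow> complex) \<Rightarrow> bool" where
  "P_zw p q w \<longleftrightarrow> (\<forall>a b. p * ((w (Ap a b) - w (Ap b a)) / 2) + q * w (Ze a b) = 0)
     \<and> (\<forall>a. (p + 2 * q) * w (Ga a) = 0)"

definition P_sk :: "('m cix \<Rightarrow> complex) \<Rightarrow> bool" where
  "P_sk w \<longleftrightarrow> (\<forall>a b c. w (Gp a b c) + w (Gp b c a) + w (Gp c a b) = 0)
     \<and> (\<forall>a b. w (Ap a b) - w (Ap b a) = w (Ze a b))"

definition P_hk :: "('m cix \<Rightarrow> complex) \<Rightarrow> bool" where
  "P_hk w \<longleftrightarrow> (\<forall>a b c. w (Gp a b c) + w (Gp b a c) = 0)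
     \<and> (\<forall>a b. w (Ap a b) + w (Ze a b) = 0) \<and> P_sig w"

text \<open>Up to sign, the Hermitian and skew-Hermitian parts of \<open>tfM\<close> are the mixed
  components of \<sigma> and the tracefree mixed components of \<tau>; here both vanish.\<close>

definition P_M :: "('m::finite cix \<Rightarrow> complex) \<Rightarrow> bool" where
  "P_M w \<longleftrightarrow> (\<forall>a b. tfM w a b = 0)"

definition tfG :: "('m::finite cix \<Rightarrow> complex) \<Rightarrow> 'm \<Rightarrow> 'm \<Rightarrow> 'm \<Rightarrow> complex" where
  "tfG w a b c = w (Gm a b c) - (dl a b * trG w c - dl a c * trG w b) / (of_nat CARD('m) - 1)"

definition P_G0 :: "('m::finite cix \<Rightarrow> complex) \<Rightarrow> bool" where
  "P_G0 w \<longleftrightarrow> (\<forall>a b c. tfG w a b c = 0) \<and> (\<forall>a b. w (Ze a b) = 0) \<and> P_M w \<and> P_gam w"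

definition P_EG :: "('m::finite cix \<Rightarrow> complex) \<Rightarrow> bool" where
  "P_EG w \<longleftrightarrow> (\<forall>a. 2 * (of_nat CARD('m) - 1) * w (Ee a) = trG w a)
     \<and> (\<forall>a b. (of_nat CARD('m) - 1) * w (Ap a b) + w (Ze a b) = 0) \<and> P_M w \<and> P_sig w"

definition P_B :: "('m::finite cix \<Rightarrow> complex) \<Rightarrow> bool" where
  "P_B w \<longleftrightarrow> (\<forall>a b. w (Be a b) = 0) \<and> P_EG w \<and> P_hk w
     \<and> (2 < CARD('m) \<longrightarrow> P_sk w \<and> P_G0 w)"

context torsion_cmps
begin

lemma m1: "of_nat CARD('m) - 1 \<noteq> (0::complex)" and m0: "of_nat CARD('m) \<noteq> (0::complex)"
  using two by (auto simp: of_nat_diff[symmetric] simp del: of_nat_diff)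

lemma ex_neq: "\<exists>r. r \<noteq> (c::'m)"
proof (rule ccontr)
  assume "\<not> ?thesis"
  then have "(UNIV::'m set) = {c}" by auto
  then have "CARD('m) = card {c}" by (rule arg_cong)
  then show False using two by simp
qed

lemma ex_neq3: "2 < CARD('m) \<Longrightarrow> \<exists>r. r \<noteq> (b::'m) \<and> r \<noteq> c"
proof (rule ccontr)
  assume m: "2 < CARD('m)" and "\<not> ?thesis"
  then have "(UNIV::'m set) \<subseteq> {b, c}" by auto
  then have "CARD('m) \<le> card {b, c}" by (intro card_mono) auto
  then show False using m by (simp add: card_insert_if split: if_splits)
qed

text \<open>A null rotation in the direction p. Among the operators \<open>act\<close> only the null
  rotations connect different heights: they feed components of one height into those one step
  lower.\<close>

lemma nilp: "w \<in> S \<Longrightarrow> act 0 (\<lambda>_ _. 0) (\<lambda>a. z * dl a p) w \<in> S"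
  by (rule act_in) (simp_all add: skewh_def)

lemma sum_dl_scaled [simp]:
  "(\<Sum>q\<in>UNIV. cnj z * dl q p * f q + z * dl q p * g q) = cnj z * f p + z * g (p::'m)"
  by (simp add: sum.distrib mult.assoc sum_distrib_left[symmetric])

section \<open>Consequences of the vanishing of a component\<close>

text \<open>The null rotation in the direction a has the value \<open>- w (Ga a)\<close> at
  \<open>Ap a a\<close>.\<close>

lemma gam_if_sig:
  assumes "\<And>w a b. w \<in> S \<Longrightarrow> w (Ap a b) + w (Ap b a) = 0" and w: "w \<in> S"
  shows "P_gam w"
  unfolding P_gam_def
proof
  fix a
  have "act 0 (\<lambda>_ _. 0) (\<lambda>b. 1 * dl b a) w (Ap a a) + act 0 (\<lambda>_ _. 0) (\<lambda>b. 1 * dl b a) w (Ap a a) = 0"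
    by (intro assms(1) nilp w)
  then show "w (Ga a) = 0" by simp
qed

text \<open>The null rotation in a direction a other than b has the value \<open>- w (Ga b)\<close>
  at \<open>Am a b\<close>, off the diagonal and hence unaffected by the trace.\<close>

lemma gam_if_M:
  assumes "\<And>w. w \<in> S \<Longrightarrow> P_M w" and w: "w \<in> S"
  shows "P_gam w"
  unfolding P_gam_def
proof
  fix b :: 'm
  obtain a where ab: "a \<noteq> b" using ex_neq[of b] by blast
  have "P_M (act 0 (\<lambda>_ _. 0) (\<lambda>c. 1 * dl c a) w)"
    by (intro assms(1) nilp w)
  then have "tfM (act 0 (\<lambda>_ _. 0) (\<lambda>c. 1 * dl c a) w) a b = 0" by (simp add: P_M_def)
  then show "w (Ga b) = 0" using ab by (simp add: tfM_def)
qed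

text \<open>A null rotation in a direction a different from b and c turns the cyclic sum into
  \<open>Ap b c - Ap c b - Ze b c\<close>. Such a third index exists because m > 2.\<close>

lemma vanish_sk:
  assumes van: "\<And>w a b c. w \<in> S \<Longrightarrow> w (Gp a b c) + w (Gp b c a) + w (Gp c a b) = 0"
    and m: "2 < CARD('m)" and w: "w \<in> S"
  shows "P_sk w"
  unfolding P_sk_def
proof (intro conjI allI)
  show "w (Gp a b c) + w (Gp b c a) + w (Gp c a b) = 0" for a b c by (rule van[OF w])
  fix b c
  show "w (Ap b c) - w (Ap c b) = w (Ze b c)"
  proof (cases "b = c")
    case True
    then show ?thesis using anti_Ze[OF w, of c c] by simp
  next
    case False
    obtain a where "a \<noteq> b" "a \<noteq> c" using ex_neq3[OF m] by blast
    then show ?thesis using van[OF nilp[OF w, of 1 a], of a b c] False by (simp add: algebra_simps)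
  qed
qed

text \<open>At the indices a, a, c the null rotation in the direction c isolates
  \<open>Ap a a\<close>; at a, a, b the one in the direction a isolates
  \<open>Ap a b + Ze a b\<close>. So \<open>Ap\<close> is skew, and \<gamma> vanishes with the
  symmetric part.\<close>

lemma vanish_hk:
  assumes van: "\<And>w a b c. w \<in> S \<Longrightarrow> w (Gp a b c) + w (Gp b a c) = 0" and w: "w \<in> S"
  shows "P_hk w"
proof -
  have d: "w (Ap a a) = 0" if w: "w \<in> S" for w a
  proof -
    obtain c where "c \<noteq> a" using ex_neq[of a] by blast
    then show ?thesis using van[OF nilp[OF w, of 1 c], of a a c] by simp
  qed
  have o: "w (Ap a b) + w (Ze a b) = 0" if w: "w \<in> S" for w a b
  proof (cases "a = b")
    case True
    then show ?thesis using d[OF w] anti_Ze[OF w, of b b] by simp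
  next
    case False
    then have "2 * w (Ap a b) + 2 * w (Ze a b) = 0"
      using van[OF nilp[OF w, of 1 a], of a a b] by (simp add: neg_eq_iff_add_eq_0 add.commute)
    then have "2 * (w (Ap a b) + w (Ze a b)) = 0" by (simp only: distrib_left)
    then show ?thesis unfolding mult_eq_0_iff by simp
  qed
  have s: "w (Ap a b) + w (Ap b a) = 0" if w: "w \<in> S" for w a b
  proof -
    have "w (Ap a b) + w (Ap b a) = (w (Ap a b) + w (Ze a b)) + (w (Ap b a) + w (Ze b a))"
      unfolding anti_Ze[OF w, of a b] by simp
    also have "\<dots> = 0" using o[OF w, of a b] o[OF w, of b a] by simp
    finally show ?thesis .
  qed
  show ?thesis unfolding P_hk_def P_sig_def
    using van[OF w] o[OF w] s[OF w] gam_if_sig[OF s w] by simp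
qed

text \<open>Under the null rotation with parameter z in the direction p, the terms in the conjugate
  of z give the relation between \<open>Ap\<close> and \<open>Ze\<close>, and those in z give m
  times \<open>tfM w p a\<close>.\<close>

lemma vanish_EG:
  assumes van: "\<And>w a. w \<in> S \<Longrightarrow> 2 * (of_nat CARD('m) - 1) * w (Ee a) = trG w a" and w: "w \<in> S"
  shows "P_EG w"
proof -
  let ?m = "of_nat CARD('m) :: complex"
  have *: "(?m - 1) * w (Ap p a) + w (Ze p a) = 0 \<and> (?m - 1) * w (Am p a) = dl p a * (\<Sum>b\<in>UNIV. w (Am b b)) - w (Am p a)"
    if w: "w \<in> S" for w p a
  proof -
    have "z * ((?m - 1) * w (Am p a) - (dl p a * (\<Sum>b\<in>UNIV. w (Am b b)) - w (Am p a)))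
        + cnj z * ((?m - 1) * w (Ap p a) + w (Ze p a)) = 0" for z
    proof -
      have t: "trG (act 0 (\<lambda>_ _. 0) (\<lambda>q. z * dl q p) w) a
        = - (cnj z * w (Ze p a)) - z * w (Am p a) + z * dl p a * (\<Sum>b\<in>UNIV. w (Am b b))"
        by (simp add: trG_def sum.distrib sum_subtractf sum_negf mult.assoc sum_distrib_left[symmetric]
            dl_commute[of a])
      have e: "2 * (?m - 1) * act 0 (\<lambda>_ _. 0) (\<lambda>q. z * dl q p) w (Ee a)
        = (?m - 1) * (cnj z * w (Ap p a) + z * w (Am p a))" by simp
      show ?thesis using van[OF nilp[OF w, of z p], of a] unfolding t e by (simp add: algebra_simps)
    qed
    from conj_linear_zero[OF this] show ?thesis by (simp add: algebra_simps)
  qed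
  have s: "w (Ap a b) + w (Ap b a) = 0" if w: "w \<in> S" for w a b
  proof -
    have "(?m - 1) * (w (Ap a b) + w (Ap b a))
        = ((?m - 1) * w (Ap a b) + w (Ze a b)) + ((?m - 1) * w (Ap b a) + w (Ze b a))"
      unfolding anti_Ze[OF w, of a b] by (simp add: algebra_simps)
    also have "\<dots> = 0" using *[OF w, of a b] *[OF w, of b a] by simp
    finally have "(?m - 1) * (w (Ap a b) + w (Ap b a)) = 0" .
    then show ?thesis using m1 by simp
  qed
  have M: "P_M w" unfolding P_M_def tfM_def using *[OF w] m0 by (simp add: field_simps)
  show ?thesis unfolding P_EG_def P_sig_def
    using van[OF w] *[OF w] M s[OF w] gam_if_sig[OF s w] by simp
qed

text \<open>Without tracefree part, \<open>Gm a b c\<close> is zero for a different from b and c,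
  and \<open>Gm a a c\<close> is the same for all a different from c. Null rotations of the first
  equation in the directions a and b give \<open>Ze\<close> and the off-diagonal part of
  \<open>Am\<close>; those of the second in the direction c compare the diagonal entries of
  \<open>Am\<close>.\<close>

lemma vanish_G0:
  assumes van: "\<And>w a b c. w \<in> S \<Longrightarrow> tfG w a b c = 0" and m: "2 < CARD('m)" and w: "w \<in> S"
  shows "P_G0 w"
proof -
  have di: "w (Gm a b c) = 0" if "w \<in> S" "a \<noteq> b" "a \<noteq> c" for w a b c
    using van[OF that(1), of a b c] that by (simp add: tfG_def)
  have eq: "w (Gm a a c) = w (Gm b b c)" if "w \<in> S" "a \<noteq> c" "b \<noteq> c" for w a b c
    using van[OF that(1), of a a c] van[OF that(1), of b b c] that by (simp add: tfG_def)
  have Z: "w (Ze b c) = 0" if w: "w \<in> S" for w b c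
  proof (cases "b = c")
    case True
    then show ?thesis using anti_Ze[OF w, of b b] by simp
  next
    case False
    obtain a where a: "a \<noteq> b" "a \<noteq> c" using ex_neq3[OF m] by blast
    then have b: "z * 0 + cnj z * w (Ze b c) = 0" for z
      using di[OF nilp[OF w, of z a], of a b c] by simp
    show ?thesis by (rule conj_linear_zero(2)[OF b])
  qed
  have M1: "w (Am a c) = 0" if w: "w \<in> S" and ac: "a \<noteq> c" for w a c
  proof -
    obtain b where "b \<noteq> a" "b \<noteq> c" using ex_neq3[OF m] by blast
    then show ?thesis using di[OF nilp[OF w, of 1 b], of a b c] ac by simp
  qed
  have M2: "w (Am a a) = w (Am b b)" if w: "w \<in> S" for w a b
  proof -
    obtain c where "c \<noteq> a" "c \<noteq> b" using ex_neq3[OF m] by blast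
    then show ?thesis using eq[OF nilp[OF w, of 1 c], of a c b] by simp
  qed
  have M: "P_M w" if w: "w \<in> S" for w
    unfolding P_M_def
  proof (intro allI)
    fix a b
    have "(\<Sum>p\<in>UNIV. w (Am p p)) = (\<Sum>p\<in>(UNIV::'m set). w (Am a a))"
      by (intro sum.cong refl M2[OF w])
    then show "tfM w a b = 0" using M1[OF w, of a b] m0 by (cases "a = b") (simp_all add: tfM_def)
  qed
  show ?thesis unfolding P_G0_def using van[OF w] Z[OF w] M[OF w] gam_if_M[OF M w] by simp
qed

text \<open>A null rotation of \<open>Be\<close> kills \<open>Gp\<close> and forces
  \<open>Gm\<close> into the shape of \<open>conf_EG\<close>. Its tracefree part is then zero and
  its trace is tied to \<open>Ee\<close>, so the preceding lemmas apply.\<close>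

lemma vanish_B:
  assumes van: "\<And>w a b. w \<in> S \<Longrightarrow> w (Be a b) = 0" and w: "w \<in> S"
  shows "P_B w"
proof -
  have *: "w (Gm p a b) = 2 * dl p a * w (Ee b) - 2 * dl p b * w (Ee a) \<and> w (Gp p a b) = 0"
    if w: "w \<in> S" for w p a b
  proof -
    have "z * (w (Gm p a b) - (2 * dl p a * w (Ee b) - 2 * dl p b * w (Ee a))) + cnj z * w (Gp p a b) = 0" for z
    proof -
      have e: "act 0 (\<lambda>_ _. 0) (\<lambda>q. z * dl q p) w (Be a b)
        = (cnj z * w (Gp p a b) + z * w (Gm p a b)) / 2 - z * dl p a * w (Ee b) + z * dl p b * w (Ee a)"
        by (simp add: dl_commute[of a] dl_commute[of b])
      show ?thesis using van[OF nilp[OF w, of z p], of a b] unfolding e by (simp add: field_simps)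
    qed
    from conj_linear_zero[OF this] show ?thesis by simp
  qed
  have tr: "trG w a = 2 * (of_nat CARD('m) - 1) * w (Ee a)" if w: "w \<in> S" for w a
  proof -
    have "trG w a = (\<Sum>b\<in>UNIV. 2 * w (Ee a) - dl b a * (2 * w (Ee b)))"
      unfolding trG_def by (intro sum.cong refl) (simp add: *[OF w])
    then show ?thesis by (simp add: sum_subtractf) (simp add: algebra_simps)
  qed
  have G: "tfG w a b c = 0" if w: "w \<in> S" for w a b c
    unfolding tfG_def tr[OF w] conjunct1[OF *[OF w, of a b c]] using m1 by (simp add: field_simps)
  have "2 < CARD('m) \<Longrightarrow> P_G0 w" by (rule vanish_G0[OF G _ w])
  moreover have "2 < CARD('m) \<Longrightarrow> P_sk w" by (rule vanish_sk[OF _ _ w]) (simp_all add: *)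
  moreover have "P_hk w" by (rule vanish_hk[OF _ w]) (simp_all add: *)
  moreover have "P_EG w" by (rule vanish_EG[OF _ w]) (simp add: tr)
  ultimately show ?thesis using van[OF w] by (simp add: P_B_def)
qed

section \<open>The tracefree part of the component in degree zero and charge one\<close>

text \<open>Tracefree when a differs from b and c; these tensors and the differences in
  \<open>tri_loop\<close> span the tracefree part.\<close>

definition tri :: "'m \<Rightarrow> 'm \<Rightarrow> 'm \<Rightarrow> 'm cix \<Rightarrow> complex" where
  "tri a b c = iEG (\<lambda>_. 0) (\<lambda>x y z. dl x a * wdg b c y z)"

lemma el_iEG: "el p q (iEG e T) = iEG (\<lambda>x. dl x p * e q)
    (\<lambda>x y z. - dl x q * T p y z + dl y p * T x q z + dl z p * T x y q)"
proof
  show "el p q (iEG e T) c = iEG (\<lambda>x. dl x p * e q)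
    (\<lambda>x y z. - dl x q * T p y z + dl y p * T x q z + dl z p * T x y q) c" for c
    by (cases c) simp_all
qed

lemma iEG_el: "iEG e T \<in> S \<Longrightarrow> iEG (\<lambda>x. dl x p * e q)
    (\<lambda>x y z. - dl x q * T p y z + dl y p * T x q z + dl z p * T x y q) \<in> S"
  using el_in[of "iEG e T" p q] by (simp add: el_iEG Sc_S)

lemma iEG_cong: "iEG e T \<in> S \<Longrightarrow> (\<And>a. e a = e' a) \<Longrightarrow> (\<And>a b c. T a b c = T' a b c) \<Longrightarrow> iEG e' T' \<in> S"
  by (subst (asm) ext[of e e'], simp, subst (asm) ext[of T T']) (auto intro!: ext)

lemma iEG_zero: "iEG (\<lambda>_. 0) (\<lambda>_ _ _. 0) \<in> S"
proof -
  have "iEG (\<lambda>_. 0) (\<lambda>_ _ _. 0) = (\<lambda>_::'m cix. 0)"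
  proof
    show "iEG (\<lambda>_. 0) (\<lambda>_ _ _. 0) c = 0" for c :: "'m cix" by (cases c) simp_all
  qed
  then show ?thesis using zero by simp
qed

text \<open>\<open>el p p\<close> is diagonal; its eigenvalue is the weight of the index p, counted
  negatively in the barred place. The quadratic polynomial \<open>x * (x + s)\<close> of it serves
  to select a weight.\<close>

lemma iEG_weight:
  assumes "iEG e T \<in> S"
  shows "iEG (\<lambda>x. dl x p * (dl x p + s) * e x)
    (\<lambda>x y z. (dl y p + dl z p - dl x p) * (dl y p + dl z p - dl x p + s) * T x y z) \<in> S"
proof -
  have 1: "iEG (\<lambda>x. dl x p * e x) (\<lambda>x y z. (dl y p + dl z p - dl x p) * T x y z) \<in> S"
    if "iEG e T \<in> S" for e T
    using iEG_el[OF that, of p p]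
    by (rule iEG_cong) (auto simp: dl_def algebra_simps)
  from iEG_add[OF 1[OF 1[OF assms]] iEG_scale[OF 1[OF assms], of s]]
  show ?thesis by (rule iEG_cong) (simp_all add: algebra_simps)
qed

text \<open>Skewness leaves only the weights -1, 0 and 1. The polynomial \<open>x * (x - 1)\<close>
  selects -1 for a and also removes \<open>Ee\<close>; \<open>x * (x + 1)\<close> selects 1 for b
  and for c. Each takes the value 2 there, hence the factor 8.\<close>

lemma tri_isolate:
  assumes w: "w \<in> S" and d: "a \<noteq> b" "a \<noteq> c" "b \<noteq> c" and n: "w (Gm a b c) \<noteq> 0"
  shows "tri a b c \<in> S"
proof -
  let ?T = "\<lambda>x y z. w (Gm x y z)"
  have 1: "iEG (\<lambda>_. 0) (\<lambda>x y z. (dl y a + dl z a - dl x a) * (dl y a + dl z a - dl x a - 1) * ?T x y z) \<in> S"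
    using iEG_weight[OF piece_EG[OF w], of a "-1"] by (rule iEG_cong) (simp_all add: dl_def)
  have z: "?T x y y = 0" for x y using anti_Gm[OF w, of x y y] by simp
  show ?thesis
    using iEG_scale[OF iEG_weight[OF iEG_weight[OF 1, of b 1], of c 1], of "1 / (8 * ?T a b c)"] unfolding tri_def
  proof (rule iEG_cong)
    fix x y z
    show "1 / (8 * ?T a b c) * ((dl y c + dl z c - dl x c) * (dl y c + dl z c - dl x c + 1) *
       ((dl y b + dl z b - dl x b) * (dl y b + dl z b - dl x b + 1) *
       ((dl y a + dl z a - dl x a) * (dl y a + dl z a - dl x a - 1) * ?T x y z))) = dl x a * wdg b c y z"
    proof (cases "y = z")
      case True
      then show ?thesis by (simp add: z wdg_def)
    next
      case False
      have "x = a \<or> x = b \<or> x = c \<or> (x \<noteq> a \<and> x \<noteq> b \<and> x \<noteq> c)"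
        "y = a \<or> y = b \<or> y = c \<or> (y \<noteq> a \<and> y \<noteq> b \<and> y \<noteq> c)"
        "z = a \<or> z = b \<or> z = c \<or> (z \<noteq> a \<and> z \<noteq> b \<and> z \<noteq> c)" by blast+
      then show ?thesis using d n False anti_Gm[OF w, of a c b]
        by (elim disjE) (simp_all add: wdg_def)
    qed
  qed simp
qed

lemma tri_swap: "tri a b c \<in> S \<Longrightarrow> tri a c b \<in> S"
  unfolding tri_def by (drule iEG_scale[of _ _ "-1"], erule iEG_cong) (simp_all add: wdg_def algebra_simps)

lemma tri_move: "tri a b c \<in> S \<Longrightarrow> a \<noteq> b \<Longrightarrow> a \<noteq> c \<Longrightarrow> b \<noteq> c \<Longrightarrow> d \<noteq> a \<Longrightarrow> tri a d c \<in> S"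
  unfolding tri_def by (drule iEG_el[of _ _ d b], erule iEG_cong) (simp_all add: wdg_def algebra_simps)

text \<open>\<open>el a b\<close> replaces an unbarred b by a and, with a minus sign, a barred a by
  b. The result is a difference of two tensors with equal trace.\<close>

lemma tri_loop:
  assumes "tri a b c \<in> S" "a \<noteq> b" "a \<noteq> c" "b \<noteq> c"
  shows "iEG (\<lambda>_. 0) (\<lambda>x y z. dl x a * wdg a c y z - dl x b * wdg b c y z) \<in> S"
  using iEG_el[OF assms(1)[unfolded tri_def], of a b]
  by (rule iEG_cong) (use assms in \<open>simp_all add: wdg_def algebra_simps\<close>)

text \<open>A second application of \<open>el a b\<close>, now to the result of
  \<open>tri_loop\<close>, gives -2 times the tensor with a and b interchanged.\<close>

lemma tri_bar:
  assumes "tri a b c \<in> S" "a \<noteq> b" "a \<noteq> c" "b \<noteq> c"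
  shows "tri b a c \<in> S"
  unfolding tri_def using iEG_scale[OF iEG_el[OF tri_loop[OF assms], of a b], of "-1/2"]
  by (rule iEG_cong) (use assms in \<open>simp_all add: wdg_def algebra_simps\<close>)

text \<open>The barred index is brought into place through \<open>tri_bar\<close>, then the other
  two one at a time by \<open>tri_move\<close>, with \<open>tri_swap\<close> exchanging their
  roles.\<close>

lemma tri_all:
  assumes t: "tri a b c \<in> S" and d: "a \<noteq> b" "a \<noteq> c" "b \<noteq> c" and d': "a' \<noteq> b'" "a' \<noteq> c'" "b' \<noteq> c'"
  shows "tri a' b' c' \<in> S"
proof -
  have 1: "\<exists>b c. tri a' b c \<in> S \<and> a' \<noteq> b \<and> a' \<noteq> c \<and> b \<noteq> c"
  proof -
    consider "a' = a" | "a' = b" | "a' = c" | "a' \<noteq> a" "a' \<noteq> b" "a' \<noteq> c" by blast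
    then show ?thesis
    proof cases
      case 1 then show ?thesis using t d by blast
    next
      case 2 then show ?thesis using tri_bar[OF t d] d by metis
    next
      case 3 then show ?thesis using tri_bar[OF tri_swap[OF t]] d by metis
    next
      case 4 then show ?thesis using tri_bar[OF tri_move[OF t d, of a']] d by metis
    qed
  qed
  then obtain b c where t: "tri a' b c \<in> S" and d: "a' \<noteq> b" "a' \<noteq> c" "b \<noteq> c" by blast
  have 2: "\<exists>c. tri a' b' c \<in> S \<and> a' \<noteq> c \<and> b' \<noteq> c"
  proof (cases "b' = c")
    case True then show ?thesis using tri_swap[OF t] d by metis
  next
    case False then show ?thesis using tri_move[OF t d, of b'] d d' by metis
  qed
  then obtain c where t: "tri a' b' c \<in> S" and d: "a' \<noteq> c" "b' \<noteq> c" by blast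
  show ?thesis using tri_swap[OF tri_move[OF tri_swap[OF t], of c']] d d' by metis
qed

text \<open>The entries with three different indices are combinations of \<open>tri\<close>. The
  others are given by \<open>N a a c\<close>; each is compared with a reference index
  \<open>r c\<close> as in \<open>tri_loop\<close>, and the reference terms cancel because N is
  tracefree.\<close>

lemma G0_all:
  assumes w: "w \<in> S" and d: "a0 \<noteq> b0" "a0 \<noteq> c0" "b0 \<noteq> c0" and n: "w (Gm a0 b0 c0) \<noteq> 0"
    and anti: "\<And>a b c. N a b c = - N a c b" and tr: "\<And>c. (\<Sum>b\<in>UNIV. N b b c) = 0"
  shows "iEG (\<lambda>_. 0) N \<in> S"
proof -
  have tri: "tri a b c \<in> S" if "a \<noteq> b" "a \<noteq> c" "b \<noteq> c" for a b c
    using tri_all[OF tri_isolate[OF w d n] d that] .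
  have zer: "iEG (\<lambda>_. 0) (\<lambda>_ _ _. 0) \<in> S"
    by (rule iEG_zero)
  define N1 where "N1 a b c = (if a \<noteq> b \<and> a \<noteq> c \<and> b \<noteq> c then N a b c else 0)" for a b c
  define n where "n a c = N a a c" for a c
  define r where "r c = (SOME r. r \<noteq> c)" for c :: 'm
  have r: "r c \<noteq> c" for c unfolding r_def using someI_ex[OF ex_neq] .
  have z: "N x y y = 0" for x y using anti[of x y y] by simp
  have "iEG (\<lambda>x. \<Sum>a\<in>(UNIV::'m set). \<Sum>b\<in>(UNIV::'m set). \<Sum>c\<in>(UNIV::'m set). N1 a b c / 2 * 0)
    (\<lambda>x y z. \<Sum>a\<in>UNIV. \<Sum>b\<in>UNIV. \<Sum>c\<in>UNIV. N1 a b c / 2 * (dl x a * wdg b c y z)) \<in> S"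
  proof (intro iEG_sum)
    fix a b c
    show "iEG (\<lambda>x. N1 a b c / 2 * 0) (\<lambda>x y z. N1 a b c / 2 * (dl x a * wdg b c y z)) \<in> S"
    proof (cases "a \<noteq> b \<and> a \<noteq> c \<and> b \<noteq> c")
      case True
      then show ?thesis using tri[of a b c] by (intro iEG_scale) (simp add: tri_def)
    next
      case False
      then have "N1 a b c = 0" by (auto simp: N1_def)
      then show ?thesis using zer by simp
    qed
  qed
  moreover have "(\<Sum>a\<in>UNIV. \<Sum>b\<in>UNIV. \<Sum>c\<in>UNIV. N1 a b c / 2 * (dl x a * wdg b c y z)) = N1 x y z" for x y z
  proof -
    have "(\<Sum>a\<in>UNIV. \<Sum>b\<in>UNIV. \<Sum>c\<in>UNIV. N1 a b c / 2 * (dl x a * wdg b c y z))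
      = (\<Sum>a\<in>UNIV. dl x a * (\<Sum>b\<in>UNIV. \<Sum>c\<in>UNIV. N1 a b c / 2 * wdg b c y z))"
      unfolding sum_distrib_left by (intro sum.cong refl) (simp add: ac_simps)
    also have "\<dots> = N1 x y z" unfolding sum_dl sum_wdg
      using anti[of x z y] by (auto simp: N1_def)
    finally show ?thesis .
  qed
  ultimately have 1: "iEG (\<lambda>_. 0) N1 \<in> S" by simp
  have "iEG (\<lambda>x. \<Sum>a\<in>(UNIV::'m set). \<Sum>c\<in>(UNIV::'m set). n a c * 0)
    (\<lambda>x y z. \<Sum>a\<in>UNIV. \<Sum>c\<in>UNIV. n a c * (dl x a * wdg a c y z - dl x (r c) * wdg (r c) c y z)) \<in> S"
  proof (intro iEG_sum)
    fix a c
    show "iEG (\<lambda>x. n a c * 0) (\<lambda>x y z. n a c * (dl x a * wdg a c y z - dl x (r c) * wdg (r c) c y z)) \<in> S"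
    proof (cases "a \<noteq> r c \<and> a \<noteq> c")
      case True
      then show ?thesis using tri_loop[OF tri[of a "r c" c]] r by (intro iEG_scale) simp
    next
      case False
      then show ?thesis using zer by (auto simp: n_def z)
    qed
  qed
  moreover have "(\<Sum>a\<in>UNIV. \<Sum>c\<in>UNIV. n a c * (dl x a * wdg a c y z - dl x (r c) * wdg (r c) c y z))
      = dl x y * n x z - dl x z * n x y" for x y z
  proof -
    have "(\<Sum>a\<in>UNIV. \<Sum>c\<in>UNIV. n a c * (dl x (r c) * wdg (r c) c y z))
       = (\<Sum>c\<in>UNIV. (\<Sum>a\<in>UNIV. n a c) * (dl x (r c) * wdg (r c) c y z))"
      unfolding sum_distrib_right by (rule sum.swap)
    also have "\<dots> = 0" by (simp add: n_def tr)
    finally have e: "(\<Sum>a\<in>UNIV. \<Sum>c\<in>UNIV. n a c * (dl x (r c) * wdg (r c) c y z)) = 0" .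
    have "(\<Sum>a\<in>UNIV. \<Sum>c\<in>UNIV. n a c * (dl x a * wdg a c y z))
      = (\<Sum>a\<in>UNIV. dl x a * (dl y a * (\<Sum>c\<in>UNIV. n a c * dl z c) - dl z a * (\<Sum>c\<in>UNIV. n a c * dl y c)))"
      unfolding sum_distrib_left sum_subtractf[symmetric]
      by (intro sum.cong refl) (simp add: wdg_def algebra_simps)
    also have "\<dots> = dl x y * n x z - dl x z * n x y"
      by (simp only: sum_dl) (simp add: dl_commute)
    finally show ?thesis using e by (simp add: right_diff_distrib sum_subtractf)
  qed
  ultimately have 2: "iEG (\<lambda>_. 0) (\<lambda>x y z. dl x y * n x z - dl x z * n x y) \<in> S" by simp
  show ?thesis using iEG_add[OF 1 2]
  proof (rule iEG_cong)
    show "N1 x y z + (dl x y * n x z - dl x z * n x y) = N x y z" for x y z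
      using z anti[of x y x] by (auto simp: N1_def n_def dl_def)
  qed simp
qed

text \<open>The third hypothesis is what the second one gives along infinitesimal rotations of the frame.\<close>

lemma tfG_zero:
  assumes anti: "\<And>a b c. w (Gm a b c) = - w (Gm a c b)"
    and di: "\<And>a b c. a \<noteq> b \<Longrightarrow> a \<noteq> c \<Longrightarrow> b \<noteq> c \<Longrightarrow> w (Gm a b c) = 0"
    and eq: "\<And>a b c. a \<noteq> b \<Longrightarrow> a \<noteq> c \<Longrightarrow> b \<noteq> c \<Longrightarrow> w (Gm a a c) = w (Gm b b c)"
  shows "tfG w a b (c::'m) = 0"
proof -
  have z: "w (Gm x y y) = 0" for x y using anti[of x y y] by simp
  have tr: "trG w c = (of_nat CARD('m) - 1) * w (Gm a a c)" if "a \<noteq> c" for a c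
  proof -
    have "trG w c = (\<Sum>b\<in>UNIV - {c}. w (Gm b b c))"
      unfolding trG_def by (subst sum.remove[of _ c]) (simp_all add: z)
    also have "\<dots> = (\<Sum>b\<in>UNIV - {c}. w (Gm a a c))"
    proof (rule sum.cong)
      fix x assume "x \<in> UNIV - {c}"
      then show "w (Gm x x c) = w (Gm a a c)" using eq[of x a c] that by (cases "x = a") auto
    qed simp
    also have "\<dots> = (of_nat CARD('m) - 1) * w (Gm a a c)"
      using two by (simp add: card_Diff_singleton of_nat_diff)
    finally show ?thesis .
  qed
  consider "b = c" | "a = b" "b \<noteq> c" | "a = c" "b \<noteq> c" | "a \<noteq> b" "a \<noteq> c" "b \<noteq> c" by blast
  then show ?thesis
  proof cases
    case 1 then show ?thesis by (simp add: tfG_def z)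
  next
    case 2 then show ?thesis using tr[of a c] m1 by (simp add: tfG_def)
  next
    case 3 then show ?thesis using tr[of a b] m1 anti[of a b a] by (simp add: tfG_def)
  next
    case 4 then show ?thesis by (simp add: tfG_def di)
  qed
qed

lemma tfG_anti:
  assumes "\<And>a b c. w (Gm a b c) = - w (Gm a c b)"
  shows "tfG w a b c = - tfG w a c b"
  unfolding tfG_def using assms[of a b c] by (simp add: diff_divide_distrib)

lemma tfG_trace: "(\<Sum>b\<in>UNIV. tfG w b b (c::'m)) = 0"
proof -
  have "(\<Sum>b\<in>UNIV. dl b b * trG w c - dl b c * trG w b) = (of_nat CARD('m) - 1) * trG w c"
    by (simp add: sum_subtractf algebra_simps)
  then show ?thesis using m1
    by (simp add: tfG_def sum_subtractf trG_def[symmetric] sum_divide_distrib[symmetric] del: dl_same)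
qed

text \<open>The alternative depends on whether some element of S is nonzero at three different
  indices. For m = 2 there are no such indices and the second case holds.\<close>

lemma tfG_cases:
  obtains (all) "\<And>N. (\<And>a b c. N a b c = - N a c b) \<Longrightarrow> (\<And>c. (\<Sum>b\<in>UNIV. N b b c) = 0) \<Longrightarrow> iEG (\<lambda>_. 0) N \<in> S"
  | (none) "\<And>w a b c. w \<in> S \<Longrightarrow> tfG w a b c = 0"
proof (cases "\<exists>w\<in>S. \<exists>a b c. a \<noteq> b \<and> a \<noteq> c \<and> b \<noteq> c \<and> w (Gm a b c) \<noteq> 0")
  case True
  then obtain w a b c where "w \<in> S" "a \<noteq> b" "a \<noteq> c" "b \<noteq> c" "w (Gm a b c) \<noteq> 0" by blast
  then show thesis by (intro all G0_all)
next
  case False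
  then have di: "w (Gm a b c) = 0" if "w \<in> S" "a \<noteq> b" "a \<noteq> c" "b \<noteq> c" for w a b c
    using that by blast
  show thesis
  proof (rule none, rule tfG_zero)
    fix w assume w: "w \<in> S"
    show "w (Gm a b c) = - w (Gm a c b)" for a b c by (rule anti_Gm[OF w])
    show "w (Gm a b c) = 0" if "a \<noteq> b" "a \<noteq> c" "b \<noteq> c" for a b c by (rule di[OF w that])
    show "w (Gm a a c) = w (Gm b b c)" if "a \<noteq> b" "a \<noteq> c" "b \<noteq> c" for a b c
      using di[OF iEG_el[OF piece_EG[OF w], of b a] that] that by simp
  qed
qed

lemma EG_tf:
  assumes w: "w \<in> S"
  shows "iEG (\<lambda>_. 0) (tfG w) \<in> S"
proof (cases rule: tfG_cases)
  case all
  show ?thesis by (intro all tfG_anti anti_Gm w tfG_trace)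
next
  case none
  have "tfG w = (\<lambda>_ _ _. 0)" using none[OF w] by (intro ext)
  moreover have "iEG (\<lambda>_. 0) (\<lambda>_ _ _. 0) \<in> S"
    by (rule iEG_zero)
  ultimately show ?thesis by simp
qed

text \<open>Removing from w the tracefree part of \<open>Gm\<close> and the multiple of
  \<open>conf_EG\<close> with the same trace leaves only \<open>Ee\<close>, with a value
  proportional to the deviation from \<open>2 (m - 1) Ee = trG\<close>.\<close>

lemma EG_all:
  assumes w: "w \<in> S" and n: "2 * (of_nat CARD('m) - 1) * w (Ee q) \<noteq> trG w q"
  shows "iEG e (\<lambda>_ _ _. 0) \<in> S"
proof -
  define k :: complex where "k = of_nat CARD('m) - 1"
  have k: "k \<noteq> 0" using m1 by (simp add: k_def)
  let ?e = "\<lambda>a. w (Ee a) - trG w a / (2 * k)"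
  have "iEG ?e (\<lambda>_ _ _. 0) \<in> S"
    using iEG_add[OF iEG_add[OF piece_EG[OF w] iEG_scale[OF EG_tf[OF w], of "-1"]]
        iEG_scale[OF conf_EG[of "\<lambda>a. trG w a / (2 * k)"], of "-1"]]
    by (rule iEG_cong) (use k in \<open>simp_all add: tfG_def k_def[symmetric] field_simps\<close>)
  then have "iEG (\<lambda>a. \<Sum>p\<in>UNIV. e p / ?e q * (dl a p * ?e q)) (\<lambda>a b c. \<Sum>p\<in>(UNIV::'m set). e p / ?e q *
      (- dl a q * 0 + dl b p * 0 + dl c p * 0)) \<in> S"
    by (intro iEG_sum iEG_scale iEG_el)
  moreover have "?e q \<noteq> 0" using n k by (simp add: k_def[symmetric] field_simps)
  ultimately show ?thesis by (simp add: mult.commute[of "dl _ _"])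
qed

end

text \<open>Rewrites the complex condition as the vanishing of one real functional, with
  coefficients p and q, on the two kinds of numbers that \<open>L_tfM\<close> places in
  \<open>L\<close>.\<close>

lemma P_xy_iff:
  "P_xy p (- q) w \<longleftrightarrow> P_gam w \<and> (\<forall>a b. p * Re (tfM w a b + tfM w b a) + q * Im (tfM w a b + tfM w b a) = 0
    \<and> p * Re (\<i> * (tfM w a b - tfM w b a)) + q * Im (\<i> * (tfM w a b - tfM w b a)) = 0)"
proof -
  have "of_real p * (u + cnj v) + \<i> * of_real (- q) * (u - cnj v) = 0 \<longleftrightarrow>
      p * Re (u + v) + q * Im (u + v) = 0 \<and> p * Re (\<i> * (u - v)) + q * Im (\<i> * (u - v)) = 0" for u v
    by (auto simp: complex_eq_iff algebra_simps)
  then show ?thesis by (simp only: P_xy_def)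
qed

context torsion_cmps
begin

section \<open>The component of charge zero\<close>

lemma iM_cong: "iM A \<in> S \<Longrightarrow> (\<And>x y. A x y = B x y) \<Longrightarrow> iM B \<in> S"
  by (subst (asm) ext[of A B]) (auto intro!: ext)

lemma iM_zero: "iM (\<lambda>_ _. 0) \<in> S"
proof -
  have "iM (\<lambda>_ _. 0) = (\<lambda>_::'m cix. 0)"
  proof
    show "iM (\<lambda>_ _. 0) c = 0" for c :: "'m cix" by (cases c) simp_all
  qed
  then show ?thesis using zero by simp
qed

lemma iM_scale: "iM A \<in> S \<Longrightarrow> iM (\<lambda>x y. of_real r * A x y) \<in> S"
proof -
  assume "iM A \<in> S"
  then have "(\<lambda>c. of_real r * iM A c) \<in> S" by (rule scale)
  also have "(\<lambda>c. of_real r * iM A c) = iM (\<lambda>x y. of_real r * A x y)"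
  proof
    show "of_real r * iM A c = iM (\<lambda>x y. of_real r * A x y) c" for c by (cases c) simp_all
  qed
  finally show ?thesis .
qed

lemma iM_act:
  assumes "iM A \<in> S" and "skewh U"
  shows "iM (\<lambda>x y. (\<Sum>p\<in>UNIV. cnj (U p x) * A p y) + (\<Sum>p\<in>UNIV. U p y * A x p)) \<in> S"
proof -
  have "act 0 U (\<lambda>_. 0) (iM A) \<in> S" by (intro act_in assms)
  also have "act 0 U (\<lambda>_. 0) (iM A)
    = iM (\<lambda>x y. (\<Sum>p\<in>UNIV. cnj (U p x) * A p y) + (\<Sum>p\<in>UNIV. U p y * A x p))" (is "_ = ?R")
  proof
    show "act 0 U (\<lambda>_. 0) (iM A) c = ?R c" for c by (cases c) simp_all
  qed
  finally show ?thesis .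
qed

lemma iM_tor:
  assumes "iM A \<in> S"
  shows "iM (\<lambda>x y. \<i> * (dl y a - dl x a) * A x y) \<in> S"
proof -
  have "skewh (\<lambda>x y. dl x a * (\<i> * dl y a))" by (simp add: skewh_def)
  from iM_act[OF assms this] show ?thesis
    by (rule iM_cong) (simp add: mult.assoc sum_negf, auto simp: dl_def)
qed

lemma iM_rot:
  assumes "iM A \<in> S"
  shows "iM (\<lambda>x y. dl x b * A a y - dl x a * A b y + dl y b * A x a - dl y a * A x b) \<in> S"
proof -
  have "skewh (\<lambda>x y. dl x a * dl y b - dl x b * dl y a)" by (simp add: skewh_def)
  from iM_act[OF assms this] show ?thesis
    by (rule iM_cong) (simp add: left_diff_distrib mult.assoc sum_subtractf)
qed

text \<open>The square of the operator in \<open>iM_tor\<close> for a is minus the indicator of the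
  entries with exactly one index equal to a. The product of the squares for a and b leaves the
  entries (a, b) and (b, a).\<close>

lemma iM_pair:
  assumes A: "iM A \<in> S" and ab: "a \<noteq> b"
  shows "iM (\<lambda>x y. dl x a * dl y b * A a b + dl x b * dl y a * A b a) \<in> S"
  using iM_tor[OF iM_tor[OF iM_tor[OF iM_tor[OF A, of a], of a], of b], of b]
proof (rule iM_cong)
  fix x y
  have "x = a \<or> x = b \<or> (x \<noteq> a \<and> x \<noteq> b)" "y = a \<or> y = b \<or> (y \<noteq> a \<and> y \<noteq> b)" by blast+
  then show "\<i> * (dl y b - dl x b) * (\<i> * (dl y b - dl x b) * (\<i> * (dl y a - dl x a) * (\<i> * (dl y a - dl x a) * A x y)))
    = dl x a * dl y b * A a b + dl x b * dl y a * A b a"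
    using ab by (elim disjE) auto
qed

text \<open>The multiplicity space of the real adjoint representation: the tracefree
  \<open>Am\<close> are the tracefree Hermitian matrices tensored with the real plane of complex
  numbers. The matrices \<open>sy a b\<close> are the test elements; \<open>L_pair\<close> and
  \<open>L_diag_in\<close> recover the others.\<close>

definition L :: "complex set" where
  "L = {c. \<forall>a b. a \<noteq> b \<longrightarrow> iM (\<lambda>x y. c * sy a b x y) \<in> S}"

lemma L_add: "c \<in> L \<Longrightarrow> d \<in> L \<Longrightarrow> c + d \<in> L"
  unfolding L_def by (auto simp: distrib_right intro: iM_add)

lemma L_scale: "c \<in> L \<Longrightarrow> of_real r * c \<in> L"
  unfolding L_def by (auto simp: mult.assoc intro: iM_scale)

lemma L_zero: "0 \<in> L"
  unfolding L_def by (auto intro: iM_zero)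

lemma L_sum: "finite I \<Longrightarrow> (\<And>i. f i \<in> L) \<Longrightarrow> sum f I \<in> L"
  by (induction I rule: finite_induct) (auto intro: L_add L_zero)

lemma sy_in_L:
  assumes c: "iM (\<lambda>x y. c * sy a b x y) \<in> S" and ab: "a \<noteq> b"
  shows "c \<in> L"
proof -
  have mv: "iM (\<lambda>x y. c * sy a d x y) \<in> S" if "iM (\<lambda>x y. c * sy a b x y) \<in> S" "a \<noteq> b" "a \<noteq> d" for a b d
  proof (cases "b = d")
    case False
    show ?thesis using iM_rot[OF that(1), of d b]
      by (rule iM_cong) (use that False in \<open>simp add: sy_def algebra_simps\<close>)
  qed (use that in simp)
  have sw: "iM (\<lambda>x y. c * sy a b x y) \<in> S \<Longrightarrow> iM (\<lambda>x y. c * sy b a x y) \<in> S" for a b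
    by (erule iM_cong) (simp add: sy_def algebra_simps)
  show ?thesis unfolding L_def
  proof (intro CollectI allI impI)
    fix p q :: 'm assume pq: "p \<noteq> q"
    consider "p = a" | "p = b" | "p \<noteq> a" "p \<noteq> b" by blast
    then show "iM (\<lambda>x y. c * sy p q x y) \<in> S"
    proof cases
      case 1 then show ?thesis using mv[OF c ab, of q] pq by simp
    next
      case 2 then show ?thesis using mv[OF sw[OF c], of q] pq ab by simp
    next
      case 3 then show ?thesis using mv[OF sw[OF mv[OF c ab, of p]], of q] pq by simp
    qed
  qed
qed

text \<open>The rotation in the plane of a and b kills the skew part of the pair of entries and,
  applied twice, multiplies \<open>sy a b\<close> by -4.\<close>

lemma L_off:
  assumes A: "iM A \<in> S" and ab: "a \<noteq> b"
  shows "A a b + A b a \<in> L"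
proof (rule sy_in_L[OF _ ab])
  show "iM (\<lambda>x y. (A a b + A b a) * sy a b x y) \<in> S"
    using iM_scale[OF iM_rot[OF iM_rot[OF iM_pair[OF A ab], of b a], of b a], of "-1/2"]
    by (rule iM_cong) (use ab in \<open>simp add: sy_def algebra_simps\<close>)
qed

text \<open>The operator in \<open>iM_tor\<close> turns the skew part of a pair of entries into
  \<open>\<i>\<close> times a symmetric one, to which \<open>L_off\<close> applies.\<close>

lemma L_off_i:
  assumes A: "iM A \<in> S" and ab: "a \<noteq> b"
  shows "\<i> * (A a b - A b a) \<in> L"
  using L_off[OF iM_tor[OF A, of b] ab] ab by (simp add: algebra_simps)

lemma L_diag:
  assumes A: "iM A \<in> S"
  shows "A a a - A b b \<in> L"
proof (cases "a = b")
  case False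
  from L_scale[OF L_off[OF iM_rot[OF A, of b a] False], of "1/2"] False show ?thesis by (simp add: diff_divide_distrib)
qed (simp add: L_zero)

lemma L_tfM:
  assumes w: "w \<in> S"
  shows "tfM w a b + tfM w b a \<in> L" "\<i> * (tfM w a b - tfM w b a) \<in> L"
proof -
  let ?A = "\<lambda>a b. w (Am a b)"
  have A: "iM ?A \<in> S" by (rule piece_M[OF w])
  have d: "tfM w a a \<in> L" for a
  proof -
    have "of_real (1 / real CARD('m)) * (\<Sum>b\<in>UNIV. ?A a a - ?A b b) \<in> L"
      by (intro L_scale L_sum L_diag A finite)
    also have "of_real (1 / real CARD('m)) * (\<Sum>b\<in>UNIV. ?A a a - ?A b b) = tfM w a a"
      using m0 by (simp add: tfM_def sum_subtractf field_simps)
    finally show ?thesis .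
  qed
  show "tfM w a b + tfM w b a \<in> L"
  proof (cases "a = b")
    case True show ?thesis unfolding True by (rule L_add[OF d d])
  next
    case False then show ?thesis using L_off[OF A False] by (simp add: tfM_def)
  qed
  show "\<i> * (tfM w a b - tfM w b a) \<in> L"
  proof (cases "a = b")
    case True then show ?thesis using L_zero by simp
  next
    case False then show ?thesis using L_off_i[OF A False] by (simp add: tfM_def)
  qed
qed

lemma L_pair:
  assumes "u + v \<in> L" "\<i> * (u - v) \<in> L" and ab: "a \<noteq> b"
  shows "iM (\<lambda>x y. u * (dl x a * dl y b) + v * (dl x b * dl y a)) \<in> S"
proof -
  have 1: "iM (\<lambda>x y. (u + v) * sy a b x y) \<in> S" and 2: "iM (\<lambda>x y. \<i> * (u - v) * sy a b x y) \<in> S"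
    using assms unfolding L_def by blast+
  show ?thesis using iM_add[OF iM_scale[OF 1, of "1/2"] iM_scale[OF iM_tor[OF 2, of b], of "-1/2"]]
  proof (rule iM_cong)
    fix x y
    have "x = a \<or> x = b \<or> (x \<noteq> a \<and> x \<noteq> b)" "y = a \<or> y = b \<or> (y \<noteq> a \<and> y \<noteq> b)" by blast+
    then show "of_real (1 / 2) * ((u + v) * sy a b x y) + of_real (- 1 / 2) * (\<i> * (dl y b - dl x b) * (\<i> * (u - v) * sy a b x y))
      = u * (dl x a * dl y b) + v * (dl x b * dl y a)"
      using ab by (elim disjE) (simp_all add: sy_def field_simps)
  qed
qed

lemma L_diag_in:
  assumes "c \<in> L" and ab: "a \<noteq> b"
  shows "iM (\<lambda>x y. c * (dl x a * dl y a - dl x b * dl y b)) \<in> S"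
proof -
  have 1: "iM (\<lambda>x y. c * sy a b x y) \<in> S" using assms unfolding L_def by blast
  show ?thesis using iM_scale[OF iM_rot[OF 1, of b a], of "-1/2"]
    by (rule iM_cong) (use ab in \<open>simp add: sy_def algebra_simps\<close>)
qed

lemma tfM_in:
  fixes w :: "'m cix \<Rightarrow> complex"
  assumes s: "\<And>a b. tfM w a b + tfM w b a \<in> L" and i: "\<And>a b. \<i> * (tfM w a b - tfM w b a) \<in> L"
  shows "iM (tfM w) \<in> S"
proof -
  let ?m = "of_nat CARD('m) :: complex" and ?A = "tfM w"
  have d: "?A a a \<in> L" for a using L_scale[OF s[of a a], of "1/2"] by simp
  have tr: "(\<Sum>a\<in>UNIV. ?A a a) = 0"
    using m0 by (simp add: tfM_def sum_subtractf)
  define q where "q a b = (if a = b then 0 else ?A a b)" for a b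
  have "iM (\<lambda>x y. \<Sum>a\<in>(UNIV::'m set). \<Sum>b\<in>(UNIV::'m set).
      of_real (1/2) * (q a b * (dl x a * dl y b) + q b a * (dl x b * dl y a))) \<in> S"
  proof (intro iM_sum)
    fix a b
    show "iM (\<lambda>x y. of_real (1/2) * (q a b * (dl x a * dl y b) + q b a * (dl x b * dl y a))) \<in> S"
      using L_pair[OF s i] iM_zero by (cases "a = b") (auto simp: q_def simp del: of_real_divide intro!: iM_scale)
  qed
  moreover have "(\<Sum>a\<in>(UNIV::'m set). \<Sum>b\<in>(UNIV::'m set).
      of_real (1/2) * (q a b * (dl x a * dl y b) + q b a * (dl x b * dl y a))) = q x y" for x y
  proof -
    have "(\<Sum>a\<in>(UNIV::'m set). \<Sum>b\<in>(UNIV::'m set). q b a * (dl x b * dl y a)) = q x y"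
      by (subst sum.swap) simp
    then have "of_real (1/2) * ((\<Sum>a\<in>(UNIV::'m set). \<Sum>b\<in>(UNIV::'m set). q a b * (dl x a * dl y b))
        + (\<Sum>a\<in>(UNIV::'m set). \<Sum>b\<in>(UNIV::'m set). q b a * (dl x b * dl y a))) = q x y" by simp
    then show ?thesis by (simp only: sum_distrib_left sum.distrib distrib_left)
  qed
  ultimately have 1: "iM q \<in> S" by (rule_tac iM_cong)
  \<comment> \<open>A tracefree diagonal matrix with entries \<open>d a\<close> is the sum over all
    a and b of \<open>(d a - d b) / (2 * m)\<close> times the difference of the a-th and b-th
    diagonal units.\<close>
  have "iM (\<lambda>x y. \<Sum>a\<in>(UNIV::'m set). \<Sum>b\<in>(UNIV::'m set).
      (?A a a - ?A b b) / (2 * ?m) * (dl x a * dl y a - dl x b * dl y b)) \<in> S"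
  proof (intro iM_sum)
    fix a b
    show "iM (\<lambda>x y. (?A a a - ?A b b) / (2 * ?m) * (dl x a * dl y a - dl x b * dl y b)) \<in> S"
    proof (cases "a = b")
      case True
      then show ?thesis using iM_zero by simp
    next
      case False
      have "of_real (1 / (2 * real CARD('m))) * (?A a a + of_real (-1) * ?A b b) \<in> L"
        by (intro L_scale L_add d)
      then show ?thesis using False by (intro L_diag_in) simp_all
    qed
  qed
  moreover have "(\<Sum>a\<in>(UNIV::'m set). \<Sum>b\<in>(UNIV::'m set).
      (?A a a - ?A b b) / (2 * ?m) * (dl x a * dl y a - dl x b * dl y b)) = dl x y * ?A x x" for x y
  proof -
    let ?k = "\<lambda>a b. (?A a a - ?A b b) / (2 * ?m)"
    have r: "(\<Sum>b\<in>UNIV. ?k a b) = ?A a a / 2" "(\<Sum>b\<in>UNIV. ?k b a) = - ?A a a / 2" for a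
      using m0 tr by (simp_all add: sum_divide_distrib[symmetric] sum_subtractf)
    have "(\<Sum>a\<in>UNIV. \<Sum>b\<in>UNIV. ?k a b * (dl x a * dl y a - dl x b * dl y b))
      = (\<Sum>a\<in>UNIV. \<Sum>b\<in>UNIV. ?k a b * (dl x a * dl y a)) - (\<Sum>a\<in>UNIV. \<Sum>b\<in>UNIV. ?k a b * (dl x b * dl y b))"
      by (simp only: right_diff_distrib sum_subtractf)
    also have "(\<Sum>a\<in>UNIV. \<Sum>b\<in>UNIV. ?k a b * (dl x b * dl y b)) = (\<Sum>b\<in>UNIV. \<Sum>a\<in>UNIV. ?k a b * (dl x b * dl y b))"
      by (rule sum.swap)
    also have "(\<Sum>a\<in>UNIV. \<Sum>b\<in>UNIV. ?k a b * (dl x a * dl y a)) = (\<Sum>a\<in>UNIV. dl x a * (dl y a * (?A a a / 2)))"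
      unfolding sum_distrib_right[symmetric] r by (simp add: ac_simps)
    also have "(\<Sum>b\<in>UNIV. \<Sum>a\<in>UNIV. ?k a b * (dl x b * dl y b)) = (\<Sum>a\<in>UNIV. dl x a * (dl y a * (- ?A a a / 2)))"
      unfolding sum_distrib_right[symmetric] r by (simp add: ac_simps)
    finally show ?thesis unfolding sum_dl by (simp add: dl_commute[of y])
  qed
  ultimately have 2: "iM (\<lambda>x y. dl x y * ?A x x) \<in> S" by simp
  show ?thesis using iM_add[OF 1 2] by (rule iM_cong) (simp add: q_def)
qed

section \<open>Classification\<close>

text \<open>Each component of x is treated separately. Either S contains all its values, or some
  functional vanishes on S; by the lemmas above this amounts to a distinguished condition valid on
  S, which h passes on to x.\<close>

lemma classification:
  fixes x :: "'m cix \<Rightarrow> complex"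
  assumes x_Ze: "\<And>a b. x (Ze a b) = - x (Ze b a)"
    and x_Gp: "\<And>a b c. x (Gp a b c) = - x (Gp a c b)"
    and x_Gm: "\<And>a b c. x (Gm a b c) = - x (Gm a c b)"
    and x_Be: "\<And>a b. x (Be a b) = - x (Be b a)"
    and h: "(\<forall>w\<in>S. P_gam w) \<Longrightarrow> P_gam x"
      "(\<forall>w\<in>S. P_om w) \<Longrightarrow> P_om x"
      "(\<forall>w\<in>S. P_sig w) \<Longrightarrow> P_sig x"
      "\<And>p q. (p, q) \<noteq> (0, 0) \<Longrightarrow> (\<forall>w\<in>S. P_xy p q w) \<Longrightarrow> P_xy p q x"
      "\<And>p q. (p, q) \<noteq> (0, 0) \<Longrightarrow> (\<forall>w\<in>S. P_zw p q w) \<Longrightarrow> P_zw p q x"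
      "2 < CARD('m) \<Longrightarrow> (\<forall>w\<in>S. P_sk w) \<Longrightarrow> P_sk x"
      "(\<forall>w\<in>S. P_hk w) \<Longrightarrow> P_hk x"
      "2 < CARD('m) \<Longrightarrow> (\<forall>w\<in>S. P_G0 w) \<Longrightarrow> P_G0 x"
      "(\<forall>w\<in>S. P_EG w) \<Longrightarrow> P_EG x"
      "(\<forall>w\<in>S. P_B w) \<Longrightarrow> P_B x"
  shows "x \<in> S"
proof -
  have S0: "(\<lambda>c. 0) \<in> S" by (rule zero)
  have Ga: "iGa (\<lambda>a. x (Ga a)) \<in> S"
  proof (cases "\<exists>w\<in>S. \<exists>q. w (Ga q) \<noteq> 0")
    case True then show ?thesis using Ga_all by blast
  next
    case False
    then have "P_gam x" using h(1) by (auto simp: P_gam_def)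
    then have "iGa (\<lambda>a. x (Ga a)) = (\<lambda>c. 0)"
      by (intro ext, case_tac c) (simp_all add: P_gam_def)
    then show ?thesis using S0 by simp
  qed
  have gamAZ: "act 0 (\<lambda>_ _. 0) (\<lambda>a. 1 * dl a p) (iGa g) \<in> S" if "w \<in> S" "w (Ga q) \<noteq> 0" for w q p g
    by (intro nilp Ga_all[OF that])
  have AZ1: "iAZ (\<lambda>a b. (x (Ap a b) - x (Ap b a)) / 2) (\<lambda>a b. x (Ze a b)) \<in> S"
  proof -
    \<comment> \<open>The multiplicity space, inside the complex plane squared, of the two copies of
      the skew matrices.\<close>
    let ?L = "{(s, t). \<forall>p r. iAZ (\<lambda>a b. wdg p r a b * s) (\<lambda>a b. wdg p r a b * t) \<in> S}"
    have LS: "((w (Ap a b) - w (Ap b a)) / 2, w (Ze a b)) \<in> ?L" if "w \<in> S" for w a b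
      using AZ_wdg[OF that] by simp
    have mem: "((x (Ap a b) - x (Ap b a)) / 2, x (Ze a b)) \<in> ?L" for a b
    proof (rule ccontr)
      assume "((x (Ap a b) - x (Ap b a)) / 2, x (Ze a b)) \<notin> ?L"
      then have "\<exists>p q. p * ((x (Ap a b) - x (Ap b a)) / 2) + q * x (Ze a b) \<noteq> 0 \<and> (\<forall>(s, t)\<in>?L. p * s + q * t = 0)"
      proof (rule separating_functional[rotated 2])
        show "(0, 0) \<in> ?L" using S0 AZ_wdg[OF zero] by simp
        fix u v k assume u: "u \<in> ?L"
        show "(k * fst u, k * snd u) \<in> ?L"
          using u by (auto simp: mult.left_commute[of _ k] intro!: iAZ_scale)
        assume v: "v \<in> ?L"
        show "(fst u + fst v, snd u + snd v) \<in> ?L"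
          using u v by (auto simp: distrib_left intro!: iAZ_add)
      qed
      then obtain p q where pq: "p * ((x (Ap a b) - x (Ap b a)) / 2) + q * x (Ze a b) \<noteq> 0"
        and van: "\<And>s t. (s, t) \<in> ?L \<Longrightarrow> p * s + q * t = 0" by blast
      have "P_zw p q w" if w: "w \<in> S" for w
        unfolding P_zw_def
      proof (intro conjI allI)
        show "p * ((w (Ap a b) - w (Ap b a)) / 2) + q * w (Ze a b) = 0" for a b
          by (rule van[OF LS[OF w]])
        fix a
        show "(p + 2 * q) * w (Ga a) = 0"
        proof (cases "w (Ga a) = 0")
          case False
          \<comment> \<open>If \<gamma> is not zero on S, the null rotation of
            \<open>iGa (dl b)\<close> in the direction a lies in S. Its pair of coefficients at b, a
            is \<open>(1/2, 1)\<close>, which forces \<open>p + 2 * q = 0\<close>.\<close>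
          obtain b where b: "b \<noteq> a" using ex_neq[of a] by blast
          have "p * (1/2) + q = 0"
            using van[OF LS[OF gamAZ[OF w False, where g = "dl b" and p = a], of b a]] b by simp
          then have "2 * (p * (1/2) + q) = 0" by (simp only: mult_zero_right)
          then show ?thesis by (simp add: algebra_simps)
        qed simp
      qed
      moreover have "(p, q) \<noteq> (0, 0)" using pq by auto
      ultimately have "P_zw p q x" using h(5) by blast
      then show False using pq by (simp add: P_zw_def)
    qed
    have in_S: "iAZ (\<lambda>a b. \<Sum>p\<in>(UNIV::'m set). \<Sum>r\<in>(UNIV::'m set). 1/2 * (wdg p r a b * ((x (Ap p r) - x (Ap r p)) / 2)))
      (\<lambda>a b. \<Sum>p\<in>UNIV. \<Sum>r\<in>UNIV. 1/2 * (wdg p r a b * x (Ze p r))) \<in> S"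
      using mem by (intro iAZ_sum iAZ_scale) simp
    have wd: "(\<Sum>p\<in>(UNIV::'m set). \<Sum>r\<in>UNIV. 1/2 * (wdg p r a b * n p r)) = n a b"
      if "\<And>a b. n a b = - n b a" for n a b
    proof -
      have "(\<Sum>p\<in>(UNIV::'m set). \<Sum>r\<in>UNIV. 1/2 * (wdg p r a b * n p r))
         = (\<Sum>p\<in>UNIV. \<Sum>r\<in>UNIV. n p r / 2 * wdg p r a b)"
        by (intro sum.cong refl) simp
      also have "\<dots> = n a b" unfolding sum_wdg that[of b a] by simp
      finally show ?thesis .
    qed
    have wd1: "(\<Sum>p\<in>(UNIV::'m set). \<Sum>r\<in>UNIV. 1/2 * (wdg p r a b * ((x (Ap p r) - x (Ap r p)) / 2)))
        = (x (Ap a b) - x (Ap b a)) / 2" for a b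
      by (rule wd) (simp add: field_simps)
    show ?thesis using in_S by (simp only: wd1 wd[of "\<lambda>a b. x (Ze a b)", OF x_Ze])
  qed
  have AZ2: "iAZ (\<lambda>a b. (x (Ap a b) + x (Ap b a)) / 2) (\<lambda>a b. 0) \<in> S"
  proof (cases "\<exists>w\<in>S. \<exists>a b. w (Ap a b) + w (Ap b a) \<noteq> 0")
    case True
    then obtain w a b where "w \<in> S" "w (Ap a b) + w (Ap b a) \<noteq> 0" by blast
    then show ?thesis by (rule AZ_sym_all) (simp add: add.commute)
  next
    case False
    then have "\<forall>w\<in>S. P_sig w" unfolding P_sig_def using gam_if_sig by blast
    then have "P_sig x" by (rule h(3))
    then have "iAZ (\<lambda>a b. (x (Ap a b) + x (Ap b a)) / 2) (\<lambda>a b. 0) = (\<lambda>c. 0)"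
      by (intro ext, case_tac c) (simp_all add: P_sig_def)
    then show ?thesis using S0 by simp
  qed
  have AZ: "iAZ (\<lambda>a b. x (Ap a b)) (\<lambda>a b. x (Ze a b)) \<in> S"
    using iAZ_add[OF AZ1 AZ2] by (simp add: add_divide_distrib[symmetric])
  have M1: "iM (tfM x) \<in> S"
  proof -
    have mem: "c \<in> L" if c: "(\<exists>a b. c = tfM x a b + tfM x b a) \<or> (\<exists>a b. c = \<i> * (tfM x a b - tfM x b a))" for c
    proof (rule ccontr)
      assume n: "c \<notin> L"
      let ?L = "(\<lambda>c. (Re c, Im c)) ` L"
      have "\<exists>p q. p * Re c + q * Im c \<noteq> 0 \<and> (\<forall>(s, t)\<in>?L. p * s + q * t = 0)"
      proof (rule separating_functional[rotated 2])
        show "(Re c, Im c) \<notin> ?L" using n by (auto simp: image_iff) (metis complex_eqI)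
        show "(0, 0) \<in> ?L" using L_zero by (force simp: image_iff)
        fix u v k assume u: "u \<in> ?L"
        then show "(k * fst u, k * snd u) \<in> ?L" using L_scale[of _ k] by (force simp: image_iff)
        assume v: "v \<in> ?L"
        then show "(fst u + fst v, snd u + snd v) \<in> ?L" using u L_add by (force simp: image_iff)
      qed
      then obtain p q where pq: "p * Re c + q * Im c \<noteq> 0"
        and van: "\<And>d. d \<in> L \<Longrightarrow> p * Re d + q * Im d = 0" by blast
      have g: "P_gam w" if w: "w \<in> S" for w
      proof (rule ccontr)
        assume "\<not> P_gam w"
        then obtain a where a: "w (Ga a) \<noteq> 0" by (auto simp: P_gam_def)
        obtain b where b: "b \<noteq> a" using ex_neq[of a] by blast
        \<comment> \<open>As \<gamma> is arbitrary on S, a null rotation puts any z at the entry (a,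
          b) and zero at (b, a), so the functional would vanish on all complex numbers.\<close>
        have "p * Re z + q * Im z = 0" for z
          using van[OF L_tfM(1)[OF gamAZ[OF w a, where g = "\<lambda>x. - z * dl x b" and p = a], of a b]] b
          by (simp add: tfM_def)
        from this[of c] pq show False by simp
      qed
      have "\<forall>w\<in>S. P_xy p (- q) w"
        unfolding P_xy_iff by (intro ballI conjI allI g van L_tfM)
      moreover have "(p, - q) \<noteq> (0, 0)" using pq by auto
      ultimately have "P_xy p (- q) x" using h(4) by blast
      then show False using pq c unfolding P_xy_iff by blast
    qed
    show ?thesis by (rule tfM_in) (rule mem, blast)+
  qed
  \<comment> \<open>Real multiples of \<open>dl\<close> come from \<open>conf_M\<close>; imaginary
    ones are extracted from an element of S whose trace is not real.\<close>
  have M2: "iM (\<lambda>a b. dl a b * z) \<in> S" if z: "Im z \<noteq> 0 \<Longrightarrow> \<exists>w\<in>S. Im (\<Sum>a\<in>UNIV. w (Am a a)) \<noteq> 0" for z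
  proof -
    have i: "iM (\<lambda>a b. of_real (Im z) * (\<i> * dl a b)) \<in> S"
    proof (cases "Im z = 0")
      case True
      then show ?thesis using iM_zero by simp
    next
      case False
      then obtain w where w: "w \<in> S" and n: "Im (\<Sum>a\<in>UNIV. w (Am a a)) \<noteq> 0" using z by blast
      define t where "t = (\<Sum>a\<in>UNIV. w (Am a a)) / of_nat CARD('m)"
      have t: "Im t \<noteq> 0" using n two by (simp add: t_def Im_divide_of_nat)
      have "iM (tfM w) \<in> S" by (rule tfM_in) (rule L_tfM[OF w])+
      from iM_add[OF piece_M[OF w] iM_scale[OF this, of "-1"]]
      have 1: "iM (\<lambda>a b. t * dl a b) \<in> S" by (rule iM_cong) (simp add: tfM_def t_def)
      show ?thesis using iM_scale[OF iM_add[OF 1 iM_scale[OF conf_M, of "- Re t"]], of "Im z / Im t"]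
      proof (rule iM_cong)
        fix a b
        have "t * dl a b + of_real (- Re t) * dl a b = of_real (Im t) * (\<i> * dl a b)"
          by (subst (1) complex_eq[of t]) (simp add: algebra_simps)
        then show "of_real (Im z / Im t) * (t * dl a b + of_real (- Re t) * dl a b) = of_real (Im z) * (\<i> * dl a b)"
          using t by simp
      qed
    qed
    show ?thesis using iM_add[OF iM_scale[OF conf_M, of "Re z"] i]
      by (rule iM_cong) (subst (3) complex_eq[of z], simp add: algebra_simps)
  qed
  have M: "iM (\<lambda>a b. x (Am a b)) \<in> S"
  proof -
    let ?t = "(\<Sum>a\<in>UNIV. x (Am a a)) / of_nat CARD('m)"
    have "iM (\<lambda>a b. dl a b * ?t) \<in> S"
    proof (rule M2, rule ccontr)
      assume n: "Im ?t \<noteq> 0" and "\<not> (\<exists>w\<in>S. Im (\<Sum>a\<in>UNIV. w (Am a a)) \<noteq> 0)"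
      then have van: "Im (\<Sum>a\<in>UNIV. w (Am a a)) = 0" if "w \<in> S" for w using that by blast
      have g: "P_gam w" if w: "w \<in> S" for w
      proof (rule ccontr)
        assume "\<not> P_gam w"
        then obtain a where a: "w (Ga a) \<noteq> 0" by (auto simp: P_gam_def)
        \<comment> \<open>With this choice of g the trace of the null rotation is
          \<open>\<i>\<close>.\<close>
        show False
          using van[OF gamAZ[OF w a, where g = "\<lambda>x. - \<i> * dl x a" and p = a]] by (simp add: sum_negf)
      qed
      have "P_om x" by (rule h(2)) (use van g in \<open>simp add: P_om_def\<close>)
      then show False using n by (simp add: P_om_def Im_divide_of_nat)
    qed
    from iM_add[OF M1 this] show ?thesis by (rule iM_cong) (simp add: tfM_def)
  qed
  have EG1: "iEG (\<lambda>_. 0) (tfG x) \<in> S"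
  proof (cases rule: tfG_cases)
    case all
    show ?thesis by (intro all tfG_anti x_Gm tfG_trace)
  next
    case none
    have "tfG x a b c = 0" for a b c
    proof (cases "2 < CARD('m)")
      case True
      then have "P_G0 x" using h(8) vanish_G0[OF none] by blast
      then show ?thesis by (simp add: P_G0_def)
    next
      case False
      \<comment> \<open>For m = 2 no three indices are different, so the hypotheses of
        \<open>tfG_zero\<close> on such triples are vacuous.\<close>
      then have "card {a, b, c} < 3" for a b c :: 'm using card_mono[of UNIV "{a, b, c}"] by simp
      then have "a = b \<or> a = c \<or> b = c" for a b c :: 'm
        by (metis card_3_iff less_irrefl)
      then show ?thesis by (intro tfG_zero x_Gm) blast+
    qed
    then show ?thesis using iEG_zero by (intro iEG_cong[OF iEG_zero]) simp_all
  qed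
  have EG: "iEG (\<lambda>a. x (Ee a)) (\<lambda>a b c. x (Gm a b c)) \<in> S"
  proof -
    define k :: complex where "k = of_nat CARD('m) - 1"
    have k: "k \<noteq> 0" using m1 by (simp add: k_def)
    have "iEG (\<lambda>a. x (Ee a) - trG x a / (2 * k)) (\<lambda>_ _ _. 0) \<in> S"
    proof (cases "\<exists>w\<in>S. \<exists>q. 2 * (of_nat CARD('m) - 1) * w (Ee q) \<noteq> trG w q")
      case True then show ?thesis using EG_all by blast
    next
      case False
      then have "P_EG x" using h(9) vanish_EG by blast
      then have "x (Ee a) - trG x a / (2 * k) = 0" for a
        using k by (simp add: P_EG_def k_def[symmetric] field_simps)
      then show ?thesis by (intro iEG_cong[OF iEG_zero]) simp_all
    qed
    from iEG_add[OF iEG_add[OF EG1 this] conf_EG[of "\<lambda>a. trG x a / (2 * k)"]]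
    show ?thesis by (rule iEG_cong) (use k in \<open>simp_all add: tfG_def k_def[symmetric] field_simps\<close>)
  qed
  have P: "iP (\<lambda>a b c. x (Gp a b c)) \<in> S"
  proof -
    \<comment> \<open>The totally skew part; the remainder of \<open>Gp\<close> is of hook
      type.\<close>
    let ?s = "\<lambda>a b c. (x (Gp a b c) + x (Gp b c a) + x (Gp c a b)) / 3"
    have z: "iP (\<lambda>_ _ _. 0) \<in> S" using iP_scale[OF piece_P[OF zero], of 0] by simp
    have s_anti: "?s a b c = - ?s a c b" for a b c
    proof -
      have "x (Gp a b c) + x (Gp b c a) + x (Gp c a b) = - (x (Gp a c b) + x (Gp c b a) + x (Gp b a c))"
        using x_Gp[of a b c] x_Gp[of b c a] x_Gp[of c a b] by simp
      then show ?thesis by (simp only: minus_divide_left)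
    qed
    have "iP ?s \<in> S"
    proof (cases "\<exists>w\<in>S. \<exists>a b c. w (Gp a b c) + w (Gp b c a) + w (Gp c a b) \<noteq> 0")
      case True
      then obtain w a b c where "w \<in> S" "w (Gp a b c) + w (Gp b c a) + w (Gp c a b) \<noteq> 0" by blast
      then show ?thesis by (rule P_sk_all) (rule s_anti, simp)
    next
      case False
      have "?s a b c = 0" for a b c
      proof (cases "2 < CARD('m)")
        case True
        then have "P_sk x" using h(6) vanish_sk False by blast
        then show ?thesis by (simp add: P_sk_def)
      next
        case m: False
        then have "card {a, b, c} < 3" using card_mono[of UNIV "{a, b, c}"] by simp
        then have d: "a = b \<or> a = c \<or> b = c" by (metis card_3_iff less_irrefl)
        have e: "x (Gp p p q) + x (Gp p q p) + x (Gp q p p) = 0" for p q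
          using x_Gp[of p p q] x_Gp[of q p p] by simp
        from d show ?thesis
          using e[of a c] e[of a b] e[of b a] by (elim disjE) (simp_all add: add_ac)
      qed
      then show ?thesis using z by simp
    qed
    moreover have "iP (\<lambda>a b c. x (Gp a b c) - ?s a b c) \<in> S"
    proof (cases "\<exists>w\<in>S. \<exists>a b c. w (Gp a b c) + w (Gp b a c) \<noteq> 0")
      case True
      then obtain w a b c where "w \<in> S" "w (Gp a b c) + w (Gp b a c) \<noteq> 0" by blast
      then show ?thesis
      proof (rule P_hk_all)
        show "x (Gp a b c) - ?s a b c = - (x (Gp a c b) - ?s a c b)" for a b c
          using s_anti[of a b c] x_Gp[of a b c] by (simp only: minus_diff_eq minus_diff_minus)
        show "x (Gp a b c) - ?s a b c + (x (Gp b c a) - ?s b c a) + (x (Gp c a b) - ?s c a b) = 0" for a b c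
          by (simp add: field_simps)
      qed
    next
      case False
      then have "P_hk x" using h(7) vanish_hk by blast
      then have hk: "x (Gp a b c) = - x (Gp b a c)" for a b c
        by (simp add: P_hk_def eq_neg_iff_add_eq_0)
      \<comment> \<open>Skew in the first two and in the last two indices, \<open>Gp\<close> is
        totally skew and equals its cyclic mean.\<close>
      have "x (Gp a b c) - ?s a b c = 0" for a b c
        using hk[of b c a] x_Gp[of c b a] hk[of c a b] x_Gp[of a c b] by simp
      then show ?thesis using z by (simp only:)
    qed
    ultimately show ?thesis using iP_add by fastforce
  qed
  have B: "iB (\<lambda>a b. x (Be a b)) \<in> S"
  proof (cases "\<exists>w\<in>S. \<exists>a b. w (Be a b) \<noteq> 0")
    case True
    then obtain w a b where "w \<in> S" "w (Be a b) \<noteq> 0" by blast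
    then show ?thesis by (rule B_all) (rule x_Be)
  next
    case False
    then have "P_B x" using h(10) vanish_B by blast
    then have "iB (\<lambda>a b. x (Be a b)) = iB (\<lambda>a b. 0 * x (Be a b))" by (simp add: P_B_def)
    moreover have "iB (\<lambda>a b. 0 * x (Be a b)) \<in> S"
      using iB_scale[OF piece_B[OF zero], of 0] by simp
    ultimately show ?thesis by simp
  qed
  from add[OF add[OF add[OF add[OF add[OF Ga AZ] M] EG] P] B] show ?thesis
    unfolding emb_split[symmetric] .
qed

end

section \<open>Matrices and the Cayley transform\<close>

lemma matrix_inv_eqI:
  fixes A B :: "'a::field^'n^'n"
  assumes "A ** B = mat 1"
  shows "matrix_inv A = B"
proof -
  have BA: "B ** A = mat 1" using assms matrix_left_right_inverse by blast
  have "invertible A" using assms BA unfolding invertible_def by blast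
  then have "A ** matrix_inv A = mat 1" unfolding invertible_def matrix_inv_def by (rule someI2_ex) simp
  then have "B ** (A ** matrix_inv A) = B" by simp
  then show ?thesis using BA by (simp add: matrix_mul_assoc)
qed

lemma tendsto_matrix_mult:
  fixes A :: "'x \<Rightarrow> real^'n::finite^'k::finite" and B :: "'x \<Rightarrow> real^'p::finite^'n"
  assumes "(A \<longlongrightarrow> A0) F" "(B \<longlongrightarrow> B0) F"
  shows "((\<lambda>s. A s ** B s) \<longlongrightarrow> A0 ** B0) F"
  unfolding matrix_matrix_mult_def
  by (intro tendsto_vec_lambda tendsto_sum tendsto_mult tendsto_vec_nth assms)

lemma tendsto_matrix_vec:
  fixes A :: "'x \<Rightarrow> real^'n::finite^'k::finite"
  assumes "(A \<longlongrightarrow> A0) F" "(v \<longlongrightarrow> v0) F"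
  shows "((\<lambda>s. A s *v v s) \<longlongrightarrow> A0 *v v0) F"
  unfolding matrix_vector_mult_def
  by (intro tendsto_vec_lambda tendsto_sum tendsto_mult tendsto_vec_nth assms)

lemma tendsto_det:
  fixes A :: "'x \<Rightarrow> real^'n::finite^'n"
  assumes "(A \<longlongrightarrow> A0) F"
  shows "((\<lambda>s. det (A s)) \<longlongrightarrow> det A0) F"
  unfolding det_def
  by (intro tendsto_sum tendsto_mult tendsto_const tendsto_prod tendsto_vec_nth assms)

text \<open>Cramer's rule expresses the entries of the inverse through determinants, from which its
  continuity follows.\<close>

lemma matrix_inv_cramer:
  fixes A :: "real^'n::finite^'n"
  assumes "det A \<noteq> 0"
  shows "matrix_inv A $ k $ l = det (\<chi> i j. if j = k then axis l 1 $ i else A $ i $ j) / det A"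
proof -
  have "A ** matrix_inv A = mat 1"
    using assms invertible_det_nz[of A] unfolding invertible_def matrix_inv_def by (metis (mono_tags, lifting) someI_ex)
  then have "A *v (matrix_inv A *v axis l 1) = axis l 1"
    by (simp add: matrix_vector_mul_assoc)
  then have "matrix_inv A *v axis l 1 = (\<chi> k. det (\<chi> i j. if j = k then axis l 1 $ i else A $ i $ j) / det A)"
    unfolding cramer[OF assms] .
  then have "(matrix_inv A *v axis l 1) $ k = det (\<chi> i j. if j = k then axis l 1 $ i else A $ i $ j) / det A"
    by simp
  then show ?thesis by (simp add: matrix_vector_mul_component inner_axis' matrix_vector_mult_basis column_def)
qed

lemma tendsto_matrix_inv:
  fixes A :: "'x \<Rightarrow> real^'n::finite^'n"
  assumes A: "(A \<longlongrightarrow> A0) F" and d: "det A0 \<noteq> 0"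
  shows "((\<lambda>s. matrix_inv (A s)) \<longlongrightarrow> matrix_inv A0) F"
proof (rule vec_tendstoI, rule vec_tendstoI)
  fix k l
  have ev: "\<forall>\<^sub>F s in F. det (A s) \<noteq> 0"
    using tendsto_imp_eventually_ne[OF tendsto_det[OF A] d] .
  have "((\<lambda>s. det (\<chi> i j. if j = k then axis l 1 $ i else A s $ i $ j) / det (A s)) \<longlongrightarrow>
      det (\<chi> i j. if j = k then axis l 1 $ i else A0 $ i $ j) / det A0) F"
  proof (intro tendsto_divide tendsto_det A d tendsto_vec_lambda)
    show "((\<lambda>s. if j = k then axis l 1 $ i else A s $ i $ j) \<longlongrightarrow>
      (if j = k then axis l 1 $ i else A0 $ i $ j)) F" for i j
      by (cases "j = k") (simp_all add: tendsto_vec_nth[OF tendsto_vec_nth[OF A]])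
  qed
  then show "((\<lambda>s. matrix_inv (A s) $ k $ l) \<longlongrightarrow> matrix_inv A0 $ k $ l) F"
    unfolding matrix_inv_cramer[OF d]
    by (rule Lim_transform_eventually) (use ev in \<open>auto elim!: eventually_mono simp: matrix_inv_cramer\<close>)
qed

lemma UNIV_idx_sum:
  fixes f :: "'m::finite idx \<Rightarrow> 'a::comm_monoid_add"
  shows "(\<Sum>i\<in>UNIV. f i) = (\<Sum>a\<in>UNIV. f (Inl a)) + (\<Sum>a\<in>UNIV. f (Inr (Inl a))) + f il + f ik"
  by (simp add: UNIV_Plus_UNIV[symmetric] sum.Plus UNIV_bool ac_simps del: UNIV_Plus_UNIV)

lemma idx_cases [case_names X Y il ik]:
  fixes i :: "'m idx"
  obtains a where "i = Inl a" | a where "i = Inr (Inl a)" | "i = il" | "i = ik"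
proof (cases i)
  case (Inr j)
  show thesis
  proof (cases j)
    case (Inr p)
    then show thesis using \<open>i = Inr j\<close> that(3,4) by (cases p) simp_all
  qed (use \<open>i = Inr j\<close> that(2) in blast)
qed (use that(1) in blast)

lemma eta_nth [simp]:
  "eta $ Inl a $ Inl b = (if a = b then 1 else 0)" "eta $ Inl a $ Inr j = 0"
  "eta $ Inr (Inl a) $ Inr (Inl b) = (if a = b then 1 else 0)"
  "eta $ Inr (Inl a) $ Inl c = 0" "eta $ Inr (Inl a) $ Inr (Inr q) = 0"
  "eta $ Inr (Inr p) $ Inl c = 0" "eta $ Inr (Inr p) $ Inr (Inl b) = 0"
  "eta $ Inr (Inr p) $ Inr (Inr q) = (if p \<noteq> q then 1 else 0)"
  by (simp_all add: eta_def split: sum.split)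

lemma transpose_eta [simp]: "transpose eta = eta"
  unfolding vec_eq_iff transpose_def
proof (intro allI)
  show "(\<chi> i j. eta $ j $ i) $ i $ j = (eta $ i $ j :: real)" for i j :: "'m::finite idx"
    by (cases i rule: idx_cases; cases j rule: idx_cases) auto
qed

lemma eta_mult: "(eta ** A) $ i $ j = (case i of Inl a \<Rightarrow> A $ Inl a $ j | Inr (Inl a) \<Rightarrow> A $ Inr (Inl a) $ j
    | Inr (Inr p) \<Rightarrow> A $ Inr (Inr (\<not> p)) $ j)"
  by (cases i rule: idx_cases)
    (simp_all add: matrix_matrix_mult_def UNIV_idx_sum if_distrib[where f = "\<lambda>x. x * _"] cong: if_cong)

lemma eta_eta [simp]: "eta ** eta = mat 1"
  unfolding vec_eq_iff eta_mult
proof (intro allI)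
  show "(case i of Inl a \<Rightarrow> eta $ Inl a $ j | Inr (Inl a) \<Rightarrow> eta $ Inr (Inl a) $ j
    | Inr (Inr p) \<Rightarrow> eta $ Inr (Inr (\<not> p)) $ j) = (mat 1 :: real^'m idx^'m idx) $ i $ j" for i j :: "'m::finite idx"
    by (cases i rule: idx_cases; cases j rule: idx_cases) (auto simp: mat_def)
qed

lemma det_eta: "det (eta :: real^'m::finite idx^'m idx) \<noteq> 0"
proof
  assume "det (eta :: real^'m idx^'m idx) = 0"
  then have "det (eta ** eta :: real^'m idx^'m idx) = 0" by (simp add: det_mul del: eta_eta)
  then show False by (simp add: det_I)
qed

lemma cmat_mul: "cmat (A ** B) = cmat A ** cmat B"
  by (simp add: cmat_def matrix_matrix_mult_def vec_eq_iff)

lemma cmat_1 [simp]: "cmat (mat 1) = mat 1"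
  by (simp add: cmat_def mat_def vec_eq_iff)

lemma cmat_add: "cmat (A + B) = cmat A + cmat B"
  by (simp add: cmat_def vec_eq_iff)

lemma cmat_diff: "cmat (A - B) = cmat A - cmat B"
  by (simp add: cmat_def vec_eq_iff)

lemma cmat_scaleR: "cmat (r *\<^sub>R A) *v v = complex_of_real r *s (cmat A *v v)"
  by (simp add: cmat_def vec_eq_iff matrix_vector_mult_def sum_distrib_left mult.assoc)

lemma N_subspace: "vec.subspace N_model"
  unfolding N_model_def by (auto simp: vec.subspace_def algebra_simps)

lemma invertible_image_eq:
  fixes A :: "complex^'n::finite^'n"
  assumes "vec.subspace V" "(*v) A ` V \<subseteq> V" "B ** A = mat 1"
  shows "(*v) A ` V = V"
proof (rule vec.subspace_dim_equal)
  show "vec.subspace ((*v) A ` V)"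
    by (rule vec.linear_subspace_image[OF matrix_vector_mul_linear_gen assms(1)])
  have "inj ((*v) A)" using assms(3) matrix_left_invertible_injective by blast
  then show "vec.dim V \<le> vec.dim ((*v) A ` V)"
    by (subst vec.dim_image_eq[OF matrix_vector_mul_linear_gen]) (auto intro: inj_on_subset)
qed (use assms in auto)

lemma so_alg_iff: "A \<in> so_alg \<longleftrightarrow> transpose A ** eta = - (eta ** A)"
  by (simp add: so_alg_def eq_neg_iff_add_eq_0)

lemma transpose_diff: "transpose (A - B) = transpose A - transpose (B :: 'a::ab_group_add^'n^'m)"
  by (simp add: transpose_def vec_eq_iff)

lemma transpose_add: "transpose (A + B) = transpose A + transpose (B :: 'a::ab_group_add^'n^'m)"
  by (simp add: transpose_def vec_eq_iff)

lemma transpose_scaleR: "transpose (r *\<^sub>R A) = r *\<^sub>R transpose (A :: real^'n^'m)"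
  by (simp add: transpose_def vec_eq_iff)

lemma matrix_diff_left': "(A - B) ** C = A ** C - B ** (C :: real^'n::finite^'k::finite)"
  by (simp add: matrix_matrix_mult_def vec_eq_iff left_diff_distrib sum_subtractf)

lemma matrix_diff_right': "C ** (A - B) = C ** A - C ** (B :: real^'n::finite^'k::finite)"
  by (simp add: matrix_matrix_mult_def vec_eq_iff right_diff_distrib sum_subtractf)

lemma matrix_add_rdistrib': "(A + B) ** C = A ** C + B ** (C :: real^'n::finite^'k::finite)"
  by (simp add: matrix_matrix_mult_def vec_eq_iff distrib_right sum.distrib)

lemma matrix_scaleR_left: "(r *\<^sub>R A) ** C = r *\<^sub>R (A ** (C :: real^'n::finite^'k::finite))"
  by (simp add: matrix_matrix_mult_def vec_eq_iff sum_distrib_left mult.assoc)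

lemma matrix_scaleR_right: "C ** (r *\<^sub>R A) = r *\<^sub>R (C ** (A :: real^'n::finite^'k::finite))"
  by (simp add: matrix_matrix_mult_def vec_eq_iff sum_distrib_left ac_simps)

lemma matrix_minus_right: "C ** (- A) = - (C ** (A :: real^'n::finite^'k::finite))"
  by (simp add: matrix_matrix_mult_def vec_eq_iff sum_negf)

lemma so_alg_scaleR: "X \<in> so_alg \<Longrightarrow> r *\<^sub>R X \<in> so_alg"
  unfolding so_alg_iff transpose_scaleR
  by (simp add: matrix_scaleR_left matrix_scaleR_right)

lemma matrix_inv_mult:
  fixes A :: "'a::field^'n^'n"
  assumes "det A \<noteq> 0"
  shows "A ** matrix_inv A = mat 1" "matrix_inv A ** A = mat 1"
proof -
  obtain B where "A ** B = mat 1"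
    using assms invertible_det_nz[of A] unfolding invertible_def by blast
  then show "A ** matrix_inv A = mat 1" "matrix_inv A ** A = mat 1"
    using matrix_inv_eqI[of A B] matrix_left_right_inverse[of A B] by auto
qed

text \<open>The Cayley transform takes the place of the exponential: that it is an isometry of
  determinant 1 preserving N becomes algebra with the commuting matrices a and b.\<close>

locale cayley =
  fixes Y :: "real^'m::finite idx^'m idx"
  assumes Y: "Y \<in> so_alg" and YN: "(*v) (cmat Y) ` N_model \<subseteq> N_model"
    and det_nz: "det (mat 1 - Y) \<noteq> 0"
begin

abbreviation a where "a \<equiv> mat 1 - Y"
abbreviation b where "b \<equiv> mat 1 + Y"

definition q where "q = matrix_inv a ** b"

lemma ab: "a ** b = b ** a"
  by (simp add: matrix_add_ldistrib matrix_add_rdistrib' matrix_diff_left' matrix_diff_right')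

lemma aq: "a ** q = b"
  by (simp add: q_def matrix_mul_assoc matrix_inv_mult[OF det_nz])

lemma qa: "q ** a = b"
proof -
  have "q ** a = matrix_inv a ** (b ** a)" by (simp add: q_def matrix_mul_assoc)
  also have "\<dots> = (matrix_inv a ** a) ** b" unfolding ab[symmetric] by (simp add: matrix_mul_assoc)
  finally show ?thesis by (simp add: matrix_inv_mult[OF det_nz])
qed

lemma trans_eta: "transpose b ** eta = eta ** a" "transpose a ** eta = eta ** b"
  using Y by (simp_all add: so_alg_iff transpose_add transpose_diff matrix_add_ldistrib
      matrix_add_rdistrib' matrix_diff_left' matrix_diff_right')

lemma det_b: "det b = det a"
proof -
  have "det (transpose b ** eta) = det (eta ** a)" unfolding trans_eta(1) ..
  then show ?thesis using det_eta[where 'm='m] by (simp add: det_mul)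
qed

lemma det_q: "det q = 1"
  using arg_cong[OF aq, of det] det_b det_nz by (simp add: det_mul)

lemma orth: "transpose q ** eta ** q = eta"
proof -
  have "transpose a ** (transpose q ** eta ** q) ** a = transpose (q ** a) ** eta ** (q ** a)"
    by (simp add: matrix_transpose_mul matrix_mul_assoc)
  also have "\<dots> = eta ** (a ** b)" unfolding qa by (simp add: trans_eta matrix_mul_assoc)
  also have "\<dots> = transpose a ** eta ** a" unfolding ab by (simp add: trans_eta matrix_mul_assoc)
  finally have *: "transpose a ** (transpose q ** eta ** q) ** a = transpose a ** eta ** a" .
  have cdot: "det (transpose a) \<noteq> 0" using det_nz by simp
  have "matrix_inv (transpose a) ** (transpose a ** (transpose q ** eta ** q) ** a) ** matrix_inv a
    = matrix_inv (transpose a) ** (transpose a ** eta ** a) ** matrix_inv a" unfolding * ..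
  then have "(matrix_inv (transpose a) ** transpose a) ** (transpose q ** eta ** q) ** (a ** matrix_inv a)
    = (matrix_inv (transpose a) ** transpose a) ** eta ** (a ** matrix_inv a)"
    by (simp add: matrix_mul_assoc)
  then show ?thesis by (simp add: matrix_inv_mult[OF det_nz] matrix_inv_mult[OF cdot])
qed

lemma mul_N: "v \<in> N_model \<Longrightarrow> cmat a *v v \<in> N_model" "v \<in> N_model \<Longrightarrow> cmat b *v v \<in> N_model"
  using YN by (auto simp: cmat_add cmat_diff algebra_simps intro!: vec.subspace_add vec.subspace_diff N_subspace)

lemma image_N: "(*v) (cmat a) ` N_model = N_model" "(*v) (cmat b) ` N_model = N_model"
proof -
  have "cmat (matrix_inv a) ** cmat a = mat 1"
    by (simp add: cmat_mul[symmetric] matrix_inv_mult[OF det_nz])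
  then show "(*v) (cmat a) ` N_model = N_model"
    using mul_N by (intro invertible_image_eq N_subspace) auto
  have "cmat (matrix_inv b) ** cmat b = mat 1"
    using det_nz det_b by (simp add: cmat_mul[symmetric] matrix_inv_mult)
  then show "(*v) (cmat b) ` N_model = N_model"
    using mul_N by (intro invertible_image_eq N_subspace) auto
qed

lemma q_N: "(*v) (cmat q) ` N_model = N_model"
proof -
  have "(*v) (cmat q) ` (*v) (cmat a) ` N_model = (*v) (cmat b) ` N_model"
    by (simp add: image_image matrix_vector_mul_assoc cmat_mul[symmetric] qa)
  then show ?thesis by (simp add: image_N)
qed

lemma inv_q: "matrix_inv q = matrix_inv b ** a"
proof (rule matrix_inv_eqI)
  have "q ** (matrix_inv b ** a) = matrix_inv a ** (b ** matrix_inv b) ** a"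
    by (simp add: q_def matrix_mul_assoc)
  also have "\<dots> = mat 1" using det_nz det_b by (simp add: matrix_inv_mult)
  finally show "q ** (matrix_inv b ** a) = mat 1" .
qed

end

text \<open>The half makes X the derivative at 0. Changing the sign of s exchanges the two factors
  up to inversion, and so inverts the matrix.\<close>

definition cay :: "real^'m::finite idx^'m idx \<Rightarrow> real \<Rightarrow> real^'m idx^'m idx" where
  "cay X s = matrix_inv (mat 1 - (s/2) *\<^sub>R X) ** (mat 1 + (s/2) *\<^sub>R X)"

lemma tendsto_cay_aux:
  fixes X :: "real^'n::finite^'n"
  shows "((\<lambda>s. matrix_inv (mat 1 - (s/2) *\<^sub>R X)) \<longlongrightarrow> mat 1) (at 0)"
  "\<forall>\<^sub>F s in at 0. det (mat 1 - (s/2) *\<^sub>R X) \<noteq> 0"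
proof -
  have l: "((\<lambda>s. mat 1 - (s/2) *\<^sub>R X) \<longlongrightarrow> mat 1 - (0/2) *\<^sub>R X) (at 0)"
    by (intro tendsto_add tendsto_diff tendsto_scaleR tendsto_divide tendsto_const tendsto_ident_at) simp
  then have l1: "((\<lambda>s. mat 1 - (s/2) *\<^sub>R X) \<longlongrightarrow> mat 1) (at 0)" by simp
  have "matrix_inv (mat 1 :: real^'n^'n) = mat 1" by (rule matrix_inv_eqI) simp
  with tendsto_matrix_inv[OF l1] show "((\<lambda>s. matrix_inv (mat 1 - (s/2) *\<^sub>R X)) \<longlongrightarrow> mat 1) (at 0)"
    by simp
  show "\<forall>\<^sub>F s in at 0. det (mat 1 - (s/2) *\<^sub>R X) \<noteq> 0"
    using tendsto_imp_eventually_ne[OF tendsto_det[OF l1], of 0] by simp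
qed

lemma tendsto_cay: "(cay X \<longlongrightarrow> mat 1) (at 0)"
proof -
  have l: "((\<lambda>s. mat 1 + (s/2) *\<^sub>R X) \<longlongrightarrow> mat 1 + (0/2) *\<^sub>R X) (at 0)"
    by (intro tendsto_add tendsto_diff tendsto_scaleR tendsto_divide tendsto_const tendsto_ident_at) simp
  from tendsto_matrix_mult[OF tendsto_cay_aux(1) l] show ?thesis
    unfolding cay_def by simp
qed

lemma cay_diff_quot: "((\<lambda>s. (1 / s) *\<^sub>R (cay X s - mat 1)) \<longlongrightarrow> X) (at 0)"
proof -
  have "\<forall>\<^sub>F s in at 0. matrix_inv (mat 1 - (s/2) *\<^sub>R X) ** X = (1 / s) *\<^sub>R (cay X s - mat 1)"
    using tendsto_cay_aux(2)[of X] eventually_neq_at_within[of 0 "0::real" UNIV]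
  proof eventually_elim
    case (elim s)
    let ?a = "mat 1 - (s/2) *\<^sub>R X"
    \<comment> \<open>Over the common factor \<open>matrix_inv ?a\<close>, the difference is
      \<open>s *\<^sub>R X\<close>.\<close>
    have "cay X s - mat 1 = matrix_inv ?a ** (mat 1 + (s/2) *\<^sub>R X) - matrix_inv ?a ** ?a"
      using elim by (simp add: cay_def matrix_inv_mult)
    also have "\<dots> = matrix_inv ?a ** (s *\<^sub>R X)"
      unfolding matrix_diff_right'[symmetric] by (simp add: algebra_simps scaleR_2[symmetric])
    finally show ?case using elim by (simp add: matrix_scaleR_right)
  qed
  moreover have "((\<lambda>s. matrix_inv (mat 1 - (s/2) *\<^sub>R X) ** X) \<longlongrightarrow> X) (at 0)"
    using tendsto_matrix_mult[OF tendsto_cay_aux(1) tendsto_const, of X X] by simp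
  ultimately show ?thesis by (rule Lim_transform_eventually[rotated])
qed

text \<open>Restricted to small s: \<open>mat 1 - (s/2) *\<^sub>R X\<close> has to be invertible,
  and the time orientation, an open condition, is inherited from s = 0.\<close>

lemma cay_Q:
  assumes X: "X \<in> q_alg"
  shows "\<forall>\<^sub>F s in at 0. cay X s \<in> Q_group \<and> matrix_inv (cay X s) = cay X (- s)"
proof -
  let ?t = "axis ik 1 - axis il 1 :: real^'a idx"
  have "((\<lambda>s. (cay X s *v ?t) \<bullet> (eta *v ?t)) \<longlongrightarrow> (mat 1 *v ?t) \<bullet> (eta *v ?t)) (at 0)"
    by (intro tendsto_inner tendsto_matrix_vec tendsto_cay tendsto_const)
  moreover have "(mat 1 *v ?t) \<bullet> (eta *v ?t) < 0"
    by (simp add: inner_vec_def matrix_vector_mult_def UNIV_idx_sum axis_def mat_def)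
  ultimately have "\<forall>\<^sub>F s in at 0. (cay X s *v ?t) \<bullet> (eta *v ?t) < 0"
    by (rule order_tendstoD(2))
  then show ?thesis using tendsto_cay_aux(2)[of X]
  proof eventually_elim
    case (elim s)
    have "(s/2) *\<^sub>R X \<in> so_alg" using X by (simp add: q_alg_def so_alg_scaleR)
    moreover have "(*v) (cmat ((s/2) *\<^sub>R X)) ` N_model \<subseteq> N_model"
      using X by (auto simp: q_alg_def cmat_scaleR intro!: vec.subspace_scale N_subspace)
    ultimately interpret cayley "(s/2) *\<^sub>R X" using elim by unfold_locales
    have "cay X s = q" by (simp add: cay_def q_def)
    then show ?case using elim det_q orth q_N inv_q
      by (simp add: Q_group_def SO0_def Let_def cay_def)
  qed
qed

section \<open>Invariance under the Lie algebra of Q\<close>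

lemma subspace_so_alg: "subspace so_alg"
  unfolding subspace_def so_alg_def
  by (auto simp: transpose_add transpose_scaleR matrix_add_ldistrib matrix_add_rdistrib' matrix_scaleR_left
      matrix_scaleR_right scaleR_add_right[symmetric] algebra_simps)
    (simp_all add: transpose_def matrix_matrix_mult_def vec_eq_iff)

lemma subspace_q_alg: "subspace q_alg"
proof -
  have 0: "cmat 0 *v v = 0" for v :: "complex^'a::finite idx"
    by (simp add: cmat_def matrix_vector_mult_def vec_eq_iff)
  have "(0 :: real^'a idx^'a idx) \<in> q_alg" using subspace_0[OF subspace_so_alg] vec.subspace_0[OF N_subspace]
    by (auto simp: q_alg_def 0)
  moreover have "x \<in> q_alg \<Longrightarrow> y \<in> q_alg \<Longrightarrow> x + y \<in> q_alg" for x y :: "real^'a idx^'a idx"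
    using subspace_add[OF subspace_so_alg, of x y]
    by (auto simp: q_alg_def cmat_add matrix_vector_mult_add_rdistrib intro!: vec.subspace_add[OF N_subspace])
  moreover have "x \<in> q_alg \<Longrightarrow> c *\<^sub>R x \<in> q_alg" for c and x :: "real^'a idx^'a idx"
    using subspace_scale[OF subspace_so_alg, of x c]
    by (auto simp: q_alg_def cmat_scaleR intro!: vec.subspace_scale[OF N_subspace])
  ultimately show ?thesis by (simp add: subspace_def)
qed

lemma torsion_class_cong:
  assumes "\<And>v. S v - T v \<in> q_alg"
  shows "torsion_class S = torsion_class T"
proof -
  have "R v - S v \<in> q_alg \<longleftrightarrow> R v - T v \<in> q_alg" for R v
  proof
    show "R v - S v \<in> q_alg \<Longrightarrow> R v - T v \<in> q_alg"
      using subspace_add[OF subspace_q_alg _ assms[of v], of "R v - S v"] by simp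
    show "R v - T v \<in> q_alg \<Longrightarrow> R v - S v \<in> q_alg"
      using subspace_diff[OF subspace_q_alg _ assms[of v], of "R v - T v"] by simp
  qed
  then show ?thesis by (simp add: torsion_class_def)
qed

lemma self_in_class: "T \<in> conn_space \<Longrightarrow> T \<in> torsion_class T"
  by (simp add: torsion_class_def subspace_0[OF subspace_q_alg])

lemma in_class_eq: "S \<in> torsion_class T \<Longrightarrow> torsion_class S = torsion_class T"
  by (rule torsion_class_cong) (simp add: torsion_class_def)

text \<open>Coordinates of a linear map in a Euclidean space, where every subspace is
  closed.\<close>

definition tens :: "real^'m::finite idx^'m idx^'m idx \<Rightarrow> 'm tensor" where
  "tens M v = (\<Sum>i\<in>UNIV. v $ i *\<^sub>R M $ i)"

lemma tens_linear: "linear T \<Longrightarrow> tens (\<chi> i. T (axis i 1)) = T"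
proof
  fix v assume T: "linear T"
  have "T v = T (\<Sum>i\<in>UNIV. v $ i *\<^sub>R axis i 1)"
    by (simp add: scalar_mult_eq_scaleR[symmetric] basis_expansion)
  also have "\<dots> = tens (\<chi> i. T (axis i 1)) v"
    by (simp add: tens_def linear_sum[OF T] linear_scale[OF T])
  finally show "tens (\<chi> i. T (axis i 1)) v = T v" ..
qed

text \<open>The derivative at the identity, in the direction X, of the action of the group on
  tensors.\<close>

definition bracket :: "real^'m::finite idx^'m idx \<Rightarrow> 'm tensor \<Rightarrow> 'm tensor" where
  "bracket X T v = X ** T v - T v ** X - T (X *v v)"

lemma linear_bracket: "linear T \<Longrightarrow> linear (bracket X T)"
  by (rule linearI) (simp_all add: bracket_def linear_add linear_scale matrix_add_ldistrib
      matrix_add_rdistrib' matrix_scaleR_left matrix_scaleR_right matrix_vector_right_distrib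
      matrix_vector_mult_scaleR algebra_simps)

lemma matrix_vector_minus: "(- A) *v x = - (A *v (x :: real^'n::finite))"
  by (simp add: matrix_vector_mult_def vec_eq_iff sum_negf)

locale Q_sub =
  fixes W :: "('m::finite tensor set) set"
  assumes W: "Q_submodule W"
begin

text \<open>The union of the cosets in W; it replaces classes by tensors.\<close>

definition Wt :: "'m tensor set" where
  "Wt = {T \<in> conn_space. torsion_class T \<in> W}"

lemma Wt_conn: "T \<in> Wt \<Longrightarrow> T \<in> conn_space"
  by (simp add: Wt_def)

lemma Wt_linear: "T \<in> Wt \<Longrightarrow> linear T"
  by (simp add: Wt_def conn_space_def)

lemma W_Wt: "C \<in> W \<longleftrightarrow> (\<exists>T\<in>Wt. C = torsion_class T)"
  using W by (auto simp: Q_submodule_def torsion_module_def Wt_def)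

lemma Wt_cong: "T \<in> Wt \<Longrightarrow> S \<in> conn_space \<Longrightarrow> (\<And>v. S v - T v \<in> q_alg) \<Longrightarrow> S \<in> Wt"
  using torsion_class_cong[of S T] by (simp add: Wt_def)

lemma conn_zero: "(\<lambda>v. 0) \<in> conn_space"
  by (simp add: conn_space_def linear_zero subspace_0[OF subspace_so_alg])

lemma conn_add: "S \<in> conn_space \<Longrightarrow> T \<in> conn_space \<Longrightarrow> (\<lambda>v. S v + T v) \<in> conn_space"
  by (simp add: conn_space_def linear_compose_add subspace_add[OF subspace_so_alg])

lemma conn_scale: "T \<in> conn_space \<Longrightarrow> (\<lambda>v. r *\<^sub>R T v) \<in> conn_space"
  by (simp add: conn_space_def linear_compose_scale_right subspace_scale[OF subspace_so_alg])

lemma Wt_zero: "(\<lambda>v. 0) \<in> Wt"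
  using W conn_zero by (simp add: Wt_def Q_submodule_def)

lemma Wt_add: "S \<in> Wt \<Longrightarrow> T \<in> Wt \<Longrightarrow> (\<lambda>v. S v + T v) \<in> Wt"
  using W conn_add unfolding Wt_def Q_submodule_def by blast

lemma Wt_scale: "T \<in> Wt \<Longrightarrow> (\<lambda>v. r *\<^sub>R T v) \<in> Wt"
  using W conn_scale unfolding Wt_def Q_submodule_def by blast

lemma Wt_Q:
  assumes q: "q \<in> Q_group" and T: "T \<in> Wt"
  shows "(\<lambda>v. q ** T (matrix_inv q *v v) ** matrix_inv q) \<in> Wt" (is "?S \<in> Wt")
proof -
  have TW: "torsion_class T \<in> W" "T \<in> conn_space" using T by (auto simp: Wt_def)
  then have C: "Q_act q (torsion_class T) \<in> W" using W q by (simp add: Q_submodule_def)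
  then obtain R where R: "R \<in> Wt" "Q_act q (torsion_class T) = torsion_class R" using W_Wt by blast
  have "?S \<in> Q_act q (torsion_class T)"
    unfolding Q_act_def using self_in_class[OF TW(2)] by (rule imageI)
  then have S: "?S \<in> torsion_class R" using R by simp
  then have "?S \<in> conn_space" by (simp add: torsion_class_def)
  moreover have "torsion_class ?S = torsion_class R" by (rule in_class_eq[OF S])
  ultimately show ?thesis using C R by (simp add: Wt_def)
qed

lemma subspace_tens: "subspace {M. tens M \<in> Wt}"
proof -
  have "tens (M + N) = (\<lambda>v. tens M v + tens N v)" for M N :: "real^'m idx^'m idx^'m idx"
    by (rule ext) (simp add: tens_def scaleR_add_right sum.distrib)
  moreover have "tens (r *\<^sub>R M) = (\<lambda>v. r *\<^sub>R tens M v)" for r and M :: "real^'m idx^'m idx^'m idx"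
    by (rule ext) (simp add: tens_def scaleR_sum_right mult.commute)
  moreover have "tens 0 = (\<lambda>v. 0 :: real^'m idx^'m idx)" by (rule ext) (simp add: tens_def)
  ultimately show ?thesis using Wt_zero Wt_add Wt_scale by (simp add: subspace_def)
qed

text \<open>Invariance under the group gives invariance under its Lie algebra: the submodule is a closed
  subspace, so it contains the derivatives of its orbits.\<close>

lemma Wt_bracket:
  assumes X: "X \<in> q_alg" and T: "T \<in> Wt"
  shows "bracket X T \<in> Wt"
proof -
  have lin: "linear T" using T by (rule Wt_linear)
  define D where "D s v = (1 / s) *\<^sub>R (cay X s ** T (cay X (- s) *v v) ** cay X (- s) - T v)" for s v
  have linD: "linear (D s)" for s
    unfolding D_def
    by (rule linearI) (simp_all add: linear_add[OF lin] linear_scale[OF lin] matrix_add_ldistrib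
      matrix_add_rdistrib' matrix_scaleR_left matrix_scaleR_right matrix_vector_right_distrib
      matrix_vector_mult_scaleR algebra_simps)
  define M where "M s = (\<chi> i. D s (axis i 1))" for s
  have ev: "\<forall>\<^sub>F s in at 0. M s \<in> {M. tens M \<in> Wt}"
    using cay_Q[OF X]
  proof eventually_elim
    case (elim s)
    then have "(\<lambda>v. cay X s ** T (cay X (- s) *v v) ** cay X (- s)) \<in> Wt"
      using Wt_Q[OF _ T, of "cay X s"] by simp
    from Wt_scale[OF Wt_add[OF this Wt_scale[OF T, of "-1"]], of "1 / s"]
    have "D s \<in> Wt" by (simp add: D_def[abs_def])
    then show ?case by (simp add: M_def tens_linear[OF linD])
  qed
  have um: "filterlim uminus (at 0) (at (0::real))"
    unfolding filterlim_def filtermap_at_minus by simp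
  have cm: "((\<lambda>s. cay X (- s)) \<longlongrightarrow> mat 1) (at 0)"
    by (rule filterlim_compose[OF tendsto_cay[of X] um])
  have qm: "((\<lambda>s. (1 / s) *\<^sub>R (cay X (- s) - mat 1)) \<longlongrightarrow> - X) (at 0)"
    using tendsto_minus[OF filterlim_compose[OF cay_diff_quot[of X] um]] by simp
  have lim: "((\<lambda>s. D s v) \<longlongrightarrow> bracket X T v) (at 0)" for v
  proof -
    have bl: "bounded_linear T" using lin by (simp add: linear_conv_bounded_linear)
    let ?q = "\<lambda>s. (1 / s) *\<^sub>R (cay X s - mat 1)" and ?p = "\<lambda>s. (1 / s) *\<^sub>R (cay X (- s) - mat 1)"
    \<comment> \<open>The difference quotient of the triple product is split as in the product rule,
      one factor changing at a time.\<close>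
    have "D s v = ?q s ** T (cay X (- s) *v v) ** cay X (- s)
        + T (?p s *v v) ** cay X (- s) + T v ** ?p s" for s
      by (simp add: D_def matrix_scaleR_left matrix_scaleR_right matrix_diff_left' matrix_diff_right'
          scaleR_matrix_vector_assoc[symmetric] matrix_vector_mult_diff_rdistrib linear_scale[OF lin]
          linear_diff[OF lin] algebra_simps)
    moreover have "((\<lambda>s. ?q s ** T (cay X (- s) *v v) ** cay X (- s)
        + T (?p s *v v) ** cay X (- s) + T v ** ?p s)
      \<longlongrightarrow> X ** T (mat 1 *v v) ** mat 1 + T (- X *v v) ** mat 1 + T v ** (- X)) (at 0)"
      by (intro tendsto_add tendsto_matrix_mult cay_diff_quot qm cm tendsto_const
          bounded_linear.tendsto[OF bl] tendsto_matrix_vec)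
    moreover have "X ** T (mat 1 *v v) ** mat 1 + T (- X *v v) ** mat 1 + T v ** (- X) = bracket X T v"
      by (simp add: bracket_def matrix_minus_right matrix_vector_minus linear_neg[OF lin])
    ultimately show ?thesis by simp
  qed
  have "(M \<longlongrightarrow> (\<chi> i. bracket X T (axis i 1))) (at 0)"
    unfolding M_def by (intro tendsto_vec_lambda lim)
  from Lim_in_closed_set[OF closed_subspace[OF subspace_tens] ev _ this]
  show ?thesis by (simp add: tens_linear[OF linear_bracket[OF lin]])
qed

end

section \<open>The components of a connection tensor\<close>

definition cdot :: "complex^'n \<Rightarrow> complex^'n \<Rightarrow> complex" where
  "cdot v w = (\<Sum>i\<in>UNIV. v $ i * w $ i)"

lemma cbil_cdot: "cbil G v w = cdot v (cmat G *v w)"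
  by (simp add: cbil_def cdot_def cmat_def matrix_vector_mult_def sum_distrib_left ac_simps)

lemma cdot_matrix: "cdot (A *v v) w = cdot v (transpose A *v w)"
proof -
  have "cdot (A *v v) w = (\<Sum>i\<in>UNIV. \<Sum>j\<in>UNIV. A $ i $ j * v $ j * w $ i)"
    by (simp add: cdot_def matrix_vector_mult_def sum_distrib_right)
  also have "\<dots> = (\<Sum>j\<in>UNIV. \<Sum>i\<in>UNIV. A $ i $ j * v $ j * w $ i)" by (rule sum.swap)
  also have "\<dots> = cdot v (transpose A *v w)"
    by (simp add: cdot_def matrix_vector_mult_def transpose_def sum_distrib_left ac_simps)
  finally show ?thesis .
qed

lemma cmat_transpose: "cmat (transpose A) = transpose (cmat A)"
  by (simp add: cmat_def transpose_def vec_eq_iff)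

lemma cmat_minus: "cmat (- A) *v v = - (cmat A *v v)"
  by (simp add: cmat_def matrix_vector_mult_def vec_eq_iff sum_negf)

lemma cdot_simps:
  "cdot (u + v) w = cdot u w + cdot v w" "cdot (c *s v) w = c * cdot v w" "cdot (- v) w = - cdot v w"
  "cdot w (u + v) = cdot w u + cdot w v" "cdot w (c *s v) = c * cdot w v" "cdot w (- v) = - cdot w v"
  "cdot (u - v) w = cdot u w - cdot v w"
  by (simp_all add: cdot_def algebra_simps sum.distrib sum_distrib_left sum_negf sum_subtractf)

lemma cbil_simps:
  "cbil G (u + v) w = cbil G u w + cbil G v w" "cbil G (c *s v) w = c * cbil G v w"
  "cbil G (- v) w = - cbil G v w" "cbil G (u - v) w = cbil G u w - cbil G v w"
  "cbil G w (u + v) = cbil G w u + cbil G w v" "cbil G w (c *s v) = c * cbil G w v"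
  by (simp_all add: cbil_cdot cdot_simps matrix_vector_right_distrib vec.scale)

lemma cbil_eta: "cbil eta v w = (\<Sum>a\<in>UNIV. v $ Inl a * w $ Inl a)
    + (\<Sum>a\<in>UNIV. v $ Inr (Inl a) * w $ Inr (Inl a)) + v $ il * w $ ik + v $ ik * w $ il"
  by (simp add: cbil_def UNIV_idx_sum if_distrib[where f = complex_of_real]
      if_distrib[where f = "\<lambda>x. x * _"] cong: if_cong)

lemma cbil_eta_commute: "cbil eta v w = cbil eta w v"
  by (simp add: cbil_eta mult.commute)

lemma cbil_skew:
  assumes "X \<in> so_alg"
  shows "cbil eta (cmat X *v v) w = - cbil eta v (cmat X *v w)"
  using assms unfolding cbil_cdot cdot_matrix so_alg_iff
  by (simp add: cmat_transpose[symmetric] matrix_vector_mul_assoc cmat_mul[symmetric] cmat_minus cdot_simps)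

definition cform :: "'m::finite tensor \<Rightarrow> complex^'m idx \<Rightarrow> complex^'m idx \<Rightarrow> complex^'m idx \<Rightarrow> complex" where
  "cform T u v w = cbil eta (ctensor T u *v v) w"

lemma ctensor_nth: "ctensor T u $ i $ j
    = of_real (T (re_vec u) $ i $ j) + \<i> * of_real (T (im_vec u) $ i $ j)"
  by (simp add: ctensor_def complex_eq_iff)

lemma ctensor_mult: "ctensor T u *v v = cmat (T (re_vec u)) *v v + \<i> *s (cmat (T (im_vec u)) *v v)"
  by (simp add: vec_eq_iff matrix_vector_mult_def ctensor_nth cmat_def distrib_right sum.distrib
      sum_distrib_left mult.assoc)

lemma vec_re_im:
  "re_vec (u + v) = re_vec u + re_vec v" "im_vec (u + v) = im_vec u + im_vec v"
  "re_vec (c *s v) = Re c *\<^sub>R re_vec v - Im c *\<^sub>R im_vec v"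
  "im_vec (c *s v) = Re c *\<^sub>R im_vec v + Im c *\<^sub>R re_vec v"
  "re_vec (cmat X *v v) = X *v re_vec v" "im_vec (cmat X *v v) = X *v im_vec v"
  by (simp_all add: re_vec_def im_vec_def vec_eq_iff cmat_def matrix_vector_mult_def)

lemma ctensor_add: "linear T \<Longrightarrow> ctensor T (u + v) = ctensor T u + ctensor T v"
  by (simp add: vec_eq_iff ctensor_nth vec_re_im linear_add algebra_simps)

lemma ctensor_scale: "linear T \<Longrightarrow> ctensor T (c *s u) *v v = c *s (ctensor T u *v v)"
proof -
  assume T: "linear T"
  have "ctensor T (c *s u) $ i $ j = c * ctensor T u $ i $ j" for i j
    by (simp add: ctensor_nth vec_re_im linear_add[OF T] linear_diff[OF T] linear_scale[OF T] complex_eq_iff)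
  then show ?thesis by (simp add: vec_eq_iff matrix_vector_mult_def sum_distrib_left mult.assoc)
qed

lemma cform_add_scale:
  assumes T: "linear T"
  shows "cform T (u + u') v w = cform T u v w + cform T u' v w" "cform T (c *s u) v w = c * cform T u v w"
    "cform T u (v + v') w = cform T u v w + cform T u v' w" "cform T u (c *s v) w = c * cform T u v w"
    "cform T u v (w + w') = cform T u v w + cform T u v w'" "cform T u v (c *s w) = c * cform T u v w"
  by (simp_all add: cform_def ctensor_add[OF T] ctensor_scale[OF T] matrix_vector_mult_add_rdistrib
      matrix_vector_right_distrib vec.scale cbil_simps)

lemma neg_scale: "- (v::complex^'n) = (- 1) *s v" and zero_scale: "(0::complex^'n) = 0 *s 0"
  by (simp_all add: vec_eq_iff)

lemma cform_diff:
  assumes T: "linear T"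
  shows "cform T (u - u') v w = cform T u v w - cform T u' v w"
    "cform T u (v - v') w = cform T u v w - cform T u v' w"
    "cform T u v (w - w') = cform T u v w - cform T u v w'"
  unfolding diff_conv_add_uminus neg_scale cform_add_scale[OF T] by simp_all

lemma cform_zero:
  assumes T: "linear T"
  shows "cform T 0 v w = 0" "cform T u 0 w = 0" "cform T u v 0 = 0"
  using cform_add_scale(2)[OF T, of 0 0] cform_add_scale(4)[OF T, of _ 0 0] cform_add_scale(6)[OF T, of _ _ 0 0] by simp_all

lemma cform_sum:
  assumes T: "linear T"
  shows "cform T (\<Sum>i\<in>I. f i) v w = (\<Sum>i\<in>I. cform T (f i) v w)"
    "cform T u (\<Sum>i\<in>I. f i) w = (\<Sum>i\<in>I. cform T u (f i) w)"
    "cform T u v (\<Sum>i\<in>I. f i) = (\<Sum>i\<in>I. cform T u v (f i))"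
  by (induction I rule: infinite_finite_induct) (simp_all add: cform_zero[OF T] cform_add_scale[OF T])

lemmas cform_linear = cform_add_scale cform_diff cform_zero cform_sum

lemma cform_anti:
  assumes "T \<in> conn_space"
  shows "cform T u v w = - cform T u w v"
proof -
  have so: "T x \<in> so_alg" for x using assms by (simp add: conn_space_def)
  show ?thesis
    by (simp add: cform_def ctensor_mult cbil_simps cbil_skew[OF so] cbil_eta_commute[of v])
qed

lemma cform_same: "T \<in> conn_space \<Longrightarrow> cform T u v v = 0"
  using cform_anti[of T u v v] by simp

lemma cmat_mul_vec: "cmat (A ** B) *v v = cmat A *v (cmat B *v v)"
  by (simp add: cmat_mul matrix_vector_mul_assoc)

lemma ctensor_bracket:
  assumes T: "linear T"
  shows "ctensor (bracket X T) u *v v = cmat X *v (ctensor T u *v v) - ctensor T u *v (cmat X *v v)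
    - ctensor T (cmat X *v u) *v v"
  by (simp add: ctensor_mult bracket_def cmat_diff cmat_mul_vec vec_re_im matrix_vector_mult_diff_rdistrib
      matrix_vector_right_distrib vec.scale vec.scale_right_diff_distrib)

text \<open>In the first term of the bracket X moves to the last argument by skewness with respect
  to eta, which gives all three terms the same sign.\<close>

lemma cform_bracket:
  assumes T: "linear T" and X: "X \<in> so_alg"
  shows "cform (bracket X T) u v w = - (cform T (cmat X *v u) v w + cform T u (cmat X *v v) w + cform T u v (cmat X *v w))"
  by (simp add: cform_def ctensor_bracket[OF T] cbil_simps cbil_skew[OF X])

lemma cform_plus: "cform (\<lambda>v. S v + T v) u v w = cform S u v w + cform T u v w"
  by (simp add: cform_def ctensor_mult cmat_add matrix_vector_mult_add_rdistrib vec.scale_right_distrib cbil_simps)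

lemma cform_times: "cform (\<lambda>v. r *\<^sub>R T v) u v w = of_real r * cform T u v w"
  by (simp add: cform_def ctensor_mult cmat_scaleR cbil_simps algebra_simps)

lemma fr_nth [simp]:
  "fr (Inl a) $ Inl b = dl b a" "fr (Inl a) $ Inr (Inl b) = - \<i> * dl b a" "fr (Inl a) $ Inr (Inr p) = 0"
  "fr (Inr a) $ Inl b = dl b a" "fr (Inr a) $ Inr (Inl b) = \<i> * dl b a" "fr (Inr a) $ Inr (Inr p) = 0"
  by (simp_all add: fr_def axis_def dl_def)

lemma vk_nth [simp]: "vk $ Inl b = 0" "vk $ Inr (Inl b) = 0" "vk $ il = 0" "vk $ ik = 1"
  and vl_nth [simp]: "vl $ Inl b = 0" "vl $ Inr (Inl b) = 0" "vl $ il = 1" "vl $ ik = 0"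
  by (simp_all add: vk_def vl_def axis_def)

lemma idx_eqI:
  fixes v w :: "complex^'m::finite idx"
  assumes "\<And>a. v $ Inl a = w $ Inl a" "\<And>a. v $ Inr (Inl a) = w $ Inr (Inl a)" "v $ il = w $ il" "v $ ik = w $ ik"
  shows "v = w"
  unfolding vec_eq_iff
proof
  show "v $ i = w $ i" for i by (cases i rule: idx_cases) (simp_all add: assms)
qed

lemma frame_expand:
  "v = (\<Sum>a\<in>UNIV. ((v $ Inl a + \<i> * v $ Inr (Inl a)) / 2) *s fr (Inl a))
     + (\<Sum>a\<in>UNIV. ((v $ Inl a - \<i> * v $ Inr (Inl a)) / 2) *s fr (Inr a)) + v $ il *s vl + v $ ik *s vk"
proof (rule idx_eqI)
  fix b
  show "v $ Inl b = ((\<Sum>a\<in>UNIV. ((v $ Inl a + \<i> * v $ Inr (Inl a)) / 2) *s fr (Inl a))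
     + (\<Sum>a\<in>UNIV. ((v $ Inl a - \<i> * v $ Inr (Inl a)) / 2) *s fr (Inr a)) + v $ il *s vl + v $ ik *s vk) $ Inl b"
    by (simp only: vector_add_component sum_component vector_smult_component fr_nth vk_nth vl_nth sum_dl)
      (simp add: field_simps)
  have *: "(\<Sum>a\<in>UNIV. f a * (\<i> * dl b a)) = \<i> * f b" "(\<Sum>a\<in>UNIV. f a * (- \<i> * dl b a)) = - \<i> * f b" for f
    using sum_dl(4)[of "\<lambda>a. f a * \<i>" b] sum_dl(4)[of "\<lambda>a. f a * - \<i>" b] by (simp_all add: ac_simps)
  show "v $ Inr (Inl b) = ((\<Sum>a\<in>UNIV. ((v $ Inl a + \<i> * v $ Inr (Inl a)) / 2) *s fr (Inl a))
     + (\<Sum>a\<in>UNIV. ((v $ Inl a - \<i> * v $ Inr (Inl a)) / 2) *s fr (Inr a)) + v $ il *s vl + v $ ik *s vk) $ Inr (Inl b)"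
    by (simp only: vector_add_component sum_component vector_smult_component fr_nth vk_nth vl_nth *)
      (simp add: field_simps)
qed (simp_all add: sum_component)

text \<open>For u running through the frame, these values pair the image under T(u) of the conjugate
  of N, spanned by \<open>vk\<close> and the \<open>fr (Inl a)\<close>, with that conjugate itself.
  As T is real, they decide whether T takes values in \<open>q_alg\<close>; see
  \<open>Phi_kernel\<close>.\<close>

fun Phi :: "'m::finite tensor \<Rightarrow> 'm cix \<Rightarrow> complex" where
  "Phi T (Ga a) = cform T vk vk (fr (Inl a))"
| "Phi T (Ze a b) = cform T vk (fr (Inl a)) (fr (Inl b))"
| "Phi T (Ap a b) = cform T (fr (Inl a)) vk (fr (Inl b))"
| "Phi T (Am a b) = cform T (fr (Inr a)) vk (fr (Inl b))"
| "Phi T (Ee a) = cform T vl vk (fr (Inl a))"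
| "Phi T (Gp a b c) = cform T (fr (Inl a)) (fr (Inl b)) (fr (Inl c))"
| "Phi T (Gm a b c) = cform T (fr (Inr a)) (fr (Inl b)) (fr (Inl c))"
| "Phi T (Be a b) = cform T vl (fr (Inl a)) (fr (Inl b))"

text \<open>The element of the Lie algebra of the stabiliser with a scaling \<open>r\<close> of \<open>k\<close>, unitary part \<open>U\<close>
  and null rotation about \<open>k\<close> with parameter \<open>v\<close>.\<close>

definition qmat :: "real \<Rightarrow> ('m::finite \<Rightarrow> 'm \<Rightarrow> complex) \<Rightarrow> ('m \<Rightarrow> complex) \<Rightarrow> real^'m idx^'m idx" where
  "qmat r U v = (\<chi> i j. case (i, j) of
      (Inl b, Inl a) \<Rightarrow> Re (U b a) | (Inl b, Inr (Inl a)) \<Rightarrow> - Im (U b a)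
    | (Inr (Inl b), Inl a) \<Rightarrow> Im (U b a) | (Inr (Inl b), Inr (Inl a)) \<Rightarrow> Re (U b a)
    | (Inl b, Inr (Inr p)) \<Rightarrow> if p then 0 else Re (v b)
    | (Inr (Inl b), Inr (Inr p)) \<Rightarrow> if p then 0 else - Im (v b)
    | (Inr (Inr p), Inl a) \<Rightarrow> if p then - Re (v a) else 0
    | (Inr (Inr p), Inr (Inl a)) \<Rightarrow> if p then Im (v a) else 0
    | (Inr (Inr p), Inr (Inr q)) \<Rightarrow> if p = q then (if p then r else - r) else 0)"

lemma qmat_nth [simp]:
  "qmat r U v $ Inl b $ Inl a = Re (U b a)" "qmat r U v $ Inl b $ Inr (Inl a) = - Im (U b a)"
  "qmat r U v $ Inr (Inl b) $ Inl a = Im (U b a)" "qmat r U v $ Inr (Inl b) $ Inr (Inl a) = Re (U b a)"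
  "qmat r U v $ Inl b $ il = Re (v b)" "qmat r U v $ Inl b $ ik = 0"
  "qmat r U v $ Inr (Inl b) $ il = - Im (v b)" "qmat r U v $ Inr (Inl b) $ ik = 0"
  "qmat r U v $ il $ Inl a = 0" "qmat r U v $ ik $ Inl a = - Re (v a)"
  "qmat r U v $ il $ Inr (Inl a) = 0" "qmat r U v $ ik $ Inr (Inl a) = Im (v a)"
  "qmat r U v $ il $ il = - r" "qmat r U v $ ik $ ik = r" "qmat r U v $ il $ ik = 0" "qmat r U v $ ik $ il = 0"
  by (simp_all add: qmat_def)

lemma cmat_mult_nth: "(cmat A *v v) $ i = (\<Sum>j\<in>UNIV. of_real (A $ i $ j) * v $ j)"
  by (simp add: cmat_def matrix_vector_mult_def)

lemma qmat_so:
  assumes "skewh U"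
  shows "qmat r U v \<in> so_alg"
proof -
  have U: "U a b = - cnj (U b a)" for a b using assms unfolding skewh_def by blast
  have Re: "Re (U a b) + Re (U b a) = 0" and Im: "Im (U a b) = Im (U b a)" for a b
    by (subst U[of a b], simp)+
  let ?X = "qmat r U v"
  have "(transpose ?X ** eta + eta ** ?X) $ i $ j = 0" for i j
  proof -
    have "transpose ?X ** eta = transpose (eta ** ?X)" by (simp add: matrix_transpose_mul)
    then have e: "(transpose ?X ** eta + eta ** ?X) $ i $ j = (eta ** ?X) $ j $ i + (eta ** ?X) $ i $ j"
      by (simp add: transpose_def)
    show ?thesis unfolding e eta_mult
      by (cases i rule: idx_cases; cases j rule: idx_cases)
        (simp_all add: Re Im)
  qed
  then show ?thesis by (simp add: so_alg_def vec_eq_iff)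
qed

lemma qmat_frame:
  "cmat (qmat r U v) *v vk = of_real r *s vk"
  "cmat (qmat r U v) *v fr (Inl a) = (\<Sum>b\<in>UNIV. U b a *s fr (Inl b)) - v a *s vk"
  "cmat (qmat r U v) *v fr (Inr a) = (\<Sum>b\<in>UNIV. cnj (U b a) *s fr (Inr b)) - cnj (v a) *s vk"
  "cmat (qmat r U v) *v vl = - of_real r *s vl
     + (\<Sum>b\<in>UNIV. (cnj (v b) / 2) *s fr (Inl b)) + (\<Sum>b\<in>UNIV. (v b / 2) *s fr (Inr b))"
proof -
  have *: "(\<Sum>a\<in>UNIV. f a * (\<i> * dl b a)) = \<i> * f b" "(\<Sum>a\<in>UNIV. f a * (- (\<i> * dl b a))) = - \<i> * f b"
    "(\<Sum>a\<in>UNIV. f a * (\<i> * dl a b)) = \<i> * f b" "(\<Sum>a\<in>UNIV. f a * (- (\<i> * dl a b))) = - \<i> * f b"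
    for f and b :: "'a"
    using sum_dl(4)[of "\<lambda>a. f a * \<i>" b] sum_dl(4)[of "\<lambda>a. f a * - \<i>" b]
      sum_dl(3)[of "\<lambda>a. f a * \<i>" b] sum_dl(3)[of "\<lambda>a. f a * - \<i>" b] by (simp_all add: ac_simps)
  show "cmat (qmat r U v) *v vk = of_real r *s vk"
    by (rule idx_eqI) (simp_all add: cmat_mult_nth UNIV_idx_sum)
  show "cmat (qmat r U v) *v fr (Inl a) = (\<Sum>b\<in>UNIV. U b a *s fr (Inl b)) - v a *s vk"
    by (rule idx_eqI) (simp_all add: cmat_mult_nth UNIV_idx_sum sum_component sum_negf sum_divide_distrib[symmetric] *, simp_all add: complex_eq_iff)
  show "cmat (qmat r U v) *v fr (Inr a) = (\<Sum>b\<in>UNIV. cnj (U b a) *s fr (Inr b)) - cnj (v a) *s vk"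
    by (rule idx_eqI) (simp_all add: cmat_mult_nth UNIV_idx_sum sum_component sum_negf sum_divide_distrib[symmetric] *, simp_all add: complex_eq_iff)
  show "cmat (qmat r U v) *v vl = - of_real r *s vl
     + (\<Sum>b\<in>UNIV. (cnj (v b) / 2) *s fr (Inl b)) + (\<Sum>b\<in>UNIV. (v b / 2) *s fr (Inr b))"
    by (rule idx_eqI) (simp_all add: cmat_mult_nth UNIV_idx_sum sum_component sum_negf sum_divide_distrib[symmetric] *, simp_all add: complex_eq_iff)
qed

lemma qmat_q:
  assumes "skewh U"
  shows "qmat r U v \<in> q_alg"
proof -
  have "cmat (qmat r U v) *v x \<in> N_model" if x: "x \<in> N_model" for x
  proof -
    have x: "x $ il = 0" "\<And>a. x $ Inr (Inl a) = \<i> * x $ Inl a" using x by (auto simp: N_model_def)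
    show ?thesis unfolding N_model_def
      by (simp add: cmat_mult_nth UNIV_idx_sum x sum_distrib_left sum.distrib[symmetric])
        (simp add: complex_eq_iff algebra_simps)
  qed
  then show ?thesis using qmat_so[OF assms] by (auto simp: q_alg_def)
qed

lemma Phi_bracket:
  assumes T: "T \<in> conn_space" and U: "skewh U"
  shows "Phi (bracket (qmat r U v) T) c = - act r U v (Phi T) c"
proof -
  have lin: "linear T" using T by (simp add: conn_space_def)
  note [simp] = cform_bracket[OF lin qmat_so[OF U]] qmat_frame cform_linear[OF lin] cform_same[OF T]
  have k: "cform T u (fr i) vk = - cform T u vk (fr i)" for u i by (rule cform_anti[OF T])
  show ?thesis
    by (cases c) (simp_all add: k sum.distrib sum_divide_distrib[symmetric] algebra_simps)
qed

lemma cnj_frame [simp]: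
  "cnj_vec (fr (Inl a)) = fr (Inr a)" "cnj_vec (fr (Inr a)) = fr (Inl a)" "cnj_vec vk = vk" "cnj_vec vl = vl"
  by (rule idx_eqI; simp add: cnj_vec_def)+

lemma cform_cnj:
  assumes T: "linear T"
  shows "cform T (cnj_vec u) (cnj_vec v) (cnj_vec w) = cnj (cform T u v w)"
proof -
  have "re_vec (cnj_vec u) = re_vec u" "im_vec (cnj_vec u) = - im_vec u"
    by (simp_all add: re_vec_def im_vec_def cnj_vec_def vec_eq_iff)
  then have "ctensor T (cnj_vec u) $ i $ j = cnj (ctensor T u $ i $ j)" for i j
    by (simp add: ctensor_nth linear_neg[OF T])
  then show ?thesis by (simp add: cform_def cbil_def cnj_vec_def matrix_vector_mult_def)
qed

lemma cbil_vk: "cbil eta v vk = v $ il"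
  and cbil_fr: "cbil eta v (fr (Inl a)) = v $ Inl a - \<i> * v $ Inr (Inl a)"
    "cbil eta v (fr (Inr a)) = v $ Inl a + \<i> * v $ Inr (Inl a)"
proof -
  have *: "(\<Sum>a\<in>UNIV. f a * (\<i> * dl a b)) = \<i> * f b" "(\<Sum>a\<in>UNIV. f a * (- (\<i> * dl a b))) = - \<i> * f b"
    for f and b :: "'a"
    using sum_dl(3)[of "\<lambda>a. f a * \<i>" b] sum_dl(3)[of "\<lambda>a. f a * - \<i>" b] by (simp_all add: ac_simps)
  show "cbil eta v vk = v $ il"
    "cbil eta v (fr (Inl a)) = v $ Inl a - \<i> * v $ Inr (Inl a)"
    "cbil eta v (fr (Inr a)) = v $ Inl a + \<i> * v $ Inr (Inl a)"
    by (simp_all add: cbil_eta * sum_negf)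
qed

text \<open>N is totally null of half the dimension and therefore its own orthogonal complement; it
  is spanned by \<open>vk\<close> and the \<open>fr (Inr b)\<close>.\<close>

lemma N_model_iff: "v \<in> N_model \<longleftrightarrow> cbil eta v vk = 0 \<and> (\<forall>b. cbil eta v (fr (Inr b)) = 0)"
proof -
  have "x + \<i> * y = 0 \<longleftrightarrow> y = \<i> * x" for x y :: complex
    by (auto simp: complex_eq_iff)
  then show ?thesis by (simp add: N_model_def cbil_vk cbil_fr)
qed

lemma N_model_expand:
  assumes "v \<in> N_model"
  shows "v = v $ ik *s vk + (\<Sum>a\<in>UNIV. v $ Inl a *s fr (Inr a))"
proof (rule idx_eqI)
  have v: "v $ il = 0" "\<And>a. v $ Inr (Inl a) = \<i> * v $ Inl a" using assms by (auto simp: N_model_def)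
  have *: "(\<Sum>a\<in>UNIV. f a * (\<i> * dl b a)) = \<i> * f b" for f and b :: "'a"
    using sum_dl(4)[of "\<lambda>a. f a * \<i>" b] by (simp add: ac_simps)
  show "v $ Inl b = (v $ ik *s vk + (\<Sum>a\<in>UNIV. v $ Inl a *s fr (Inr a))) $ Inl b" for b
    by (simp add: sum_component)
  show "v $ Inr (Inl b) = (v $ ik *s vk + (\<Sum>a\<in>UNIV. v $ Inl a *s fr (Inr a))) $ Inr (Inl b)" for b
    by (simp add: sum_component * v)
  show "v $ il = (v $ ik *s vk + (\<Sum>a\<in>UNIV. v $ Inl a *s fr (Inr a))) $ il"
    by (simp add: sum_component v)
  show "v $ ik = (v $ ik *s vk + (\<Sum>a\<in>UNIV. v $ Inl a *s fr (Inr a))) $ ik"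
    by (simp add: sum_component)
qed

text \<open>By \<open>N_model_iff\<close> the values of T have to pair N with itself to zero, and
  these pairings are conjugates of combinations of the components in \<open>Phi\<close>.\<close>

lemma Phi_kernel:
  assumes T: "T \<in> conn_space" and z: "\<And>c. Phi T c = 0"
  shows "T v \<in> q_alg"
proof -
  have lin: "linear T" using T by (simp add: conn_space_def)
  have k: "cform T u vk (fr (Inl a)) = 0" for u a
    using z[of "Ga a"] z[of "Ee a"] z[of "Ap _ a"] z[of "Am _ a"]
    by (subst frame_expand[of u]) (simp add: cform_linear[OF lin])
  have e: "cform T u (fr (Inl a)) (fr (Inl b)) = 0" for u a b
    using z[of "Ze a b"] z[of "Be a b"] z[of "Gp _ a b"] z[of "Gm _ a b"]
    by (subst frame_expand[of u]) (simp add: cform_linear[OF lin])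
  have cc: "cnj_vec (cnj_vec u) = u" for u :: "complex^'a idx" by (simp add: cnj_vec_def vec_eq_iff)
  have k': "cform T u vk (fr (Inr a)) = 0" for u a
    using cform_cnj[OF lin, of "cnj_vec u" vk "fr (Inl a)"] k by (simp add: cc)
  have e': "cform T u (fr (Inr a)) (fr (Inr b)) = 0" for u a b
    using cform_cnj[OF lin, of "cnj_vec u" "fr (Inl a)" "fr (Inl b)"] e by (simp add: cc)
  define u :: "complex^'a idx" where "u = (\<chi> i. of_real (v $ i))"
  have "re_vec u = v" "im_vec u = 0" by (simp_all add: u_def re_vec_def im_vec_def vec_eq_iff)
  then have "ctensor T u $ i $ j = cmat (T v) $ i $ j" for i j
    by (simp add: ctensor_nth cmat_def linear_0[OF lin])
  then have "ctensor T u = cmat (T v)" by (simp add: vec_eq_iff)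
  then have cb: "cbil eta (cmat (T v) *v x) y = cform T u x y" for x y by (simp add: cform_def)
  have "cmat (T v) *v x \<in> N_model" if x: "x \<in> N_model" for x
    unfolding N_model_iff cb
    by (subst (1 2) N_model_expand[OF x])
      (simp add: cform_linear[OF lin] k' e' cform_same[OF T] cform_anti[OF T, of _ _ vk])
  then show ?thesis using T by (auto simp: q_alg_def conn_space_def)
qed

context Q_sub
begin

text \<open>Tensors with the same \<open>Phi\<close> differ by one with values in
  \<open>q_alg\<close> and so have the same class.\<close>

lemma Phi_image:
  assumes x: "x \<in> conn_space" and w: "Phi x \<in> Phi ` Wt"
  shows "x \<in> Wt"
proof -
  obtain T where T: "T \<in> Wt" "Phi x = Phi T" using w by blast
  have D: "(\<lambda>v. x v + (- 1) *\<^sub>R T v) \<in> conn_space" by (intro conn_add conn_scale x Wt_conn T)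
  have P: "Phi (\<lambda>v. x v + (- 1) *\<^sub>R T v) c = Phi x c - Phi T c" for c
    by (cases c) (simp_all only: Phi.simps cform_plus cform_times, simp_all)
  have "x v - T v \<in> q_alg" for v
    using Phi_kernel[OF D, of v] T unfolding P by simp
  then show ?thesis by (intro Wt_cong[OF T(1) x])
qed

end

section \<open>The rescaling classes in components\<close>

text \<open>With a read as a covector, this is the change of the Levi-Civita connection of eta at
  the origin under rescaling by \<open>exp (2 * (a \<bullet> x))\<close>, without its pure trace
  part; see \<open>conn_form_conf\<close>.\<close>

definition conf_tensor :: "real^'m::finite idx \<Rightarrow> 'm tensor" where
  "conf_tensor a u = (\<chi> k j. u $ k * a $ j - (eta *v a) $ k * (eta *v u) $ j)"

lemma cform_conf:
  fixes a :: "real^'m::finite idx"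
  shows "cform (conf_tensor a) u v w
    = (\<Sum>j\<in>UNIV. of_real (a $ j) * v $ j) * cbil eta u w - (\<Sum>j\<in>UNIV. of_real (a $ j) * w $ j) * cbil eta u v"
proof -
  let ?a = "(\<chi> j. of_real (a $ j)) :: complex^'m idx"
  have u: "u $ i = of_real (re_vec u $ i) + \<i> * of_real (im_vec u $ i)" for i
    by (simp add: re_vec_def im_vec_def complex_eq_iff)
  have "(cmat eta *v u) $ i = of_real ((eta *v re_vec u) $ i) + \<i> * of_real ((eta *v im_vec u) $ i)" for i
  proof -
    have "(cmat eta *v u) $ i = re_vec (cmat eta *v u) $ i + \<i> * im_vec (cmat eta *v u) $ i"
      by (simp add: re_vec_def im_vec_def complex_eq_iff)
    then show ?thesis by (simp add: vec_re_im)
  qed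
  moreover have "(cmat eta *v ?a) $ i = of_real ((eta *v a) $ i)" for i
    by (simp add: cmat_def matrix_vector_mult_def)
  ultimately have c: "ctensor (conf_tensor a) u $ i $ j = u $ i * ?a $ j - (cmat eta *v ?a) $ i * (cmat eta *v u) $ j" for i j
    unfolding ctensor_nth u[of i] by (simp add: conf_tensor_def algebra_simps)
  have "ctensor (conf_tensor a) u *v v = cdot ?a v *s u - cbil eta u v *s (cmat eta *v ?a)"
    unfolding cbil_eta_commute[of u v] cbil_cdot[of eta v u]
    by (simp add: vec_eq_iff matrix_vector_mult_def[of "ctensor _ _"] c left_diff_distrib right_diff_distrib sum_subtractf
        cdot_def sum_distrib_left sum_distrib_right ac_simps)
  moreover have "cbil eta (cmat eta *v ?a) w = cdot ?a w"
    by (simp add: cbil_cdot cdot_matrix cmat_transpose[symmetric] matrix_vector_mul_assoc cmat_mul[symmetric])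
  ultimately show ?thesis
    by (simp add: cform_def cbil_simps) (simp add: cdot_def)
qed

text \<open>The factor 1/2 cancels the product 2 of a frame vector with its conjugate.\<close>

lemma Phi_conf_M: "Phi (conf_tensor (axis ik (1/2))) = iM dl"
proof
  have s: "(\<Sum>j\<in>UNIV. of_real (axis ik (1/2) $ j) * v $ j) = v $ ik / 2" for v :: "complex^'a idx"
    by (simp add: UNIV_idx_sum axis_def)
  show "Phi (conf_tensor (axis ik (1/2))) c = iM dl c" for c :: "'a cix"
    by (cases c) (simp_all add: cform_conf s cbil_vk cbil_fr dl_commute)
qed

text \<open>The signs are such that the covector takes the value \<open>- e b\<close> on
  \<open>fr (Inl b)\<close>; it is zero on k and l.\<close>

lemma Phi_conf_EG:
  "Phi (conf_tensor (\<chi> i. case i of Inl b \<Rightarrow> - Re (e b) | Inr (Inl b) \<Rightarrow> Im (e b) | Inr (Inr p) \<Rightarrow> 0))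
    = iEG e (\<lambda>a b c. 2 * dl a b * e c - 2 * dl a c * e b)"
proof
  let ?a = "(\<chi> i. case i of Inl b \<Rightarrow> - Re (e b) | Inr (Inl b) \<Rightarrow> Im (e b) | Inr (Inr p) \<Rightarrow> 0) :: real^'a idx"
  have *: "(\<Sum>a\<in>UNIV. f a * (\<i> * dl a b)) = \<i> * f b" "(\<Sum>a\<in>UNIV. f a * (- (\<i> * dl a b))) = - \<i> * f b"
    for f and b :: "'a"
    using sum_dl(3)[of "\<lambda>a. f a * \<i>" b] sum_dl(3)[of "\<lambda>a. f a * - \<i>" b] by (simp_all add: ac_simps)
  have e: "(\<Sum>j\<in>UNIV. of_real (?a $ j) * fr (Inl b) $ j) = - e b" for b
    by (simp add: UNIV_idx_sum * sum_negf) (simp add: complex_eq_iff)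
  have k: "(\<Sum>j\<in>UNIV. of_real (?a $ j) * vk $ j) = 0"
    by (simp add: UNIV_idx_sum)
  show "Phi (conf_tensor ?a) c = iEG e (\<lambda>a b c. 2 * dl a b * e c - 2 * dl a c * e b) c" for c
    by (cases c) (simp_all only: Phi.simps emb_simps cform_conf e k cbil_vk cbil_fr, simp_all add: dl_commute)
qed

locale conf_sub = Q_sub W for W :: "('m::finite tensor set) set" +
  assumes conf: "\<And>a. conf_tensor a \<in> Wt" and card: "1 < CARD('m)"
begin

sublocale torsion_cmps "Phi ` Wt"
proof
  show "(\<lambda>_. 0) \<in> Phi ` Wt"
  proof (rule image_eqI[of _ _ "\<lambda>v. 0"])
    show "(\<lambda>v. 0) \<in> Wt" by (rule Wt_zero)
    show "(\<lambda>_::'m cix. 0) = Phi (\<lambda>v. 0)"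
    proof
      have "cform (\<lambda>v. 0) u v w = 0" for u v w :: "complex^'m idx"
        using cform_times[of 0 "\<lambda>_. 0"] by simp
      then show "0 = Phi (\<lambda>v. 0) c" for c :: "'m cix" by (cases c) simp_all
    qed
  qed
next
  fix w w' assume "w \<in> Phi ` Wt" "w' \<in> Phi ` Wt"
  then obtain S T where ST: "S \<in> Wt" "T \<in> Wt" "w = Phi S" "w' = Phi T" by blast
  show "(\<lambda>c. w c + w' c) \<in> Phi ` Wt"
  proof (rule image_eqI[of _ _ "\<lambda>v. S v + T v"])
    show "(\<lambda>v. S v + T v) \<in> Wt" by (intro Wt_add ST)
    show "(\<lambda>c. w c + w' c) = Phi (\<lambda>v. S v + T v)"
    proof
      show "w c + w' c = Phi (\<lambda>v. S v + T v) c" for c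
        unfolding ST by (cases c) (simp_all add: cform_plus)
    qed
  qed
next
  fix w r assume "w \<in> Phi ` Wt"
  then obtain T where T: "T \<in> Wt" "w = Phi T" by blast
  show "(\<lambda>c. of_real r * w c) \<in> Phi ` Wt"
  proof (rule image_eqI[of _ _ "\<lambda>v. r *\<^sub>R T v"])
    show "(\<lambda>v. r *\<^sub>R T v) \<in> Wt" by (intro Wt_scale T)
    show "(\<lambda>c. of_real r * w c) = Phi (\<lambda>v. r *\<^sub>R T v)"
    proof
      show "of_real r * w c = Phi (\<lambda>v. r *\<^sub>R T v) c" for c
        unfolding T by (cases c) (simp_all add: cform_times)
    qed
  qed
next
  fix w r and U :: "'m \<Rightarrow> 'm \<Rightarrow> complex" and v assume "w \<in> Phi ` Wt" and U: "skewh U"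
  then obtain T where T: "T \<in> Wt" "w = Phi T" by blast
  show "act r U v w \<in> Phi ` Wt"
  proof (rule image_eqI[of _ _ "\<lambda>x. (- 1) *\<^sub>R bracket (qmat r U v) T x"])
    show "(\<lambda>x. (- 1) *\<^sub>R bracket (qmat r U v) T x) \<in> Wt"
      by (intro Wt_scale Wt_bracket qmat_q U T)
    show "act r U v w = Phi (\<lambda>x. (- 1) *\<^sub>R bracket (qmat r U v) T x)"
    proof
      fix c
      have "Phi (\<lambda>x. (- 1) *\<^sub>R bracket (qmat r U v) T x) c = - Phi (bracket (qmat r U v) T) c"
        by (cases c) (simp_all only: Phi.simps cform_times, simp_all)
      then show "act r U v w c = Phi (\<lambda>x. (- 1) *\<^sub>R bracket (qmat r U v) T x) c"
        using Phi_bracket[OF Wt_conn[OF T(1)] U] T by simp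
    qed
  qed
next
  fix w a b c assume "w \<in> Phi ` Wt"
  then obtain T where T: "T \<in> conn_space" "w = Phi T" using Wt_conn by blast
  show "w (Ze a b) = - w (Ze b a)" "w (Gp a b c) = - w (Gp a c b)"
    "w (Gm a b c) = - w (Gm a c b)" "w (Be a b) = - w (Be b a)"
    unfolding T(2) Phi.simps by (rule cform_anti[OF T(1)])+
next
  show "iM dl \<in> Phi ` Wt" unfolding Phi_conf_M[symmetric] by (intro imageI conf)
  show "iEG e (\<lambda>a b c. 2 * dl a b * e c - 2 * dl a c * e b) \<in> Phi ` Wt" for e
    unfolding Phi_conf_EG[symmetric] by (intro imageI conf)
qed (rule card)

end

section \<open>Translation of the defining components into tuples\<close>

lemma h_low_simps: "h_low (Inl a) (Inl b) = 0" "h_low (Inr a) (Inr b) = 0"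
  "h_low (Inl a) (Inr b) = 2 * dl a b" "h_low (Inr a) (Inl b) = 2 * dl a b"
  by (simp_all add: h_low_def cbil_fr dl_commute)

lemma h_up_simps: "h_up (Inl a) (Inl b) = 0" "h_up (Inr a) (Inr b) = 0"
  "h_up (Inl a) (Inr b) = dl a b / 2" "h_up (Inr a) (Inl b) = dl a b / 2"
  by (simp_all add: h_up_def dl_def)

lemma UNIV_sum_sum:
  fixes f :: "'m::finite + 'm \<Rightarrow> 'a::comm_monoid_add"
  shows "(\<Sum>i\<in>UNIV. f i) = (\<Sum>a\<in>UNIV. f (Inl a)) + (\<Sum>a\<in>UNIV. f (Inr a))"
  by (simp add: UNIV_Plus_UNIV[symmetric] sum.Plus del: UNIV_Plus_UNIV)

lemma kappa_cbil: "kappa v = v $ il"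
  unfolding kappa_def cbil_eta_commute[of vk v] cbil_vk ..

lemma screen_J_nth [simp]:
  "screen_J $ Inl a $ Inl b = 0" "screen_J $ Inl a $ Inr (Inl b) = (if a = b then - 1 else 0)"
  "screen_J $ Inr (Inl a) $ Inl b = (if a = b then 1 else 0)" "screen_J $ Inr (Inl a) $ Inr j = 0"
  "screen_J $ Inr (Inr p) $ j' = 0" "screen_J $ Inl a $ Inr (Inr p) = 0"
  by (simp_all add: screen_J_def split: sum.split)

lemma omega_eta: "omega v w = (\<Sum>a\<in>UNIV. v $ Inl a * w $ Inr (Inl a) - v $ Inr (Inl a) * w $ Inl a)"
proof -
  have "(cmat screen_J *v v) $ Inl a = - v $ Inr (Inl a)" "(cmat screen_J *v v) $ Inr (Inl a) = v $ Inl a"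
    "(cmat screen_J *v v) $ Inr (Inr p) = 0" for a p
    by (simp_all add: cmat_mult_nth UNIV_idx_sum if_distrib[where f = complex_of_real]
      if_distrib[where f = "\<lambda>x. x * _"] cong: if_cong)
  then show ?thesis by (simp add: omega_def cbil_eta sum_subtractf sum_negf)
qed

lemma omega_fr: "omega v (fr (Inl a)) = - \<i> * cbil eta v (fr (Inl a))"
  "omega (fr (Inl a)) v = \<i> * cbil eta v (fr (Inl a))" "omega v (fr (Inr a)) = \<i> * cbil eta v (fr (Inr a))"
  and omega_l: "omega v vl = 0" "omega vl v = 0"
proof -
  have *: "(\<Sum>a\<in>UNIV. f a * (\<i> * dl a b)) = \<i> * f b" "(\<Sum>a\<in>UNIV. f a * (- (\<i> * dl a b))) = - \<i> * f b"
    "(\<Sum>a\<in>UNIV. \<i> * dl a b * f a) = \<i> * f b" "(\<Sum>a\<in>UNIV. \<i> * (dl a b * f a)) = \<i> * f b"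
    for f and b :: "'a"
    using sum_dl(1)[of b "\<lambda>a. \<i> * f a"] sum_dl(3)[of "\<lambda>a. f a * \<i>" b] sum_dl(3)[of "\<lambda>a. f a * - \<i>" b] by (simp_all add: ac_simps)
  show "omega v (fr (Inl a)) = - \<i> * cbil eta v (fr (Inl a))"
    "omega (fr (Inl a)) v = \<i> * cbil eta v (fr (Inl a))" "omega v (fr (Inr a)) = \<i> * cbil eta v (fr (Inr a))"
    by (simp_all add: omega_eta cbil_fr * sum_subtractf sum_negf sum.distrib algebra_simps)
  show "omega v vl = 0" "omega vl v = 0" by (simp_all add: omega_eta)
qed

locale conn_tensor =
  fixes T :: "'m::finite tensor"
  assumes T: "T \<in> conn_space" and card: "1 < CARD('m)"
begin

abbreviation w where "w \<equiv> Phi T"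

lemma lin: "linear T"
  using T by (simp add: conn_space_def)

lemma nabla_kappa_cform: "nabla_kappa T u v = cform T u vk v"
proof -
  have "nabla_kappa T u v = - cform T u v vk"
    by (simp add: nabla_kappa_def kappa_cbil cform_def cbil_vk)
  then show ?thesis using cform_anti[OF T, of u v vk] by simp
qed

text \<open>With l in the last place, \<open>kappa\<close> is 1 on l, while \<open>omega\<close>
  vanishes on l and on two unbarred frame vectors, so one term survives for each of
  \<open>fr (Inl b)\<close> and \<open>fr (Inl c)\<close>. Both carry the eigenvalue
  \<open>\<i>\<close> of J, and they agree by skewness.\<close>

lemma nabla_rho_cform: "nabla_rho T u (fr (Inl b)) (fr (Inl c)) vl = 2 * \<i> * cform T u (fr (Inl b)) (fr (Inl c))"
proof -
  have "nabla_rho T u (fr (Inl b)) (fr (Inl c)) vl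
    = \<i> * cform T u (fr (Inl b)) (fr (Inl c)) - \<i> * cform T u (fr (Inl c)) (fr (Inl b))"
    by (simp add: nabla_rho_def rho_def kappa_cbil omega_fr omega_l cform_def cbil_fr)
  then show ?thesis unfolding cform_anti[OF T, of u "fr (Inl c)"] by simp
qed

lemma cA: "c_A T (Inl a) (Inl b) = w (Ap a b)" "c_A T (Inr a) (Inl b) = w (Am a b)"
  "c_A T (Inl a) (Inr b) = cnj (w (Am a b))" "c_A T (Inr a) (Inr b) = cnj (w (Ap a b))"
  by (simp_all add: c_A_def nabla_kappa_cform cform_cnj[OF lin, symmetric])

lemma gam_iff: "(\<forall>i. c_gamma T i = 0) \<longleftrightarrow> P_gam w"
proof -
  have "c_gamma T (Inr a) = cnj (c_gamma T (Inl a))" for a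
    by (simp add: c_gamma_def nabla_kappa_cform cform_cnj[OF lin, symmetric])
  moreover have "c_gamma T (Inl a) = w (Ga a)" for a by (simp add: c_gamma_def nabla_kappa_cform)
  ultimately show ?thesis by (simp add: split_sum_all P_gam_def)
qed

lemma gam_l: "c_gamma T (Inl a) = w (Ga a)"
  by (simp add: c_gamma_def nabla_kappa_cform)

lemma comps: "c_E T (Inl a) = w (Ee a)" "c_zeta T a b = 2 * \<i> * w (Ze a b)"
  "c_G T (Inl a) b c = 2 * \<i> * w (Gp a b c)" "c_G T (Inr a) b c = 2 * \<i> * w (Gm a b c)"
  "c_B T a b = 2 * \<i> * w (Be a b)"
  by (simp_all add: c_E_def c_zeta_def c_G_def c_B_def nabla_kappa_cform nabla_rho_cform)

lemma tau_ab: "c_tau T (Inl a) (Inl b) = (w (Ap a b) - w (Ap b a)) / 2"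
  by (simp add: c_tau_def cA)

lemma sigma_ab: "c_sigma T (Inl a) (Inl b) = (w (Ap a b) + w (Ap b a)) / 2"
  "c_sigma T (Inr a) (Inr b) = cnj (w (Ap a b) + w (Ap b a)) / 2"
  by (simp_all add: c_sigma_def cA h_low_simps)

lemma eps: "c_eps T = (\<Sum>a\<in>UNIV. cnj (w (Am a a)) + w (Am a a)) / 2"
  by (simp add: c_eps_def UNIV_sum_sum h_up_simps cA sum.distrib sum_divide_distrib[symmetric] add_divide_distrib
      del: Phi.simps)

lemma sigma_mixed: "c_sigma T (Inl a) (Inr b) = (tfM w b a + cnj (tfM w a b)) / 2"
  "c_sigma T (Inr a) (Inl b) = (tfM w a b + cnj (tfM w b a)) / 2"
  by (simp_all add: c_sigma_def cA h_low_simps eps tfM_def sum.distrib dl_commute[of b a] cnj_sum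
      add_divide_distrib diff_divide_distrib algebra_simps del: Phi.simps)

lemma tau_free: "c_tau_free T a b = (cnj (tfM w a b) - tfM w b a) / 2"
proof -
  have "(\<Sum>c\<in>UNIV. \<Sum>d\<in>UNIV. h_up (Inl c) (Inr d) * c_tau T (Inl c) (Inr d))
    = (\<Sum>c\<in>UNIV. cnj (w (Am c c)) - w (Am c c)) / 4"
    by (simp add: h_up_simps c_tau_def cA sum_divide_distrib[symmetric] del: Phi.simps)
  then have e: "c_tau_free T a b = c_tau T (Inl a) (Inr b)
      - h_low (Inl a) (Inr b) / of_nat CARD('m) * ((\<Sum>c\<in>UNIV. cnj (w (Am c c)) - w (Am c c)) / 4)"
    unfolding c_tau_free_def by (simp only:)
  show ?thesis unfolding e
    by (simp add: c_tau_def cA h_low_simps tfM_def sum_subtractf dl_commute[of b a] cnj_sum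
      add_divide_distrib diff_divide_distrib algebra_simps del: Phi.simps)
qed

lemma tau_omega: "c_tau_omega T = - of_real (Im (\<Sum>a\<in>UNIV. w (Am a a)))"
proof -
  have o: "omega_up (Inl a) (Inl b) = 0" "omega_up (Inr a) (Inr b) = 0"
    "omega_up (Inl a) (Inr b) = - \<i> / 2 * dl a b" "omega_up (Inr a) (Inl b) = \<i> / 2 * dl a b" for a b :: 'm
    by (simp_all add: omega_up_def UNIV_sum_sum h_up_simps omega_fr cbil_fr sum_divide_distrib[symmetric] mult.assoc
       sum_distrib_left[symmetric] dl_commute sum_negf)
  have "c_tau_omega T = (\<Sum>a\<in>UNIV. - \<i> / 2 * c_tau T (Inl a) (Inr a)) + (\<Sum>a\<in>UNIV. \<i> / 2 * c_tau T (Inr a) (Inl a))"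
    by (simp add: c_tau_omega_def UNIV_sum_sum o mult.assoc sum_distrib_left[symmetric] sum_negf
        sum_divide_distrib[symmetric])
  also have "\<dots> = (\<Sum>a\<in>UNIV. - of_real (Im (w (Am a a))))"
    unfolding sum.distrib[symmetric]
    by (intro sum.cong refl) (simp add: c_tau_def cA complex_eq_iff del: Phi.simps)
  finally show ?thesis by (simp add: sum_negf del: Phi.simps)
qed

lemma G_trace: "c_G_trace T a = \<i> * trG w a"
  by (simp add: c_G_trace_def h_up_simps comps trG_def sum_divide_distrib[symmetric] sum_distrib_left[symmetric]
      del: Phi.simps)

lemma G_free: "c_G_free T a b c = 2 * \<i> * tfG w a b c"
  by (simp add: c_G_free_def comps tfG_def G_trace h_low_simps dl_commute[of _ a] right_diff_distrib del: Phi.simps)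

lemma w_anti: "w (Ze a b) = - w (Ze b a)" "w (Gp a b c) = - w (Gp a c b)"
    "w (Gm a b c) = - w (Gm a c b)" "w (Be a b) = - w (Be b a)"
  unfolding Phi.simps by (rule cform_anti[OF T])+

lemma sk_iff: "(\<forall>a b c. c_G_sk T a b c = 0) \<longleftrightarrow> (\<forall>a b c. w (Gp a b c) + w (Gp b c a) + w (Gp c a b) = 0)"
proof -
  have e: "c_G_sk T a b c = 2 * \<i> / 3 * (w (Gp a b c) + w (Gp b c a) + w (Gp c a b))" for a b c
    unfolding c_G_sk_def comps w_anti(2)[of a c b] w_anti(2)[of b a c] w_anti(2)[of c b a]
    by (simp add: field_simps)
  show ?thesis unfolding e mult_eq_0_iff by (simp del: Phi.simps)
qed

text \<open>Adding the instances at a, b, c and b, a, c of the hook condition gives three times the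
  part of \<open>Gp\<close> symmetric in the first two indices, up to a constant.\<close>

lemma hk_iff: "(\<forall>a b c. c_G_hk T a b c = 0) \<longleftrightarrow> (\<forall>a b c. w (Gp a b c) + w (Gp b a c) = 0)"
proof -
  have e: "c_G_hk T a b c = 2 * \<i> / 3 * (2 * w (Gp a b c) + w (Gp b a c) - w (Gp c a b))" for a b c
    unfolding c_G_hk_def comps w_anti(2)[of a c b] by (simp add: field_simps)
  show ?thesis
  proof
    assume "\<forall>a b c. c_G_hk T a b c = 0"
    then have z: "2 * w (Gp a b c) + w (Gp b a c) - w (Gp c a b) = 0" for a b c
      unfolding e by simp
    show "\<forall>a b c. w (Gp a b c) + w (Gp b a c) = 0"
    proof (intro allI)
      fix a b c
      have "3 * (w (Gp a b c) + w (Gp b a c)) = (2 * w (Gp a b c) + w (Gp b a c) - w (Gp c a b))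
          + (2 * w (Gp b a c) + w (Gp a b c) - w (Gp c b a))"
        unfolding w_anti(2)[of c b a] by simp
      also have "\<dots> = 0" unfolding z by simp
      finally show "w (Gp a b c) + w (Gp b a c) = 0" unfolding mult_eq_0_iff by simp
    qed
  next
    assume h: "\<forall>a b c. w (Gp a b c) + w (Gp b a c) = 0"
    have s: "w (Gp b a c) = - w (Gp a b c)" for a b c
      using h[rule_format, of a b c] by (simp add: add_eq_0_iff del: Phi.simps)
    have "2 * w (Gp a b c) + w (Gp b a c) - w (Gp c a b) = 0" for a b c
    proof -
      have "w (Gp c a b) = w (Gp a b c)" using s[of c a b] w_anti(2)[of a c b] by (simp del: Phi.simps)
      then show ?thesis using s[of a b c] by (simp del: Phi.simps)
    qed
    then show "\<forall>a b c. c_G_hk T a b c = 0" unfolding e by simp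
  qed
qed

lemma sig_iff: "(\<forall>a b. c_sigma T (Inl a) (Inl b) = 0) \<longleftrightarrow> (\<forall>a b. w (Ap a b) + w (Ap b a) = 0)"
  by (simp add: sigma_ab del: Phi.simps)

lemma M_iff: "(\<forall>a b. c_tau_free T a b = 0) \<and> (\<forall>a b. c_sigma T (Inl a) (Inr b) = 0) \<longleftrightarrow> P_M w"
proof -
  have e: "tfM w b a = c_sigma T (Inl a) (Inr b) - c_tau_free T a b" for a b
    by (simp add: sigma_mixed tau_free diff_divide_distrib[symmetric] del: Phi.simps)
  show ?thesis
  proof
    assume "(\<forall>a b. c_tau_free T a b = 0) \<and> (\<forall>a b. c_sigma T (Inl a) (Inr b) = 0)"
    then show "P_M w" unfolding P_M_def e by simp
  next
    assume "P_M w"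
    then show "(\<forall>a b. c_tau_free T a b = 0) \<and> (\<forall>a b. c_sigma T (Inl a) (Inr b) = 0)"
      by (simp add: P_M_def sigma_mixed tau_free del: Phi.simps)
  qed
qed

lemma sig_M_iff: "(\<forall>a b. c_tau_free T a b = 0) \<and> (\<forall>i j. c_sigma T i j = 0)
    \<longleftrightarrow> P_M w \<and> (\<forall>a b. w (Ap a b) + w (Ap b a) = 0)"
proof -
  have "c_sigma T (Inr a) (Inl b) = c_sigma T (Inl b) (Inr a)" for a b
    by (simp add: sigma_mixed add.commute del: Phi.simps)
  moreover have "c_sigma T (Inr a) (Inr b) = cnj (c_sigma T (Inl a) (Inl b))" for a b
    by (simp add: sigma_ab del: Phi.simps)
  ultimately have "(\<forall>i j. c_sigma T i j = 0) \<longleftrightarrow>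
      (\<forall>a b. c_sigma T (Inl a) (Inl b) = 0) \<and> (\<forall>a b. c_sigma T (Inl a) (Inr b) = 0)"
    by (auto simp: split_sum_all)
  then show ?thesis using M_iff sig_iff by blast
qed

end

context conn_tensor
begin

lemma om_iff: "c_tau_omega T = 0 \<and> (\<forall>i. c_gamma T i = 0) \<longleftrightarrow> P_om w"
  unfolding gam_iff P_om_def tau_omega neg_equal_0_iff_equal of_real_eq_0_iff by blast

lemma sigP_iff: "(\<forall>a b. c_sigma T (Inl a) (Inl b) = 0) \<and> (\<forall>i. c_gamma T i = 0) \<longleftrightarrow> P_sig w"
  unfolding gam_iff P_sig_def sig_iff by blast

lemma xy_iff: "(\<forall>a b. of_real x * c_sigma T (Inl a) (Inr b) - \<i> * of_real y * c_tau_free T a b = 0)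
    \<and> (\<forall>i. c_gamma T i = 0) \<longleftrightarrow> P_xy x y w"
proof -
  have "of_real x * c_sigma T (Inl a) (Inr b) - \<i> * of_real y * c_tau_free T a b
    = (of_real x * (tfM w b a + cnj (tfM w a b)) + \<i> * of_real y * (tfM w b a - cnj (tfM w a b))) / 2" for a b
    unfolding sigma_mixed tau_free by (simp add: field_simps)
  then show ?thesis unfolding gam_iff P_xy_def by auto
qed

lemma zw_iff: "(\<forall>a b. z * c_tau T (Inl a) (Inl b) + v * c_zeta T a b = 0)
    \<and> (\<forall>a. (z + 4 * \<i> * v) * c_gamma T (Inl a) = 0) \<longleftrightarrow> P_zw z (2 * \<i> * v) w"
  unfolding P_zw_def tau_ab comps gam_l by (simp add: mult.assoc mult.left_commute[of v] del: Phi.simps)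

text \<open>When \<open>Ap\<close> is skew, \<tau> on unbarred indices is \<open>Ap\<close> itself,
  and \<zeta> is \<open>2 * \<i>\<close> times \<open>Ze\<close>.\<close>

lemma zeta_comb:
  assumes "\<And>a b. w (Ap a b) + w (Ap b a) = 0"
  shows "2 * k * \<i> * c_tau T (Inl a) (Inl b) + c_zeta T a b = 0 \<longleftrightarrow> k * w (Ap a b) + w (Ze a b) = 0"
proof -
  have s: "w (Ap b a) = - w (Ap a b)" using assms[of a b] by (simp add: add_eq_0_iff del: Phi.simps)
  have "2 * k * \<i> * c_tau T (Inl a) (Inl b) + c_zeta T a b = 2 * \<i> * (k * w (Ap a b) + w (Ze a b))"
    unfolding tau_ab comps s by (simp add: algebra_simps)
  then show ?thesis by (simp del: Phi.simps)
qed

lemma skP_iff: "(\<forall>a b c. c_G_sk T a b c = 0) \<and> (\<forall>a b. - 4 * \<i> * c_tau T (Inl a) (Inl b) + c_zeta T a b = 0)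
    \<longleftrightarrow> P_sk w"
proof -
  have "- 4 * \<i> * c_tau T (Inl a) (Inl b) + c_zeta T a b = - 2 * \<i> * (w (Ap a b) - w (Ap b a) - w (Ze a b))" for a b
    unfolding tau_ab comps by (simp add: field_simps)
  then have "- 4 * \<i> * c_tau T (Inl a) (Inl b) + c_zeta T a b = 0 \<longleftrightarrow> w (Ap a b) - w (Ap b a) = w (Ze a b)" for a b
    by (simp del: Phi.simps)
  then show ?thesis unfolding P_sk_def sk_iff by blast
qed

lemma hkP_iff: "(\<forall>a b c. c_G_hk T a b c = 0) \<and> (\<forall>a b. 2 * \<i> * c_tau T (Inl a) (Inl b) + c_zeta T a b = 0)
    \<and> (\<forall>a b. c_sigma T (Inl a) (Inl b) = 0) \<and> (\<forall>i. c_gamma T i = 0) \<longleftrightarrow> P_hk w"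
  unfolding P_hk_def hk_iff gam_iff sig_iff P_sig_def using zeta_comb[of 1] by auto

lemma tfG_iff: "(\<forall>a b c. c_G_free T a b c = 0) \<longleftrightarrow> (\<forall>a b c. tfG w a b c = 0)"
  unfolding G_free by simp

lemma zeta_iff: "(\<forall>a b. c_zeta T a b = 0) \<longleftrightarrow> (\<forall>a b. w (Ze a b) = 0)"
  unfolding comps by (simp del: Phi.simps)

lemma G0P_iff: "(\<forall>a b c. c_G_free T a b c = 0) \<and> (\<forall>a b. c_tau_free T a b = 0)
    \<and> (\<forall>a b. c_sigma T (Inl a) (Inr b) = 0) \<and> (\<forall>a b. c_zeta T a b = 0) \<and> (\<forall>i. c_gamma T i = 0) \<longleftrightarrow> P_G0 w"
  unfolding P_G0_def tfG_iff zeta_iff gam_iff M_iff[symmetric] by blast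

lemma E_iff: "2 * (of_nat CARD('m) - 1) * \<i> * c_E T (Inl a) - c_G_trace T a = 0
    \<longleftrightarrow> 2 * (of_nat CARD('m) - 1) * w (Ee a) = trG w a"
proof -
  have "2 * (of_nat CARD('m) - 1) * \<i> * c_E T (Inl a) - c_G_trace T a
    = \<i> * (2 * (of_nat CARD('m) - 1) * w (Ee a) - trG w a)"
    unfolding comps G_trace by (simp add: algebra_simps)
  then show ?thesis by (simp del: Phi.simps)
qed

lemma EGP_iff: "(\<forall>a. 2 * (of_nat CARD('m) - 1) * \<i> * c_E T (Inl a) - c_G_trace T a = 0)
    \<and> (\<forall>a b. 2 * (of_nat CARD('m) - 1) * \<i> * c_tau T (Inl a) (Inl b) + c_zeta T a b = 0)
    \<and> (\<forall>a b. c_tau_free T a b = 0) \<and> (\<forall>i j. c_sigma T i j = 0) \<and> (\<forall>i. c_gamma T i = 0) \<longleftrightarrow> P_EG w"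
proof -
  have "(\<forall>a b. c_tau_free T a b = 0) \<and> (\<forall>i j. c_sigma T i j = 0) \<and> (\<forall>i. c_gamma T i = 0) \<longleftrightarrow> P_M w \<and> P_sig w"
    using sig_M_iff unfolding P_sig_def gam_iff by blast
  moreover have "P_sig w \<Longrightarrow> 2 * (of_nat CARD('m) - 1) * \<i> * c_tau T (Inl a) (Inl b) + c_zeta T a b = 0
      \<longleftrightarrow> (of_nat CARD('m) - 1) * w (Ap a b) + w (Ze a b) = 0" for a b
    by (rule zeta_comb) (simp add: P_sig_def del: Phi.simps)
  ultimately show ?thesis unfolding P_EG_def E_iff by blast
qed

lemma B_iff: "(\<forall>a b. c_B T a b = 0) \<longleftrightarrow> (\<forall>a b. w (Be a b) = 0)"
  unfolding comps by (simp del: Phi.simps)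

lemma BP_iff2:
  assumes m: "CARD('m) = 2"
  shows "(\<forall>a b. c_B T a b = 0) \<and> (\<forall>a. 2 * \<i> * c_E T (Inl a) - c_G_trace T a = 0)
     \<and> (\<forall>a b c. c_G_hk T a b c = 0) \<and> (\<forall>a b. 2 * \<i> * c_tau T (Inl a) (Inl b) + c_zeta T a b = 0)
     \<and> (\<forall>a b. c_tau_free T a b = 0) \<and> (\<forall>i j. c_sigma T i j = 0) \<and> (\<forall>i. c_gamma T i = 0) \<longleftrightarrow> P_B w"
proof -
  have 1: "of_nat CARD('m) - 1 = (1::complex)" using m by simp
  have "\<not> 2 < CARD('m)" using m by simp
  then have "P_B w \<longleftrightarrow> (\<forall>a b. w (Be a b) = 0) \<and> P_EG w \<and> P_hk w" by (simp add: P_B_def del: Phi.simps)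
  then show ?thesis unfolding B_iff[symmetric] EGP_iff[symmetric] hkP_iff[symmetric] 1 mult_1_right by blast
qed

lemma BP_iff:
  assumes m: "CARD('m) \<noteq> 2"
  shows "(\<forall>a b. c_B T a b = 0) \<and> (\<forall>a. 2 * (of_nat CARD('m) - 1) * \<i> * c_E T (Inl a) - c_G_trace T a = 0)
     \<and> (\<forall>a b c. c_G_sk T a b c = 0) \<and> (\<forall>a b c. c_G_hk T a b c = 0) \<and> (\<forall>a b c. c_G_free T a b c = 0)
     \<and> (\<forall>a b. c_tau T (Inl a) (Inl b) = 0) \<and> (\<forall>a b. c_tau_free T a b = 0) \<and> (\<forall>i j. c_sigma T i j = 0)
     \<and> (\<forall>a b. c_zeta T a b = 0) \<and> (\<forall>i. c_gamma T i = 0) \<longleftrightarrow> P_B w" (is "?L \<longleftrightarrow> _")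
proof -
  have "2 < CARD('m)" using m card by simp
  then have B: "P_B w \<longleftrightarrow> (\<forall>a b. w (Be a b) = 0) \<and> P_EG w \<and> P_hk w \<and> P_sk w \<and> P_G0 w"
    by (simp add: P_B_def del: Phi.simps)
  show ?thesis
  proof
    assume L: ?L
    \<comment> \<open>As \<tau> on unbarred indices and \<zeta> vanish, so do their combinations in
      the other conditions.\<close>
    then have "\<forall>a b. 2 * (of_nat CARD('m) - 1) * \<i> * c_tau T (Inl a) (Inl b) + c_zeta T a b = 0"
      "\<forall>a b. 2 * \<i> * c_tau T (Inl a) (Inl b) + c_zeta T a b = 0"
      "\<forall>a b. - 4 * \<i> * c_tau T (Inl a) (Inl b) + c_zeta T a b = 0"
      by simp_all
    with L show "P_B w"
      unfolding B B_iff[symmetric] EGP_iff[symmetric] hkP_iff[symmetric] skP_iff[symmetric] G0P_iff[symmetric]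
      by (elim conjE, intro conjI) (assumption | blast)+
  next
    assume "P_B w"
    then have R: "(\<forall>a b. w (Be a b) = 0)" "P_EG w" "P_hk w" "P_sk w" "P_G0 w" unfolding B by blast+
    \<comment> \<open>\<open>P_G0\<close> makes \<open>Ze\<close> vanish, and then
      \<open>P_sk\<close> makes \<open>Ap\<close> symmetric.\<close>
    have "c_tau T (Inl a) (Inl b) = 0" for a b
      using R(4,5) unfolding tau_ab P_sk_def P_G0_def by (simp del: Phi.simps)
    with R show ?L
      unfolding B_iff[symmetric] EGP_iff[symmetric] hkP_iff[symmetric] skP_iff[symmetric] G0P_iff[symmetric]
      by (elim conjE, intro conjI) (assumption | blast)+
  qed
qed

end

section \<open>The distinguished submodules\<close>

definition CP :: "(('m::finite cix \<Rightarrow> complex) \<Rightarrow> bool) \<Rightarrow> ('m tensor set) set" where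
  "CP P = cut (\<lambda>T. P (Phi T))"

lemma cut_CP: "(\<And>T. T \<in> conn_space \<Longrightarrow> Q T \<longleftrightarrow> P (Phi T)) \<Longrightarrow> cut Q = CP P"
  unfolding CP_def cut_def torsion_module_def torsion_class_def by blast

lemma CP_distinguished:
  assumes m: "1 < CARD('m::finite)"
  shows "CP (P_gam :: ('m cix \<Rightarrow> complex) \<Rightarrow> bool) \<in> distinguished_submodules"
    "CP (P_om :: ('m cix \<Rightarrow> complex) \<Rightarrow> bool) \<in> distinguished_submodules"
    "CP (P_sig :: ('m cix \<Rightarrow> complex) \<Rightarrow> bool) \<in> distinguished_submodules"
    "(x, y) \<noteq> (0, 0) \<Longrightarrow> CP (P_xy x y :: ('m cix \<Rightarrow> complex) \<Rightarrow> bool) \<in> distinguished_submodules"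
    "(p, q) \<noteq> (0, 0) \<Longrightarrow> CP (P_zw p q :: ('m cix \<Rightarrow> complex) \<Rightarrow> bool) \<in> distinguished_submodules"
    "2 < CARD('m) \<Longrightarrow> CP (P_sk :: ('m cix \<Rightarrow> complex) \<Rightarrow> bool) \<in> distinguished_submodules"
    "CP (P_hk :: ('m cix \<Rightarrow> complex) \<Rightarrow> bool) \<in> distinguished_submodules"
    "2 < CARD('m) \<Longrightarrow> CP (P_G0 :: ('m cix \<Rightarrow> complex) \<Rightarrow> bool) \<in> distinguished_submodules"
    "CP (P_EG :: ('m cix \<Rightarrow> complex) \<Rightarrow> bool) \<in> distinguished_submodules"
    "CP (P_B :: ('m cix \<Rightarrow> complex) \<Rightarrow> bool) \<in> distinguished_submodules"
proof -
  have c: "T \<in> conn_space \<Longrightarrow> conn_tensor T" for T :: "'m tensor" using m by unfold_locales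
  have d1: "{S_m2_00, S_m1_10, S_m1_11, S_m1_12, S_m1_20, S_m1_21, S_m1_30,
      S_0_11, S_0_12, S_0_13, S_0_0x1, S_1_00 :: ('m tensor set) set} \<subseteq> distinguished_submodules"
    unfolding distinguished_submodules_def by blast
  show "CP (P_gam :: ('m cix \<Rightarrow> complex) \<Rightarrow> bool) \<in> distinguished_submodules"
    using d1 cut_CP[where P = P_gam, OF conn_tensor.gam_iff[OF c]] unfolding S_m2_00_def by simp
  show "CP (P_om :: ('m cix \<Rightarrow> complex) \<Rightarrow> bool) \<in> distinguished_submodules"
    using d1 cut_CP[where P = P_om, OF conn_tensor.om_iff[OF c]] unfolding S_m1_10_def by simp
  show "CP (P_sig :: ('m cix \<Rightarrow> complex) \<Rightarrow> bool) \<in> distinguished_submodules"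
    using d1 cut_CP[where P = P_sig, OF conn_tensor.sigP_iff[OF c]] unfolding S_m1_21_def by simp
  show "CP (P_hk :: ('m cix \<Rightarrow> complex) \<Rightarrow> bool) \<in> distinguished_submodules"
    using d1 cut_CP[where P = P_hk, OF conn_tensor.hkP_iff[OF c]] unfolding S_0_12_def by simp
  show "CP (P_EG :: ('m cix \<Rightarrow> complex) \<Rightarrow> bool) \<in> distinguished_submodules"
    using d1 cut_CP[where P = P_EG, OF conn_tensor.EGP_iff[OF c]] unfolding S_0_0x1_def by simp
  show "CP (P_sk :: ('m cix \<Rightarrow> complex) \<Rightarrow> bool) \<in> distinguished_submodules" if "2 < CARD('m)"
    using d1 cut_CP[where P = P_sk, OF conn_tensor.skP_iff[OF c]] that unfolding S_0_11_def by simp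
  show "CP (P_G0 :: ('m cix \<Rightarrow> complex) \<Rightarrow> bool) \<in> distinguished_submodules" if "2 < CARD('m)"
    using d1 cut_CP[where P = P_G0, OF conn_tensor.G0P_iff[OF c]] that unfolding S_0_13_def by simp
  show "CP (P_B :: ('m cix \<Rightarrow> complex) \<Rightarrow> bool) \<in> distinguished_submodules"
  proof (cases "CARD('m) = 2")
    case True
    then show ?thesis using d1 cut_CP[where P = P_B, OF conn_tensor.BP_iff2[OF c True]] unfolding S_1_00_def by simp
  next
    case False
    then show ?thesis using d1 cut_CP[where P = P_B, OF conn_tensor.BP_iff[OF c False]] unfolding S_1_00_def by simp
  qed
  show "CP (P_xy x y :: ('m cix \<Rightarrow> complex) \<Rightarrow> bool) \<in> distinguished_submodules" if "(x, y) \<noteq> (0, 0)"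
  proof -
    have "CP (P_xy x y :: ('m cix \<Rightarrow> complex) \<Rightarrow> bool) = S_m1_1x2 x y"
      unfolding S_m1_1x2_def by (rule cut_CP[where P = "P_xy x y", OF conn_tensor.xy_iff[OF c], symmetric])
    then show ?thesis using that unfolding distinguished_submodules_def
      by (intro UnI1 UnI2 CollectI exI conjI)
  qed
  show "CP (P_zw p q :: ('m cix \<Rightarrow> complex) \<Rightarrow> bool) \<in> distinguished_submodules" if "(p, q) \<noteq> (0, 0)"
  proof -
    \<comment> \<open>The second parameter is divided by \<open>2 * \<i>\<close>, the ratio of
      \<zeta> to \<open>Ze\<close>.\<close>
    have "CP (P_zw p q :: ('m cix \<Rightarrow> complex) \<Rightarrow> bool) = S_m1_1x3 p (q / (2 * \<i>))"
      using cut_CP[where P = "P_zw p (2 * \<i> * (q / (2 * \<i>)))", OF conn_tensor.zw_iff[OF c]] unfolding S_m1_1x3_def by simp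
    moreover have "(p, q / (2 * \<i>)) \<noteq> (0, 0)" using that by simp
    ultimately show ?thesis unfolding distinguished_submodules_def
      by (intro UnI2 CollectI exI conjI)
  qed
qed

context conf_sub
begin

lemma sub_CP: "(\<forall>w\<in>Phi ` Wt. P w) \<Longrightarrow> W \<subseteq> CP P"
proof
  fix C assume P: "\<forall>w\<in>Phi ` Wt. P w" and C: "C \<in> W"
  then have "C \<in> torsion_module" using W by (auto simp: Q_submodule_def)
  moreover have "P (Phi T)" if "T \<in> C" for T
  proof -
    obtain T0 where "C = torsion_class T0" using C W_Wt by blast
    then have "torsion_class T = C" "T \<in> conn_space"
      using that in_class_eq by (blast, simp add: torsion_class_def)
    then show ?thesis using P C by (simp add: Wt_def)
  qed
  ultimately show "C \<in> CP P" by (simp add: CP_def cut_def)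
qed

text \<open>The family consists of all distinguished submodules containing W. As it may be empty,
  \<open>torsion_module\<close> is intersected explicitly.\<close>

lemma eq_Inter_distinguished: "W = torsion_module \<inter> \<Inter> {S \<in> distinguished_submodules. W \<subseteq> S}"
proof
  show "W \<subseteq> torsion_module \<inter> \<Inter> {S \<in> distinguished_submodules. W \<subseteq> S}"
    using W by (auto simp: Q_submodule_def)
  show "torsion_module \<inter> \<Inter> {S \<in> distinguished_submodules. W \<subseteq> S} \<subseteq> W"
  proof
    fix C assume C: "C \<in> torsion_module \<inter> \<Inter> {S \<in> distinguished_submodules. W \<subseteq> S}"
    then obtain x where x: "x \<in> conn_space" "C = torsion_class x" by (auto simp: torsion_module_def)
    have xC: "x \<in> C" using self_in_class x by blast
    have t: "P (Phi x)" if "CP P \<in> distinguished_submodules" "\<forall>w\<in>Phi ` Wt. P w" for P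
    proof -
      have "C \<in> CP P" using C sub_CP[OF that(2)] that(1) by blast
      then show ?thesis using xC by (simp add: CP_def cut_def)
    qed
    interpret x: conn_tensor x using x card by unfold_locales
    note d = CP_distinguished[OF card]
    \<comment> \<open>The symmetry assumptions of \<open>classification\<close> are
      \<open>x.w_anti\<close>. The others pass a condition from W to x, which is \<open>t\<close>;
      \<open>d\<close> identifies the condition as a distinguished one.\<close>
    have "Phi x \<in> Phi ` Wt"
      by (rule classification; (rule x.w_anti | rule t; (rule d)?; assumption?))
    then have "x \<in> Wt" by (rule Phi_image[OF x(1)])
    then show "C \<in> W" using x W_Wt by blast
  qed
qed

end

section \<open>Conformal changes of the flat model\<close>

lemma Ck_const: "Ck_on k S (\<lambda>x. c)"
  by (induction k arbitrary: c) (simp_all add: frechet_derivative_const differentiable_on_def)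

lemma smooth_const: "smooth_on S (\<lambda>x. c)"
  by (simp add: smooth_on_def Ck_const)

lemma smooth_id: "smooth_on S (\<lambda>x. x)"
proof -
  have "Ck_on k S (\<lambda>x. x)" for k
    by (cases k) (simp_all add: Ck_const frechet_derivative_ident continuous_on_id differentiable_on_id)
  then show ?thesis by (simp add: smooth_on_def)
qed

lemma exp_scaled_derivative:
  fixes b :: "'a::real_inner" and C :: "'b::real_normed_vector"
  shows "((\<lambda>x. exp (b \<bullet> x) *\<^sub>R C) has_derivative (\<lambda>v. (exp (b \<bullet> x) * (b \<bullet> v)) *\<^sub>R C)) (at x within S)"
  by (auto intro!: derivative_eq_intros simp: ac_simps)

lemma frechet_exp:
  fixes b :: "'a::real_inner" and C :: "'b::real_normed_vector"
  shows "frechet_derivative (\<lambda>x. exp (b \<bullet> x) *\<^sub>R C) (at x) v = exp (b \<bullet> x) *\<^sub>R ((b \<bullet> v) *\<^sub>R C)"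
  using frechet_derivative_at[OF exp_scaled_derivative[of b C x UNIV]] by (metis scaleR_scaleR)

text \<open>Each directional derivative has the same form with another constant C, hence the
  induction over all C.\<close>

lemma smooth_exp:
  fixes b :: "'a::real_inner" and C :: "'b::real_normed_vector"
  shows "smooth_on S (\<lambda>x. exp (b \<bullet> x) *\<^sub>R C)"
proof -
  have "Ck_on k S (\<lambda>x. exp (b \<bullet> x) *\<^sub>R C)" for k
  proof (induction k arbitrary: C)
    case 0
    show ?case by (simp, intro continuous_intros)
  next
    case (Suc k)
    have "(\<lambda>x. exp (b \<bullet> x) *\<^sub>R C) differentiable_on S"
      unfolding differentiable_on_def differentiable_def using exp_scaled_derivative by blast
    then show ?case using Suc by (simp add: frechet_exp del: scaleR_scaleR)
  qed
  then show ?thesis by (simp add: smooth_on_def)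
qed

text \<open>The flat model: the conformal class of the constant metric on the model space itself, with the
  constant almost Robinson structure.  Its chart is global, so all conditions on overlaps are void.\<close>

definition flat :: "(real^'m::finite idx, 'm) robinson_data" where
  "flat = \<lparr>points = euclidean, atlas = {(UNIV, id)}, future = (\<lambda>_ _. axis ik 1 - axis il 1),
    conf_class = {g'. \<exists>f. (\<forall>p. f p > 0) \<and> smooth_on UNIV f \<and> (\<forall>x. g' (UNIV, id) x = f x *\<^sub>R eta)},
    Ndist = (\<lambda>_ _. N_model), Kdist = (\<lambda>_ _. span {axis ik 1})\<rparr>"

lemma flat_simps [simp]:
  "points flat = euclidean" "atlas flat = {(UNIV, id)}" "future flat = (\<lambda>_ _. axis ik 1 - axis il 1)"
  "Ndist flat = (\<lambda>_ _. N_model)" "Kdist flat = (\<lambda>_ _. span {axis ik 1})"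
  by (simp_all add: flat_def)

lemma flat_conf: "g \<in> conf_class flat \<longleftrightarrow>
    (\<exists>f. (\<forall>p. f p > 0) \<and> smooth_on UNIV f \<and> (\<forall>x. g (UNIV, id) x = f x *\<^sub>R eta))"
  by (simp add: flat_def)

lemma transition_flat [simp]: "transition (UNIV, id) (UNIV, id) = (\<lambda>x. x)"
  by (simp add: transition_def fun_eq_iff)

lemma jac_flat [simp]: "jac (UNIV, id) (UNIV, id) p = mat 1"
proof -
  have "frechet_derivative (\<lambda>x. x) (at (id p)) = id"
    by (rule ext) (simp add: frechet_derivative_ident)
  then show ?thesis by (simp add: jac_def matrix_id_mat_1)
qed

lemma flat_oriented: "oriented_manifold flat"
proof -
  have "second_countable (euclidean :: (real^'a idx) topology)"
  proof -
    obtain B :: "(real^'a idx) set set" where B: "countable B" "topological_basis B"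
      using ex_countable_basis by blast
    then show ?thesis unfolding second_countable_def
      by (intro exI[of _ B]) (auto simp: topological_basis_open elim!: topological_basisE)
  qed
  then show ?thesis
    by (simp add: oriented_manifold_def smooth_id det_I)
qed

lemma flat_conformal: "conformal_structure (flat :: (real^'m::finite idx, 'm) robinson_data)"
  unfolding conformal_structure_def
proof (intro exI conjI)
  have P: "\<exists>P. invertible P \<and> transpose P ** (eta :: real^'m idx^'m idx) ** P = (eta :: real^'m idx^'m idx)"
  proof (intro exI conjI)
    show "invertible (mat 1 :: real^'m idx^'m idx)" by (metis invertible_def matrix_mul_lid)
    show "transpose (mat 1) ** eta ** mat 1 = (eta :: real^'m idx^'m idx)" by (simp add: transpose_mat)
  qed
  show "lorentzian_metric (flat :: (real^'m idx, 'm) robinson_data) (\<lambda>_ _. eta)"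
    using P by (simp add: lorentzian_metric_def smooth_const transpose_mat)
  show "conf_class (flat :: (real^'m idx, 'm) robinson_data) = {g'. conformally_related flat (\<lambda>_ _. eta) g'}"
    by (rule set_eqI) (simp add: flat_conf conformally_related_def)
qed

lemma t_norm: "(axis ik 1 - axis il 1) \<bullet> (eta *v (axis ik 1 - axis il 1)) = (-2 :: real)"
  by (simp add: inner_vec_def matrix_vector_mult_def UNIV_idx_sum axis_def)

lemma flat_time: "time_orientation flat"
  unfolding time_orientation_def
  by (auto simp: smooth_const flat_conf scaleR_matrix_vector_assoc[symmetric] t_norm mult_less_0_iff)

lemma N_dim: "vec.dim (N_model :: (complex^'m::finite idx) set) = CARD('m) + 1"
  and N_basis: "\<exists>n. (N_model :: (complex^'m idx) set) = vec.span (n ` {..CARD('m)})"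
proof -
  let ?f = "\<lambda>a::'m. fr (Inr a) :: complex^'m idx"
  let ?B = "insert vk (range ?f)"
  have inj: "inj ?f"
  proof (rule injI)
    fix a b assume "?f a = ?f b"
    then have "?f a $ Inl a = ?f b $ Inl a" by simp
    then show "a = b" by (simp add: dl_def split: if_splits)
  qed
  have nin: "vk \<notin> range ?f"
  proof
    assume "vk \<in> range ?f"
    then obtain a where "vk = ?f a" by blast
    then have "(vk :: complex^'m idx) $ ik = ?f a $ ik" by simp
    then show False by simp
  qed
  have card: "card ?B = CARD('m) + 1" using nin inj by (simp add: card_image)
  have span: "vec.span ?B = N_model"
  proof
    have "vk \<in> N_model" "?f a \<in> N_model" for a by (simp_all add: N_model_def)
    then show "vec.span ?B \<subseteq> N_model" by (intro vec.span_minimal N_subspace) auto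
    show "N_model \<subseteq> vec.span ?B"
    proof
      fix v :: "complex^'m idx" assume "v \<in> N_model"
      then have v: "v = v $ ik *s vk + (\<Sum>a\<in>UNIV. v $ Inl a *s ?f a)" by (rule N_model_expand)
      have "v $ ik *s vk \<in> vec.span ?B" by (rule vec.span_scale[OF vec.span_base]) simp
      moreover have "(\<Sum>a\<in>UNIV. v $ Inl a *s ?f a) \<in> vec.span ?B"
        by (rule vec.span_sum, rule vec.span_scale[OF vec.span_base]) simp
      ultimately have "v $ ik *s vk + (\<Sum>a\<in>UNIV. v $ Inl a *s ?f a) \<in> vec.span ?B"
        by (rule vec.span_add)
      then show "v \<in> vec.span ?B" by (rule back_subst[where P = "\<lambda>z. z \<in> vec.span ?B", OF _ v[symmetric]])
    qed
  qed
  have ind: "vec.independent ?B"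
  proof (rule vec.independent_if_scalars_zero)
    fix f x assume s: "(\<Sum>x\<in>?B. f x *s x) = 0" and x: "x \<in> ?B"
    have e: "f vk *s vk + (\<Sum>a\<in>UNIV. f (?f a) *s ?f a) = 0"
      using s nin by (simp add: sum.reindex[OF inj])
    have "(f vk *s vk + (\<Sum>a\<in>UNIV. f (?f a) *s ?f a)) $ ik = f vk" by (simp add: sum_component)
    moreover have "(f vk *s vk + (\<Sum>a\<in>UNIV. f (?f a) *s ?f a)) $ Inl b = f (?f b)" for b
      by (simp add: sum_component)
    ultimately show "f x = 0" using x unfolding e by auto
  qed simp
  show "vec.dim (N_model :: (complex^'m idx) set) = CARD('m) + 1"
    using vec.dim_span_eq_card_independent[OF ind] by (simp add: span card)
  obtain n where "bij_betw n {0..<card ?B} ?B" using ex_bij_betw_nat_finite[of ?B] by auto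
  moreover have "{0..<card ?B} = {..CARD('m)}" unfolding card by auto
  ultimately have "n ` {..CARD('m)} = ?B" by (simp add: bij_betw_def)
  then show "\<exists>n. (N_model :: (complex^'m idx) set) = vec.span (n ` {..CARD('m)})" using span by metis
qed

lemma K_iff: "w \<in> span {axis ik (1::real)} \<longleftrightarrow> (\<forall>a. w $ Inl a = 0) \<and> (\<forall>a. w $ Inr (Inl a) = 0) \<and> w $ il = 0"
proof
  assume "w \<in> span {axis ik 1}"
  then obtain k where "w = k *\<^sub>R axis ik 1" by (auto simp: span_singleton)
  then show "(\<forall>a. w $ Inl a = 0) \<and> (\<forall>a. w $ Inr (Inl a) = 0) \<and> w $ il = 0" by (simp add: axis_def)
next
  assume w: "(\<forall>a. w $ Inl a = 0) \<and> (\<forall>a. w $ Inr (Inl a) = 0) \<and> w $ il = 0"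
  have "w $ i = ((w $ ik) *\<^sub>R axis ik 1) $ i" for i
    by (cases i rule: idx_cases) (use w in \<open>simp_all add: axis_def\<close>)
  then have w': "w = (w $ ik) *\<^sub>R axis ik 1" unfolding vec_eq_iff by blast
  have "(w $ ik) *\<^sub>R axis ik 1 \<in> span {axis ik 1}" by (rule span_scale[OF span_base]) simp
  then show "w \<in> span {axis ik 1}"
    by (rule back_subst[where P = "\<lambda>z. z \<in> span {axis ik 1}", OF _ w'[symmetric]])
qed

text \<open>A vector lies in N and in its conjugate when its screen coordinates satisfy both
  \<open>y = \<i> * x\<close> and \<open>y = - \<i> * x\<close> and its l-coordinate is zero, which
  leaves the multiples of k.\<close>

lemma KN: "{v. re_vec v \<in> span {axis ik 1} \<and> im_vec v \<in> span {axis ik 1}} = N_model \<inter> cnj_vec ` N_model"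
proof (intro set_eqI iffI)
  fix v :: "complex^'a idx"
  have cc: "cnj_vec (cnj_vec v) = v" by (simp add: cnj_vec_def vec_eq_iff)
  {
    assume "v \<in> {v. re_vec v \<in> span {axis ik 1} \<and> im_vec v \<in> span {axis ik 1}}"
    then have "v $ Inl a = 0" "v $ Inr (Inl a) = 0" "v $ il = 0" for a
      by (simp_all add: K_iff re_vec_def im_vec_def complex_eq_iff)
    then have "v \<in> N_model" "cnj_vec v \<in> N_model" by (simp_all add: N_model_def cnj_vec_def)
    then show "v \<in> N_model \<inter> cnj_vec ` N_model" using cc by (metis IntI imageI)
  next
    assume "v \<in> N_model \<inter> cnj_vec ` N_model"
    then obtain u where u: "v \<in> N_model" "u \<in> N_model" "v = cnj_vec u" by blast
    have 1: "v $ il = 0" "v $ Inr (Inl a) = \<i> * v $ Inl a" for a using u by (auto simp: N_model_def)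
    have 2: "v $ Inr (Inl a) = - \<i> * v $ Inl a" for a using u by (simp add: N_model_def cnj_vec_def)
    have "v $ Inl a = 0" "v $ Inr (Inl a) = 0" for a
      using 1(2)[of a] 2[of a] by (simp_all add: complex_eq_iff)
    then show "v \<in> {v. re_vec v \<in> span {axis ik 1} \<and> im_vec v \<in> span {axis ik 1}}"
      using 1 by (simp add: K_iff re_vec_def im_vec_def)
  }
qed

lemma N_null:
  assumes "v \<in> N_model" "w \<in> N_model"
  shows "cbil (r *\<^sub>R eta) v w = 0"
proof -
  have s: "cbil (r *\<^sub>R eta) v w = of_real r * cbil eta v w"
    by (simp add: cbil_def sum_distrib_left mult.assoc)
  have "cbil eta v (\<Sum>a\<in>I. f a) = (\<Sum>a\<in>I. cbil eta v (f a))" if "finite I" for I and f :: "'a \<Rightarrow> _"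
    using that by (induction I rule: finite_induct) (simp_all add: cbil_simps, simp add: cbil_def)
  then have "cbil eta v w = 0"
    using assms(1) by (subst N_model_expand[OF assms(2)]) (simp add: cbil_simps N_model_iff)
  then show ?thesis by (simp add: s)
qed

lemma flat_robinson: "almost_robinson (flat :: (real^'m::finite idx, 'm) robinson_data)"
proof -
  obtain n :: "nat \<Rightarrow> complex^'m idx" where n: "N_model = vec.span (n ` {..CARD('m)})" using N_basis by blast
  have 1: "\<exists>V n. open V \<and> x \<in> V \<and> (\<forall>j\<le>CARD('m). smooth_on V (n j)) \<and>
      (\<forall>y\<in>V. N_model = vec.span ((\<lambda>j. n j y :: complex^'m idx) ` {..CARD('m)}))" for x :: "real^'m idx"
    using n by (intro exI[of _ UNIV] exI[of _ "\<lambda>j _. n j"]) (simp add: smooth_const)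
  have 2: "\<exists>V k. open V \<and> x \<in> V \<and> smooth_on V k \<and> (\<forall>y\<in>V. span {axis ik 1} = span {k y :: real^'m idx})"
    for x :: "real^'m idx"
    by (intro exI[of _ UNIV] exI[of _ "\<lambda>_. axis ik 1"]) (simp add: smooth_const)
  have 3: "dim (span {axis ik 1 :: real^'m idx}) = 1"
    by (simp add: axis_eq_0_iff dim_insert)
  have 4: "cbil (g (UNIV, id) x) v w = 0"
    if "g \<in> conf_class flat" "v \<in> N_model" "w \<in> N_model" for g :: "(real^'m idx, 'm) metric_field" and x v w
    using that N_null[OF that(2,3)] by (auto simp: flat_conf)
  show ?thesis
    unfolding almost_robinson_def using N_subspace N_dim 1 2 3 4 KN by simp
qed

lemma flat_manifold: "almost_conformal_robinson_manifold flat"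
  by (simp add: almost_conformal_robinson_manifold_def flat_oriented flat_conformal flat_time flat_robinson)

section \<open>Torsion of the flat metric and of its rescalings\<close>

text \<open>Used with \<psi> running through the linear equations that define N.\<close>

lemma linear_zero_derivative:
  fixes F :: "'a::euclidean_space \<Rightarrow> 'b::euclidean_space" and \<psi> :: "'b \<Rightarrow> 'c::euclidean_space"
  assumes F: "(F has_derivative D) (at x)" and \<psi>: "linear \<psi>" and V: "open V" "x \<in> V"
    and z: "\<And>y. y \<in> V \<Longrightarrow> \<psi> (F y) = 0"
  shows "\<psi> (D w) = 0"
proof -
  have "((\<lambda>y. \<psi> (F y)) has_derivative (\<lambda>w. \<psi> (D w))) (at x)"
    by (rule bounded_linear.has_derivative[OF _ F]) (use \<psi> in \<open>simp add: linear_conv_bounded_linear\<close>)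
  moreover have "((\<lambda>y. \<psi> (F y)) has_derivative (\<lambda>w. 0)) (at x)"
    by (rule has_derivative_transform_within_open[OF has_derivative_const V]) (simp add: z)
  ultimately have "(\<lambda>w. \<psi> (D w)) = (\<lambda>w. 0)" by (rule has_derivative_unique)
  then show ?thesis by meson
qed

lemma has_derivative_matrix_mult:
  fixes A :: "'a::real_normed_vector \<Rightarrow> real^'n::finite^'k::finite" and B :: "'a \<Rightarrow> real^'p::finite^'n"
  assumes "(A has_derivative A') (at x within S)" "(B has_derivative B') (at x within S)"
  shows "((\<lambda>y. A y ** B y) has_derivative (\<lambda>h. A x ** B' h + A' h ** B x)) (at x within S)"
proof -
  have "bilinear (\<lambda>(A :: real^'n^'k) (B :: real^'p^'n). A ** B)"
    by (auto simp: bilinear_def matrix_add_ldistrib matrix_add_rdistrib' matrix_scaleR_left matrix_scaleR_right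
        intro!: linearI)
  then show ?thesis using bounded_bilinear.FDERIV[OF _ assms] bilinear_conv_bounded_bilinear by blast
qed

text \<open>The frame field takes values in the group preserving eta and N, so its logarithmic
  derivative lies in the Lie algebra; the two defining conditions are differentiated
  separately.\<close>

lemma conn_form_flat:
  fixes F :: "real^'m::finite idx \<Rightarrow> real^'m idx^'m idx"
  assumes V: "open V" "x \<in> V" and F: "F differentiable (at x)"
    and orth: "\<And>y. y \<in> V \<Longrightarrow> transpose (F y) ** eta ** F y = eta"
    and N: "\<And>y. y \<in> V \<Longrightarrow> (*v) (cmat (F y)) ` N_model = N_model"
  shows "matrix_inv (F x) ** frechet_derivative F (at x) w \<in> q_alg"
proof -
  let ?D = "frechet_derivative F (at x)" and ?P = "F x"
  have D: "(F has_derivative ?D) (at x)" using F frechet_derivative_works by blast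
  have lt: "linear (transpose :: real^'m idx^'m idx \<Rightarrow> _)"
    by (rule linearI) (simp_all add: transpose_add transpose_scaleR)
  have Dt: "((\<lambda>y. transpose (F y)) has_derivative (\<lambda>w. transpose (?D w))) (at x)"
    by (rule bounded_linear.has_derivative[OF _ D]) (use lt in \<open>simp add: linear_conv_bounded_linear\<close>)
  from has_derivative_matrix_mult[OF has_derivative_matrix_mult[OF Dt has_derivative_const[of eta]] D]
  have E: "((\<lambda>y. transpose (F y) ** eta ** F y) has_derivative
      (\<lambda>w. transpose ?P ** eta ** ?D w + transpose (?D w) ** eta ** ?P)) (at x)"
    by (simp add: matrix_matrix_mult_def[of _ 0] matrix_mul_assoc)
  have "((\<lambda>y. transpose (F y) ** eta ** F y) has_derivative (\<lambda>w. 0)) (at x)"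
    by (rule has_derivative_transform_within_open[OF has_derivative_const[of eta] V]) (simp add: orth)
  with E have "(\<lambda>w. transpose ?P ** eta ** ?D w + transpose (?D w) ** eta ** ?P) = (\<lambda>w. 0)"
    by (rule has_derivative_unique)
  then have so: "transpose ?P ** eta ** ?D w + transpose (?D w) ** eta ** ?P = 0" by meson
  have "(eta ** transpose ?P ** eta) ** ?P = eta ** (transpose ?P ** eta ** ?P)"
    by (simp add: matrix_mul_assoc)
  then have "(eta ** transpose ?P ** eta) ** ?P = mat 1" using orth[OF V(2)] by simp
  then have P1: "?P ** (eta ** transpose ?P ** eta) = mat 1" using matrix_left_right_inverse by blast
  then have inv: "?P ** matrix_inv ?P = mat 1" "matrix_inv ?P ** ?P = mat 1"
    using matrix_inv_eqI[OF P1] matrix_left_right_inverse[of ?P] by auto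
  define A where "A = matrix_inv ?P ** ?D w"
  have PA: "?D w = ?P ** A" by (simp add: A_def matrix_mul_assoc inv)
  have "transpose A ** (transpose ?P ** eta ** ?P) + (transpose ?P ** eta ** ?P) ** A = 0"
    using so unfolding PA matrix_transpose_mul by (simp add: matrix_mul_assoc add.commute)
  then have Aso: "A \<in> so_alg" using orth[OF V(2)] by (simp add: so_alg_def)
  have DN: "cmat (?D w) *v n \<in> N_model" if n: "n \<in> N_model" for n
  proof -
    have l: "linear (\<lambda>M :: real^'m idx^'m idx. cbil eta (cmat M *v n) z)" for z
      by (rule linearI) (simp_all add: cmat_add matrix_vector_mult_add_rdistrib cmat_scaleR cbil_simps scaleR_conv_of_real[of _ "cbil _ _ _"])
    have "cmat (F y) *v n \<in> N_model" if "y \<in> V" for y using N[OF that] n by blast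
    then have "cbil eta (cmat (F y) *v n) vk = 0" "cbil eta (cmat (F y) *v n) (fr (Inr b)) = 0" if "y \<in> V" for y b
      using that by (simp_all add: N_model_iff)
    then have "cbil eta (cmat (?D w) *v n) vk = 0" "cbil eta (cmat (?D w) *v n) (fr (Inr b)) = 0" for b
      by (intro linear_zero_derivative[OF D l V]; simp)+
    then show ?thesis by (simp add: N_model_iff)
  qed
  have "cmat A *v n \<in> N_model" if n: "n \<in> N_model" for n
  proof -
    obtain z where z: "z \<in> N_model" "cmat (?D w) *v n = cmat ?P *v z"
      using DN[OF n] N[OF V(2)] by blast
    have "cmat A *v n = cmat (matrix_inv ?P) *v (cmat ?P *v z)"
      unfolding A_def cmat_mul_vec z(2) ..
    also have "\<dots> = z" by (simp add: cmat_mul_vec[symmetric] inv)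
    finally show ?thesis using z by simp
  qed
  then show ?thesis using Aso by (auto simp: q_alg_def A_def)
qed

lemma christoffel_const: "christoffel (\<lambda>_. G) x v = 0"
  by (simp add: christoffel_def Let_def frechet_derivative_const vec_eq_iff)

lemma smooth_differentiable: "smooth_on V F \<Longrightarrow> open V \<Longrightarrow> x \<in> V \<Longrightarrow> F differentiable (at x)"
proof -
  assume "smooth_on V F" and V: "open V" "x \<in> V"
  then have "Ck_on (Suc 0) V F" unfolding smooth_on_def by blast
  then have "F differentiable_on V" by simp
  then show ?thesis using V by (simp add: differentiable_on_eq_differentiable_at)
qed

text \<open>At the origin the conformal factor is 1 and has gradient \<open>2 *\<^sub>R b\<close>;
  this is the usual formula for a conformally flat metric.\<close>

lemma christoffel_conf:
  "christoffel (\<lambda>x. exp ((2 *\<^sub>R b) \<bullet> x) *\<^sub>R eta) 0 v $ k $ j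
    = (b \<bullet> v) * (if k = j then 1 else 0) + v $ k * b $ j - (eta *v b) $ k * (eta *v v) $ j"
proof -
  have inv: "matrix_inv eta = (eta :: real^'a idx^'a idx)" by (rule matrix_inv_eqI) simp
  have D: "frechet_derivative (\<lambda>x. exp ((2 *\<^sub>R b) \<bullet> x) *\<^sub>R eta) (at 0) w = (2 * (b \<bullet> w)) *\<^sub>R eta" for w
    by (subst frechet_exp) simp
  have sym: "eta $ i $ l = (eta $ l $ i :: real)" for i l :: "'a idx"
    using arg_cong[OF transpose_eta, of "\<lambda>A. A $ l $ i"] by (simp add: transpose_def)
  have ee: "(\<Sum>l\<in>UNIV. eta $ k $ l * eta $ l $ j) = (if k = j then 1 else 0 :: real)"
    using arg_cong[OF eta_eta, of "\<lambda>A. A $ k $ j"] by (simp add: matrix_matrix_mult_def mat_def)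
  have ev: "(\<Sum>l\<in>UNIV. eta $ k $ l * (\<Sum>i\<in>UNIV. eta $ l $ i * v $ i)) = v $ k"
  proof -
    have "(eta *v (eta *v v)) $ k = v $ k" by (simp add: matrix_vector_mul_assoc)
    then show ?thesis by (simp add: matrix_vector_mult_def)
  qed
  have aux: "(\<Sum>l\<in>I. e l * (c * f l + d * h l - b l * y))
      = c * (\<Sum>l\<in>I. e l * f l) + d * (\<Sum>l\<in>I. e l * h l) - (\<Sum>l\<in>I. e l * b l) * y"
    for e f h b :: "'i \<Rightarrow> real" and c d y I
    unfolding sum_distrib_left sum_distrib_right sum.distrib[symmetric] sum_subtractf[symmetric]
    by (intro sum.cong refl) (simp add: algebra_simps)
  have "christoffel (\<lambda>x. exp ((2 *\<^sub>R b) \<bullet> x) *\<^sub>R eta) 0 v $ k $ j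
    = 1/2 * (\<Sum>l\<in>UNIV. eta $ k $ l * (\<Sum>i\<in>UNIV. v $ i *
       (2 * b $ i * eta $ j $ l + 2 * b $ j * eta $ i $ l - 2 * b $ l * eta $ i $ j)))"
    by (simp only: christoffel_def Let_def D) (simp add: inv inner_axis)
  also have "\<dots> = (\<Sum>l\<in>UNIV. eta $ k $ l * ((\<Sum>i\<in>UNIV. b $ i * v $ i) * eta $ l $ j
      + b $ j * (\<Sum>i\<in>UNIV. eta $ l $ i * v $ i) - b $ l * (\<Sum>i\<in>UNIV. eta $ j $ i * v $ i)))"
    unfolding sum_distrib_left sum_distrib_right sum.distrib[symmetric] sum_subtractf[symmetric]
  proof (intro sum.cong refl)
    fix l i
    show "1/2 * (eta $ k $ l * (v $ i * (2 * b $ i * eta $ j $ l + 2 * b $ j * eta $ i $ l - 2 * b $ l * eta $ i $ j)))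
      = eta $ k $ l * (b $ i * v $ i * eta $ l $ j + b $ j * (eta $ l $ i * v $ i) - b $ l * (eta $ j $ i * v $ i))"
      by (simp add: sym[of j l] sym[of i l] sym[of i j] algebra_simps)
  qed
  also have "\<dots> = (\<Sum>i\<in>UNIV. b $ i * v $ i) * (\<Sum>l\<in>UNIV. eta $ k $ l * eta $ l $ j)
      + b $ j * (\<Sum>l\<in>UNIV. eta $ k $ l * (\<Sum>i\<in>UNIV. eta $ l $ i * v $ i))
      - (\<Sum>l\<in>UNIV. eta $ k $ l * b $ l) * (\<Sum>i\<in>UNIV. eta $ j $ i * v $ i)"
    by (rule aux)
  finally show ?thesis unfolding ee ev
    by (simp add: matrix_vector_mult_def inner_vec_def mult.commute)
qed

text \<open>The frame is the standard one divided by the root of the conformal factor. Its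
  derivative contributes \<open>- (b \<bullet> u)\<close> times the identity and cancels the pure
  trace part of the Christoffel symbols.\<close>

lemma conn_form_conf:
  "conn_form (\<lambda>x. exp ((2 *\<^sub>R b) \<bullet> x) *\<^sub>R eta) (\<lambda>x. exp ((- b) \<bullet> x) *\<^sub>R mat 1) 0 = conf_tensor b"
proof
  fix u :: "real^'a idx"
  have "matrix_inv (mat 1 :: real^'a idx^'a idx) = mat 1" by (rule matrix_inv_eqI) simp
  then have "conn_form (\<lambda>x. exp ((2 *\<^sub>R b) \<bullet> x) *\<^sub>R eta) (\<lambda>x. exp ((- b) \<bullet> x) *\<^sub>R mat 1) 0 u
    = (- (b \<bullet> u)) *\<^sub>R mat 1 + christoffel (\<lambda>x. exp ((2 *\<^sub>R b) \<bullet> x) *\<^sub>R eta) 0 u"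
    unfolding conn_form_def frechet_exp by simp
  then have "conn_form (\<lambda>x. exp ((2 *\<^sub>R b) \<bullet> x) *\<^sub>R eta) (\<lambda>x. exp ((- b) \<bullet> x) *\<^sub>R mat 1) 0 u $ k $ j
    = conf_tensor b u $ k $ j" for k j
    by (simp only: vector_add_component vector_scaleR_component christoffel_conf conf_tensor_def
        vec_lambda_beta mat_def real_scaleR_def)
  then show "conn_form (\<lambda>x. exp ((2 *\<^sub>R b) \<bullet> x) *\<^sub>R eta) (\<lambda>x. exp ((- b) \<bullet> x) *\<^sub>R mat 1) 0 u = conf_tensor b u"
    unfolding vec_eq_iff by blast
qed

lemma conf_tensor_conn: "conf_tensor a \<in> conn_space"
proof -
  have l: "linear (conf_tensor a)"
    by (rule linearI) (simp_all add: conf_tensor_def vec_eq_iff algebra_simps matrix_vector_right_distrib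
        matrix_vector_mult_scaleR)
  have "conf_tensor a u \<in> so_alg" for u
  proof -
    let ?A = "conf_tensor a u"
    have ea: "(eta *v x) $ Inl b = x $ Inl b" "(eta *v x) $ Inr (Inl b) = x $ Inr (Inl b)"
      "(eta *v x) $ Inr (Inr p) = x $ Inr (Inr (\<not> p))" for x :: "real^'a idx" and b p
      by (cases p; simp add: matrix_vector_mult_def UNIV_idx_sum if_distrib[where f = "\<lambda>x. x * _"] cong: if_cong)+
    have "(transpose ?A ** eta + eta ** ?A) $ i $ j = 0" for i j
    proof -
      have "transpose ?A ** eta = transpose (eta ** ?A)" by (simp add: matrix_transpose_mul)
      then have e: "(transpose ?A ** eta + eta ** ?A) $ i $ j = (eta ** ?A) $ j $ i + (eta ** ?A) $ i $ j"
        by (simp add: transpose_def)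
      show ?thesis unfolding e eta_mult
        by (cases i rule: idx_cases; cases j rule: idx_cases) (simp_all add: conf_tensor_def ea)
    qed
    then show ?thesis by (simp add: so_alg_def vec_eq_iff)
  qed
  then show ?thesis using l by (simp add: conn_space_def)
qed

context Q_sub
begin

lemma flat_torsion: "intrinsic_torsion_in flat (\<lambda>_ _. eta) W"
  unfolding intrinsic_torsion_in_def
proof (intro ballI allI impI)
  fix c and V :: "(real^'m idx) set" and F x
  assume c: "c \<in> atlas flat" and h: "open V \<and> V \<subseteq> snd c ` fst c \<and> smooth_on V F \<and>
    (\<forall>x\<in>V. F x \<in> adapted_frames flat (\<lambda>_ _. eta) c x)" and x: "x \<in> V"
  have "conn_form (\<lambda>_. eta) F x u - 0 \<in> q_alg" for u
    using conn_form_flat[of V x F "F x *v u"] h x smooth_differentiable[of V F x]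
    by (simp add: conn_form_def christoffel_const adapted_frames_def)
  then have "torsion_class (conn_form (\<lambda>_. eta) F x) = torsion_class (\<lambda>_. 0)"
    by (rule torsion_class_cong)
  then show "torsion_class (conn_form (\<lambda>_. eta) F x) \<in> W"
    using Wt_zero by (simp add: Wt_def)
qed

text \<open>Conformal invariance is applied to the flat metric, whose torsion lies in every
  submodule, and the conclusion is read off at the origin in the rescaled standard frame.\<close>

lemma conf_in_Wt:
  assumes ci: "conformally_invariant W"
  shows "conf_tensor b \<in> Wt"
proof -
  let ?g = "\<lambda>_ x. exp ((2 *\<^sub>R b) \<bullet> x) *\<^sub>R eta :: real^'m idx^'m idx"
  let ?F = "\<lambda>x. exp ((- b) \<bullet> x) *\<^sub>R (mat 1 :: real^'m idx^'m idx)"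
  have "(\<lambda>_ _. eta) \<in> conf_class flat"
    unfolding flat_conf by (intro exI[of _ "\<lambda>_. 1"]) (simp add: smooth_const)
  moreover have "?g \<in> conf_class flat"
    unfolding flat_conf using smooth_exp[of UNIV "2 *\<^sub>R b" "1::real"]
    by (intro exI[of _ "\<lambda>x. exp ((2 *\<^sub>R b) \<bullet> x)"]) simp
  ultimately have it: "intrinsic_torsion_in flat ?g W"
    using ci flat_manifold flat_torsion unfolding conformally_invariant_def by blast
  have ad: "?F x \<in> adapted_frames flat ?g (UNIV, id) x" for x
  proof -
    have e: "exp (- (b \<bullet> x)) * (exp (2 * (b \<bullet> x)) * exp (- (b \<bullet> x))) = 1"
      by (simp add: exp_add[symmetric])
    have "transpose (?F x) ** ?g (UNIV, id) x ** ?F x = eta"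
      by (simp add: transpose_scaleR transpose_mat matrix_scaleR_left matrix_scaleR_right e mult.assoc mult.left_commute)
    moreover have "(*v) (cmat (?F x)) ` N_model = N_model"
    proof -
      let ?e = "complex_of_real (exp (- (b \<bullet> x)))"
      have "cmat (?F x) *v v = ?e *s v" for v by (simp add: cmat_scaleR)
      then have i: "(*v) (cmat (?F x)) ` N_model = (*s) ?e ` N_model" by simp
      show ?thesis unfolding i
      proof
        show "(*s) ?e ` N_model \<subseteq> (N_model :: (complex^'m idx) set)" by (auto intro: vec.subspace_scale[OF N_subspace])
        show "(N_model :: (complex^'m idx) set) \<subseteq> (*s) ?e ` N_model"
        proof
          fix v :: "complex^'m idx" assume "v \<in> N_model"
          then have "(1 / ?e) *s v \<in> N_model" by (rule vec.subspace_scale[OF N_subspace])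
          moreover have "v = ?e *s ((1 / ?e) *s v)" by simp
          ultimately show "v \<in> (*s) ?e ` N_model" by (rule_tac image_eqI)
        qed
      qed
    qed
    moreover have "(?F x *v axis ik 1) \<bullet> (?g (UNIV, id) x *v future flat (UNIV, id) x) < 0"
    proof -
      have "axis ik 1 \<bullet> (eta *v (axis ik 1 - axis il 1 :: real^'m idx)) = - 1"
        by (simp add: inner_vec_def matrix_vector_mult_def UNIV_idx_sum axis_def)
      then show ?thesis
        by (simp add: scaleR_matrix_vector_assoc[symmetric] mult_less_0_iff)
    qed
    ultimately show ?thesis by (simp add: adapted_frames_def)
  qed
  have "torsion_class (conn_form (?g (UNIV, id)) ?F 0) \<in> W"
    by (rule it[unfolded intrinsic_torsion_in_def, rule_format, of "(UNIV, id)" UNIV ?F])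
      (use ad smooth_exp[of UNIV "- b" "mat 1 :: real^'m idx^'m idx"] in auto)
  then show ?thesis unfolding conn_form_conf using conf_tensor_conn by (simp add: Wt_def)
qed

end

lemma associated_bundle_Inter:
  assumes "W = U \<inter> \<Inter> F"
  shows "associated_bundle M g W = associated_bundle M g U \<inter> (\<Inter>S\<in>F. associated_bundle M g S)"
  unfolding assms associated_bundle_def Let_def by auto

theorem theorem5p4:
  fixes M :: "('p, 'm::finite) robinson_data"
    and g :: "('p, 'm) metric_field"
    and W :: "('m tensor set) set"
  assumes "CARD('m) > 1"
    and "almost_conformal_robinson_manifold M"
    and "g \<in> conf_class M"
    and "Q_submodule W"
    and "conformally_invariant W"
  shows "\<exists>F \<subseteq> distinguished_submodules.
    associated_bundle M g W =
      associated_bundle M g torsion_module \<inter> (\<Inter>S\<in>F. associated_bundle M g S)"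
proof (intro exI conjI)
  interpret Q_sub W using assms(4) by unfold_locales
  interpret conf_sub W using conf_in_Wt[OF assms(5)] assms(1) by unfold_locales
  show "{S \<in> distinguished_submodules. W \<subseteq> S} \<subseteq> distinguished_submodules" by blast
  show "associated_bundle M g W = associated_bundle M g torsion_module
      \<inter> (\<Inter>S\<in>{S \<in> distinguished_submodules. W \<subseteq> S}. associated_bundle M g S)"
    by (rule associated_bundle_Inter[OF eq_Inter_distinguished])
qed

end
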